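(* Let $(G,F)$ be a framed graph. Then (1) the join-irreducible elements of the framing lattice $\mathscr L_{G,F}$ are in bijection with the ccw-extended paths of $(G,F)$; (2) the meet-irreducible elements of $\mathscr L_{G,F}$ are in bijection with the cw-extended paths of $(G,F)$.
   Context: A flow graph $G$ is a finite directed acyclic multigraph with linearly ordered vertices, edges directed from smaller to larger vertices, a unique source $s$ and unique sink $t$; a route is a directed $s$–$t$ path. A framing $F$ gives at each vertex $v$ linear orders $\le_{\mathrm{In}(v)}$, $\le_{\mathrm{Out}(v)}$ on entering and leaving edges. For a path $P$ through $v$, $Pv$ (resp. $vP$) is the maximal subpath of $P$ ending (resp. starting) at $v$. For $Pv,Qv$, let $w$ be the first vertex after which they coincide; if $w$ is the first vertex of one of them they are equal, else $Pv<_{\mathscr I(v)}Qv$ iff $P$'s edge entering $w$ precedes $Q$'s in $\le_{\mathrm{In}(w)}$. Dually for $vP,vQ$ with $w'$ the last vertex before which they coincide, using $\le_{\mathrm{Out}(w')}$, giving $<_{\mathscr O(v)}$. For paths $P,Q$ with common inner vertex $v$, $P<_v^{cw}Q$ means $Pv<_{\mathscr I(v)}Qv$ and $vQ<_{\mathscr O(v)}vP$; they are incoherent at $v$ if $P<_v^{cw}Q$ or $Q<_v^{cw}P$, coherent if incoherent at no common inner vertex. A clique is a set of pairwise coherent routes. For maximal cliques, $C\lessdot C'$ if $C'=(C\setminus\{R\})\cup\{R'\}$ with $R<_u^{cw}R'$ for some $u$; the framing lattice $\mathscr L_{G,F}$ is the set of maximal cliques with the reflexive-transitive closure of $\lessdot$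 (it is a finite lattice). For a path $\widetilde P$ with at least two edges, let $e_1$ be its first edge, $e_2$ its last edge, $w_1$ the head of $e_1$ and $w_2$ the tail of $e_2$. $\widetilde P$ is a cw-extended path if $e_1$ is not maximal in $\le_{\mathrm{In}(w_1)}$ and $e_2$ is not minimal in $\le_{\mathrm{Out}(w_2)}$; it is a ccw-extended path if $e_1$ is not minimal in $\le_{\mathrm{In}(w_1)}$ and $e_2$ is not maximal in $\le_{\mathrm{Out}(w_2)}$. *)

theory Defs
  imports "Graph_Theory.Kuratowski" "HOL-Algebra.Order"
begin

locale flow_graph = fin_digraph G for G :: "('v::linorder, 'e) pre_digraph" +
  assumes tail_less_head: "e \<in> arcs G \<Longrightarrow> tail G e < head G e"
    and unique_source: "\<exists>!s. s \<in> verts G \<and> in_arcs G s = {}"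
    and unique_sink: "\<exists>!t. t \<in> verts G \<and> out_arcs G t = {}"

definition source :: "('v, 'e) pre_digraph \<Rightarrow> 'v" where
  "source G = (THE s. s \<in> verts G \<and> in_arcs G s = {})"

definition sink :: "('v, 'e) pre_digraph \<Rightarrow> 'v" where
  "sink G = (THE t. t \<in> verts G \<and> out_arcs G t = {})"

record ('v, 'e) framing =
  in_order :: "'v \<Rightarrow> 'e rel"
  out_order :: "'v \<Rightarrow> 'e rel"

locale framed_graph = flow_graph G for G :: "('v::linorder, 'e) pre_digraph" +
  fixes F :: "('v, 'e) framing"
  assumes linear_in_order: "v \<in> verts G \<Longrightarrow> linear_order_on (in_arcs G v) (in_order F v)"
    and linear_out_order: "v \<in> verts G \<Longrightarrow> linear_order_on (out_arcs G v) (out_order F v)"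

text \<open>
  Since \<open>G\<close> is a multigraph, a path is the list of its edges, from its first to its last edge.
\<close>

definition route :: "('v, 'e) pre_digraph \<Rightarrow> 'e list \<Rightarrow> bool" where
  "route G P \<longleftrightarrow> pre_digraph.apath G (source G) P (sink G)"

text \<open>
  The paths \<open>Pv\<close> and \<open>vP\<close>, for a path \<open>P\<close> through \<open>v\<close>: the edge list is cut just before the
  edge of \<open>P\<close> that leaves \<open>v\<close>, if there is one.
\<close>

definition path_to :: "('v, 'e) pre_digraph \<Rightarrow> 'e list \<Rightarrow> 'v \<Rightarrow> 'e list" where
  "path_to G P v = takeWhile (\<lambda>e. tail G e \<noteq> v) P"

definition path_from :: "('v, 'e) pre_digraph \<Rightarrow> 'v \<Rightarrow> 'e list \<Rightarrow> 'e list" where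
  "path_from G v P = dropWhile (\<lambda>e. tail G e \<noteq> v) P"

text \<open>
  The strict orders \<open><\<^sub>\<I>\<^sub>(\<^sub>v\<^sub>)\<close> and \<open><\<^sub>\<O>\<^sub>(\<^sub>v\<^sub>)\<close>. In \<open>in_less\<close>, \<open>S\<close> is the longest common final part
  of \<open>Pv\<close> and \<open>Qv\<close>, and \<open>e\<close> and \<open>f\<close> are the edges of \<open>P\<close> and \<open>Q\<close> entering the vertex \<open>w\<close> at
  which \<open>S\<close> starts, so that \<open>w = head G e = head G f\<close>; no such decomposition exists if \<open>w\<close> is the
  first vertex of \<open>Pv\<close> or of \<open>Qv\<close>. Dually for \<open>out_less\<close>.
\<close>

definition in_less ::
    "('v, 'e) pre_digraph \<Rightarrow> ('v, 'e) framing \<Rightarrow> 'v \<Rightarrow> 'e list \<Rightarrow> 'e list \<Rightarrow> bool" where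
  "in_less G F v P Q \<longleftrightarrow>
     (\<exists>A B S e f. path_to G P v = A @ e # S \<and> path_to G Q v = B @ f # S \<and>
        e \<noteq> f \<and> (e, f) \<in> in_order F (head G e))"

definition out_less ::
    "('v, 'e) pre_digraph \<Rightarrow> ('v, 'e) framing \<Rightarrow> 'v \<Rightarrow> 'e list \<Rightarrow> 'e list \<Rightarrow> bool" where
  "out_less G F v P Q \<longleftrightarrow>
     (\<exists>S A B e f. path_from G v P = S @ e # A \<and> path_from G v Q = S @ f # B \<and>
        e \<noteq> f \<and> (e, f) \<in> out_order F (tail G e))"

definition common_inner_vertex ::
    "('v, 'e) pre_digraph \<Rightarrow> 'e list \<Rightarrow> 'e list \<Rightarrow> 'v \<Rightarrow> bool" where
  "common_inner_vertex G P Q v \<longleftrightarrow>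
     v \<in> set (pre_digraph.inner_verts G P) \<and> v \<in> set (pre_digraph.inner_verts G Q)"

definition cw_less ::
    "('v, 'e) pre_digraph \<Rightarrow> ('v, 'e) framing \<Rightarrow> 'v \<Rightarrow> 'e list \<Rightarrow> 'e list \<Rightarrow> bool" where
  "cw_less G F v P Q \<longleftrightarrow>
     common_inner_vertex G P Q v \<and> in_less G F v P Q \<and> out_less G F v Q P"

definition incoherent_at ::
    "('v, 'e) pre_digraph \<Rightarrow> ('v, 'e) framing \<Rightarrow> 'v \<Rightarrow> 'e list \<Rightarrow> 'e list \<Rightarrow> bool" where
  "incoherent_at G F v P Q \<longleftrightarrow> cw_less G F v P Q \<or> cw_less G F v Q P"

definition coherent ::
    "('v, 'e) pre_digraph \<Rightarrow> ('v, 'e) framing \<Rightarrow> 'e list \<Rightarrow> 'e list \<Rightarrow> bool" where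
  "coherent G F P Q \<longleftrightarrow> (\<forall>v. common_inner_vertex G P Q v \<longrightarrow> \<not> incoherent_at G F v P Q)"

definition clique :: "('v, 'e) pre_digraph \<Rightarrow> ('v, 'e) framing \<Rightarrow> 'e list set \<Rightarrow> bool" where
  "clique G F C \<longleftrightarrow> (\<forall>P\<in>C. route G P) \<and> pairwise (coherent G F) C"

definition maximal_clique ::
    "('v, 'e) pre_digraph \<Rightarrow> ('v, 'e) framing \<Rightarrow> 'e list set \<Rightarrow> bool" where
  "maximal_clique G F C \<longleftrightarrow> clique G F C \<and> (\<forall>D. clique G F D \<and> C \<subseteq> D \<longrightarrow> D = C)"

definition up_flip ::
    "('v, 'e) pre_digraph \<Rightarrow> ('v, 'e) framing \<Rightarrow> 'e list set \<Rightarrow> 'e list set \<Rightarrow> bool" where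
  "up_flip G F C C' \<longleftrightarrow> maximal_clique G F C \<and> maximal_clique G F C' \<and>
     (\<exists>R R' u. R \<in> C \<and> C' = (C - {R}) \<union> {R'} \<and> cw_less G F u R R')"

definition framing_lattice ::
    "('v, 'e) pre_digraph \<Rightarrow> ('v, 'e) framing \<Rightarrow> 'e list set gorder" where
  "framing_lattice G F =
     \<lparr>carrier = {C. maximal_clique G F C}, eq = (=), le = (up_flip G F)\<^sup>*\<^sup>*\<rparr>"

text \<open>
  An element of a lattice is join-irreducible if it is not the bottom element and is not the join
  of two elements different from it; dually for meet-irreducible. Joins and meets are expressed
  by \<^const>\<open>least\<close> and \<^const>\<open>greatest\<close>, so that the definitions do not presuppose that they exist.
\<close>

definition join_irreducible :: "('a, 'm) gorder_scheme \<Rightarrow> 'a \<Rightarrow> bool" where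
  "join_irreducible L x \<longleftrightarrow> x \<in> carrier L \<and> \<not> least L x (carrier L) \<and>
     (\<forall>a\<in>carrier L. \<forall>b\<in>carrier L. is_lub L x {a, b} \<longrightarrow> x = a \<or> x = b)"

definition meet_irreducible :: "('a, 'm) gorder_scheme \<Rightarrow> 'a \<Rightarrow> bool" where
  "meet_irreducible L x \<longleftrightarrow> x \<in> carrier L \<and> \<not> greatest L x (carrier L) \<and>
     (\<forall>a\<in>carrier L. \<forall>b\<in>carrier L. is_glb L x {a, b} \<longrightarrow> x = a \<or> x = b)"

definition cw_extended_path ::
    "('v, 'e) pre_digraph \<Rightarrow> ('v, 'e) framing \<Rightarrow> 'e list \<Rightarrow> bool" where
  "cw_extended_path G F P \<longleftrightarrow>
     (\<exists>u v. pre_digraph.apath G u P v) \<and> 2 \<le> length P \<and>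
     (\<exists>f. f \<noteq> hd P \<and> (hd P, f) \<in> in_order F (head G (hd P))) \<and>
     (\<exists>f. f \<noteq> last P \<and> (f, last P) \<in> out_order F (tail G (last P)))"

definition ccw_extended_path ::
    "('v, 'e) pre_digraph \<Rightarrow> ('v, 'e) framing \<Rightarrow> 'e list \<Rightarrow> bool" where
  "ccw_extended_path G F P \<longleftrightarrow>
     (\<exists>u v. pre_digraph.apath G u P v) \<and> 2 \<le> length P \<and>
     (\<exists>f. f \<noteq> hd P \<and> (f, hd P) \<in> in_order F (head G (hd P))) \<and>
     (\<exists>f. f \<noteq> last P \<and> (last P, f) \<in> out_order F (tail G (last P)))"

end

theory Submission
  imports Defs
begin

text \<open>
  For maximal cliques, \<open>C \<le> D\<close> in the framing lattice iff no route of \<open>D\<close> is cw-below a route of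
  \<open>C\<close>. Flips preserve this relation because a flip replaces \<open>R\<close> by \<open>R'\<close> while keeping the two routes
  obtained from \<open>R\<close> and \<open>R'\<close> by exchanging their ends; conversely, if \<open>C < D\<close> in this sense, then
  some downward flip of \<open>D\<close> stays above \<open>C\<close>. If two downward flips of \<open>D\<close> lead to distinct cliques, they
  remove distinct routes, so \<open>D\<close> is contained in the union of these cliques and hence is their join.
  Join-irreducible therefore means having exactly one downward flip.

  For a ccw-extended path \<open>P\<close>, the routes \<open>R\<close> which are not cw-below \<open>P\<close>, but such that everything
  cw-below \<open>R\<close> is cw-below \<open>P\<close>, form the least maximal clique without routes cw-below \<open>P\<close>. Its only
  downward flip removes the extension of \<open>P\<close> by minimal edges before and maximal edges after it, and
  every join-irreducible arises in this way from a unique \<open>P\<close>. Reversing the framing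
  exchanges join- and meet-irreducibles, and ccw- and cw-extended paths.
\<close>

text \<open>The obstacle is to find a downward flip of \<open>D\<close> that does not leave the
  cliques above a given \<open>C\<close>. The tool is a label: at a corner \<open>Y\<close>,
  \<open>X\<close>, \<open>Z\<close> of \<open>D\<close>, the segment of the removed route
  \<open>X\<close> from \<open>b\<close> to \<open>c\<close>, the edges at which \<open>X\<close>
  parts from \<open>Y\<close> on the way in and from \<open>Z\<close> on the way out. Every route of
  a clique above \<open>D\<close>'s lower neighbours may vary, but a route that is crossed from
  below by the inserted route and by no route of \<open>D\<close> must contain the whole label
  (\<open>label_subset\<close>). A corner is chosen whose label is crossed from below by some
  \<open>W\<close> in \<open>C\<close>. If the flip there failed to stay above \<open>C\<close>,
  some route of \<open>C\<close> would contain the label, and \<open>W\<close> would cross it,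
  against coherence of \<open>C\<close>. Since \<open>b\<close> has a smaller competitor and
  \<open>c\<close> a larger one, a label is a ccw-extended path. The path attached to a
  join-irreducible arises likewise from its downward flip: it is the stretch shared by the removed
  and the inserted route, together with the edges of the removed route that enter and leave
  it.\<close>

lemma finite_maximal_rel:
  assumes "finite A" "A \<noteq> {}" "\<And>x. x \<in> A \<Longrightarrow> \<not> r x x"
    "\<And>x y z. x \<in> A \<Longrightarrow> y \<in> A \<Longrightarrow> z \<in> A \<Longrightarrow> r x y \<Longrightarrow> r y z \<Longrightarrow> r x z"
  shows "\<exists>m\<in>A. \<forall>x\<in>A. \<not> r m x"
proof -
  have "transp_on A r" using assms(4) by (rule transp_onI)
  moreover have "asymp_on A r" using assms(3,4) by (intro asymp_onI) blast
  ultimately show ?thesis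
    using Finite_Set.bex_max_element[OF assms(1) _ _ assms(2), of r] assms(3) by metis
qed

section \<open>Routes as edge sets\<close>

text \<open>
  A framed graph is encoded by its edges, with integers \<open>lo e < hi e\<close> as tail and head, and by the
  strict framing orders \<open>il\<close> (on entering edges) and \<open>ol\<close> (on leaving edges). A route is the set of
  its edges. Then \<open>ltp v P Q\<close> compares \<open>Pv\<close> with \<open>Qv\<close> in the order \<open><\<^sub>\<I>\<^sub>(\<^sub>v\<^sub>)\<close> and \<open>lts v P Q\<close>
  compares \<open>vP\<close> with \<open>vQ\<close> in \<open><\<^sub>\<O>\<^sub>(\<^sub>v\<^sub>)\<close>, while \<open>cws w w' P Q\<close> says that \<open>P\<close> is cw-below \<open>Q\<close> with
  common segment from \<open>w\<close> to \<open>w'\<close>. The predicate \<open>mc\<close> singles out the maximal cliques, and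
  \<open>below\<close> will turn out to be the order of the framing lattice.
\<close>

locale framed_edges =
  fixes E :: "'e set" and lo hi :: "'e \<Rightarrow> int" and s t :: int
    and il ol :: "'e \<Rightarrow> 'e \<Rightarrow> bool"
  assumes finite_E: "finite E"
    and lo_less_hi: "e \<in> E \<Longrightarrow> lo e < hi e"
    and s_le_lo: "e \<in> E \<Longrightarrow> s \<le> lo e"
    and hi_le_t: "e \<in> E \<Longrightarrow> hi e \<le> t"
    and pred_ex: "e \<in> E \<Longrightarrow> lo e \<noteq> s \<Longrightarrow> \<exists>f\<in>E. hi f = lo e"
    and succ_ex: "e \<in> E \<Longrightarrow> hi e \<noteq> t \<Longrightarrow> \<exists>f\<in>E. lo f = hi e"
    and il_E: "il a b \<Longrightarrow> a \<in> E \<and> b \<in> E \<and> hi a = hi b"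
    and il_irrefl: "\<not> il a a"
    and il_trans: "il a b \<Longrightarrow> il b c \<Longrightarrow> il a c"
    and il_total: "a \<in> E \<Longrightarrow> b \<in> E \<Longrightarrow> hi a = hi b \<Longrightarrow> a \<noteq> b \<Longrightarrow> il a b \<or> il b a"
    and ol_E: "ol a b \<Longrightarrow> a \<in> E \<and> b \<in> E \<and> lo a = lo b"
    and ol_irrefl: "\<not> ol a a"
    and ol_trans: "ol a b \<Longrightarrow> ol b c \<Longrightarrow> ol a c"
    and ol_total: "a \<in> E \<Longrightarrow> b \<in> E \<Longrightarrow> lo a = lo b \<Longrightarrow> a \<noteq> b \<Longrightarrow> ol a b \<or> ol b a"
begin

definition strand :: "'e set \<Rightarrow> bool" where
  "strand P \<longleftrightarrow> P \<subseteq> E \<and> (\<forall>x\<in>P. \<forall>y\<in>P. x = y \<or> hi x \<le> lo y \<or> hi y \<le> lo x)"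

text \<open>The last conjunct excludes the empty set, which satisfies the others vacuously, unless
  source and sink coincide.\<close>

definition rte :: "'e set \<Rightarrow> bool" where
  "rte R \<longleftrightarrow> strand R \<and> (\<forall>x\<in>R. hi x = t \<or> (\<exists>y\<in>R. lo y = hi x)) \<and>
     (\<forall>x\<in>R. lo x = s \<or> (\<exists>y\<in>R. hi y = lo x)) \<and> (R = {} \<longrightarrow> s = t)"

definition pass :: "'e set \<Rightarrow> int \<Rightarrow> bool" where
  "pass P v \<longleftrightarrow> (\<exists>x\<in>P. hi x = v) \<and> (\<exists>x\<in>P. lo x = v)"

text \<open>An edge that straddles \<open>u\<close> or \<open>v\<close> is not compared. Hence
  agreements on adjacent intervals join only if no edge jumps over the point between them
  (\<open>agree_joinI\<close>).\<close>

definition agree :: "'e set \<Rightarrow> 'e set \<Rightarrow> int \<Rightarrow> int \<Rightarrow> bool" where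
  "agree P Q u v \<longleftrightarrow> (\<forall>x. u \<le> lo x \<longrightarrow> hi x \<le> v \<longrightarrow> (x \<in> P \<longleftrightarrow> x \<in> Q))"

text \<open>For routes through \<open>v\<close>, \<open>preeq v P Q\<close> is
  \<open>Pv = Qv\<close> and \<open>sufeq v P Q\<close> is \<open>vP = vQ\<close>.\<close>

definition preeq :: "int \<Rightarrow> 'e set \<Rightarrow> 'e set \<Rightarrow> bool" where
  "preeq v P Q \<longleftrightarrow> (\<forall>x. hi x \<le> v \<longrightarrow> (x \<in> P \<longleftrightarrow> x \<in> Q))"

definition sufeq :: "int \<Rightarrow> 'e set \<Rightarrow> 'e set \<Rightarrow> bool" where
  "sufeq v P Q \<longleftrightarrow> (\<forall>x. v \<le> lo x \<longrightarrow> (x \<in> P \<longleftrightarrow> x \<in> Q))"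

definition ltp :: "int \<Rightarrow> 'e set \<Rightarrow> 'e set \<Rightarrow> bool" where
  "ltp v P Q \<longleftrightarrow> (\<exists>a\<in>P. \<exists>b\<in>Q. hi a = hi b \<and> hi a \<le> v \<and> il a b \<and> agree P Q (hi a) v)"

definition lts :: "int \<Rightarrow> 'e set \<Rightarrow> 'e set \<Rightarrow> bool" where
  "lts v P Q \<longleftrightarrow> (\<exists>c\<in>P. \<exists>d\<in>Q. lo c = lo d \<and> v \<le> lo c \<and> ol c d \<and> agree P Q v (lo c))"

definition cws :: "int \<Rightarrow> int \<Rightarrow> 'e set \<Rightarrow> 'e set \<Rightarrow> bool" where
  "cws w w' P Q \<longleftrightarrow> w \<le> w' \<and> (\<exists>a\<in>P. \<exists>b\<in>Q. hi a = w \<and> hi b = w \<and> il a b) \<and>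
     (\<exists>c\<in>Q. \<exists>d\<in>P. lo c = w' \<and> lo d = w' \<and> ol c d) \<and> agree P Q w w'"

definition cw :: "'e set \<Rightarrow> 'e set \<Rightarrow> bool" where
  "cw P Q \<longleftrightarrow> (\<exists>w w'. cws w w' P Q)"

definition splice :: "'e set \<Rightarrow> int \<Rightarrow> 'e set \<Rightarrow> 'e set" where
  "splice A v B = {x\<in>A. hi x \<le> v} \<union> {x\<in>B. v \<le> lo x}"

text \<open>Connectedness is local, so the ends have to be supplied by the last conjunct; for
  \<open>u = v\<close> only the empty set remains.\<close>

definition path :: "'e set \<Rightarrow> int \<Rightarrow> int \<Rightarrow> bool" where
  "path M u v \<longleftrightarrow> strand M \<and> u \<le> v \<and>
     (\<forall>x\<in>M. u \<le> lo x \<and> hi x \<le> v \<and> (hi x = v \<or> (\<exists>y\<in>M. lo y = hi x)) \<and> (lo x = u \<or> (\<exists>y\<in>M. hi y = lo x))) \<and>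
     (u \<noteq> v \<longrightarrow> (\<exists>x\<in>M. lo x = u) \<and> (\<exists>x\<in>M. hi x = v))"

definition mc :: "'e set set \<Rightarrow> bool" where
  "mc C \<longleftrightarrow> (\<forall>R\<in>C. rte R) \<and> (\<forall>P\<in>C. \<forall>Q\<in>C. \<not> cw P Q) \<and>
     (\<forall>R. rte R \<longrightarrow> (\<forall>Q\<in>C. \<not> cw R Q \<and> \<not> cw Q R) \<longrightarrow> R \<in> C)"

definition below :: "'e set set \<Rightarrow> 'e set set \<Rightarrow> bool" where
  "below C D \<longleftrightarrow> (\<forall>P\<in>C. \<forall>Q\<in>D. \<not> cw Q P)"

text \<open>The common part \<open>D\<close> is explicit because several cliques
  \<open>insert R D\<close> over the same \<open>D\<close> will be compared.\<close>

definition flip :: "'e set set \<Rightarrow> 'e set set \<Rightarrow> bool" where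
  "flip C C' \<longleftrightarrow> mc C \<and> mc C' \<and>
     (\<exists>D R R'. R \<notin> D \<and> R' \<notin> D \<and> C = insert R D \<and> C' = insert R' D \<and> cw R R')"

text \<open>
  Reversing all edges together with the framing preserves \<open>cw\<close>, so that each statement about the
  part of a route before a vertex has a dual about the part after it.
\<close>

lemma framed_edges_rev:
  "framed_edges E (\<lambda>e. - hi e) (\<lambda>e. - lo e) (- t) (- s) (\<lambda>a b. ol b a) (\<lambda>a b. il b a)"
proof
  show "finite E" by (rule finite_E)
  show "\<exists>f\<in>E. - lo f = - hi e" if "e \<in> E" "- hi e \<noteq> - t" for e
    using succ_ex[of e] that by auto
  show "\<exists>f\<in>E. - hi f = - lo e" if "e \<in> E" "- lo e \<noteq> - s" for e
    using pred_ex[of e] that by auto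
qed (use lo_less_hi s_le_lo hi_le_t il_E il_irrefl ol_E ol_irrefl il_total ol_total
      in \<open>auto intro: il_trans ol_trans\<close>)

section \<open>Strands and agreement on intervals\<close>

lemma strand_sub: "strand P \<Longrightarrow> Q \<subseteq> P \<Longrightarrow> strand Q"
  unfolding strand_def by blast

lemma rte_strand: "rte R \<Longrightarrow> strand R"
  by (simp add: rte_def)

lemma strand_E: "strand P \<Longrightarrow> x \<in> P \<Longrightarrow> x \<in> E"
  by (auto simp: strand_def)

lemma strand_lt: "strand P \<Longrightarrow> x \<in> P \<Longrightarrow> lo x < hi x"
  by (simp add: strand_E lo_less_hi)

lemma strandD: "strand P \<Longrightarrow> x \<in> P \<Longrightarrow> y \<in> P \<Longrightarrow> x = y \<or> hi x \<le> lo y \<or> hi y \<le> lo x"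
  by (auto simp: strand_def)

lemma strand_hi_inj: "strand P \<Longrightarrow> x \<in> P \<Longrightarrow> y \<in> P \<Longrightarrow> hi x = hi y \<Longrightarrow> x = y"
  using strandD[of P x y] strand_lt[of P x] strand_lt[of P y] by auto

lemma strand_lo_inj: "strand P \<Longrightarrow> x \<in> P \<Longrightarrow> y \<in> P \<Longrightarrow> lo x = lo y \<Longrightarrow> x = y"
  using strandD[of P x y] strand_lt[of P x] strand_lt[of P y] by auto

lemma hi_split: "strand P \<Longrightarrow> x \<in> P \<Longrightarrow> y \<in> P \<Longrightarrow> hi x \<le> hi y \<or> hi y \<le> lo x"
  using strandD[of P x y] strand_lt[of P x] strand_lt[of P y] by auto

lemma lo_split: "strand P \<Longrightarrow> x \<in> P \<Longrightarrow> y \<in> P \<Longrightarrow> hi x \<le> lo y \<or> lo y \<le> lo x"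
  using strandD[of P x y] strand_lt[of P x] strand_lt[of P y] by auto

lemma pass_split: "strand P \<Longrightarrow> pass P v \<Longrightarrow> x \<in> P \<Longrightarrow> hi x \<le> v \<or> v \<le> lo x"
  unfolding pass_def using hi_split by blast

lemma agree_sym: "agree P Q u v \<Longrightarrow> agree Q P u v"
  by (auto simp: agree_def)

lemma agree_mono: "agree P Q u v \<Longrightarrow> u \<le> u' \<Longrightarrow> v' \<le> v \<Longrightarrow> agree P Q u' v'"
  by (auto simp: agree_def)

lemma agree_trans: "agree P Q u v \<Longrightarrow> agree Q R u v \<Longrightarrow> agree P R u v"
  by (auto simp: agree_def)

lemma agree_joinI:
  assumes "agree P Q u v" "agree P Q v w" "\<And>x. x \<in> P \<or> x \<in> Q \<Longrightarrow> hi x \<le> v \<or> v \<le> lo x"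
  shows "agree P Q u w"
  using assms unfolding agree_def by (meson order_trans)

lemma agree_join:
  assumes "agree P Q u v" "agree P Q v w" "strand P" "strand Q" "pass P v" "pass Q v"
  shows "agree P Q u w"
  using agree_joinI[OF assms(1,2)] pass_split assms(3-6) by blast

lemma preeq_refl [simp]: "preeq v P P" and preeq_sym: "preeq v P Q \<Longrightarrow> preeq v Q P"
  and preeq_trans: "preeq v P Q \<Longrightarrow> preeq v Q R \<Longrightarrow> preeq v P R"
  and preeq_mono: "preeq v P Q \<Longrightarrow> u \<le> v \<Longrightarrow> preeq u P Q"
  and preeq_agree: "preeq v P Q \<Longrightarrow> agree P Q u v"
  by (auto simp: preeq_def agree_def)

lemma sufeq_sym: "sufeq v P Q \<Longrightarrow> sufeq v Q P"
  and sufeq_trans: "sufeq v P Q \<Longrightarrow> sufeq v Q R \<Longrightarrow> sufeq v P R"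
  and sufeq_mono: "sufeq u P Q \<Longrightarrow> u \<le> v \<Longrightarrow> sufeq v P Q"
  and sufeq_agree: "sufeq v P Q \<Longrightarrow> agree P Q v u"
  by (auto simp: sufeq_def agree_def)

section \<open>The order on paths ending at a vertex\<close>

lemma ltpE:
  assumes "ltp v P Q"
  obtains a b where "a \<in> P" "b \<in> Q" "hi a = hi b" "hi a \<le> v" "il a b" "agree P Q (hi a) v"
  using assms by (auto simp: ltp_def)

lemma ltpI: "a \<in> P \<Longrightarrow> b \<in> Q \<Longrightarrow> hi a \<le> v \<Longrightarrow> il a b \<Longrightarrow> agree P Q (hi a) v \<Longrightarrow> ltp v P Q"
  using il_E by (force simp: ltp_def)

lemma ltp_at: "a \<in> P \<Longrightarrow> b \<in> Q \<Longrightarrow> hi a = v \<Longrightarrow> il a b \<Longrightarrow> P \<subseteq> E \<Longrightarrow> Q \<subseteq> E \<Longrightarrow> ltp v P Q"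
  by (rule ltpI) (use lo_less_hi in \<open>force simp: agree_def\<close>)+

lemma ltp_irrefl: "strand P \<Longrightarrow> \<not> ltp v P P"
  using strand_hi_inj il_irrefl by (metis ltpE)

text \<open>Seen backwards from \<open>v\<close>, \<open>A\<close> and \<open>C\<close> part at the
  later of the two vertices where \<open>B\<close> parts from \<open>A\<close> and from
  \<open>C\<close>: there \<open>B\<close> still uses the edge of the one from which it has not yet
  parted.\<close>

lemma ltp_trans:
  assumes "strand A" "strand B" "strand C" "ltp v A B" "ltp v B C"
  shows "ltp v A C"
proof -
  obtain a b where ab: "a \<in> A" "b \<in> B" "hi a = hi b" "hi a \<le> v" "il a b" "agree A B (hi a) v"
    using assms(4) by (rule ltpE)
  obtain b' c where bc: "b' \<in> B" "c \<in> C" "hi b' = hi c" "hi b' \<le> v" "il b' c" "agree B C (hi b') v"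
    using assms(5) by (rule ltpE)
  consider "hi b = hi b'" | "hi b < hi b'" | "hi b' < hi b" by linarith
  then show ?thesis
  proof cases
    case 1
    then have "b = b'" using strand_hi_inj assms(2) ab bc by blast
    then show ?thesis using ab bc il_trans agree_trans by (metis ltpI)
  next
    case 2
    then have "hi b \<le> lo b'" using strandD[OF assms(2) ab(2) bc(1)] strand_lt[OF assms(2) ab(2)]
        strand_lt[OF assms(2) bc(1)] by auto
    then have "b' \<in> A" using ab bc by (auto simp: agree_def)
    moreover have "agree A C (hi b') v"
      using agree_trans[OF agree_mono[OF ab(6), of "hi b'" v] bc(6)] 2 ab by auto
    ultimately show ?thesis using bc by (intro ltpI[of b' A c]) auto
  next
    case 3
    then have "hi b' \<le> lo b" using strandD[OF assms(2) ab(2) bc(1)] strand_lt[OF assms(2) ab(2)]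
        strand_lt[OF assms(2) bc(1)] by auto
    then have "b \<in> C" using ab bc by (auto simp: agree_def)
    moreover have "agree A C (hi a) v"
      using agree_trans[OF ab(6) agree_mono[OF bc(6), of "hi a" v]] 3 ab by auto
    ultimately show ?thesis using ab by (intro ltpI[of a A b]) auto
  qed
qed

lemma ltp_asym: "strand A \<Longrightarrow> strand B \<Longrightarrow> ltp v A B \<Longrightarrow> \<not> ltp v B A"
  using ltp_trans ltp_irrefl by blast

lemma ltp_cong1:
  assumes "preeq v A A'" "ltp v A B"
  shows "ltp v A' B"
proof -
  obtain a b where ab: "a \<in> A" "b \<in> B" "hi a = hi b" "hi a \<le> v" "il a b" "agree A B (hi a) v"
    using assms(2) by (rule ltpE)
  have "agree A' B (hi a) v"
    using agree_trans[OF preeq_agree[OF preeq_sym[OF assms(1)]] ab(6)] .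
  moreover have "a \<in> A'" using assms(1) ab by (auto simp: preeq_def)
  ultimately show ?thesis using ab ltpI[of a A' b B v] by auto
qed

lemma ltp_cong2:
  assumes "preeq v B B'" "ltp v A B"
  shows "ltp v A B'"
proof -
  obtain a b where ab: "a \<in> A" "b \<in> B" "hi a = hi b" "hi a \<le> v" "il a b" "agree A B (hi a) v"
    using assms(2) by (rule ltpE)
  have "agree A B' (hi a) v"
    using agree_trans[OF ab(6) preeq_agree[OF assms(1)]] .
  moreover have "b \<in> B'" using assms(1) ab by (auto simp: preeq_def)
  ultimately show ?thesis using ab ltpI[of a A b B' v] by auto
qed

lemma pass_hi_less_t: "rte A \<Longrightarrow> pass A v \<Longrightarrow> s < v \<and> v < t"
  unfolding pass_def
  by (metis rte_strand strand_E strand_lt hi_le_t s_le_lo order_less_le_trans order_le_less_trans)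

lemma in_pass: "rte A \<Longrightarrow> x \<in> A \<Longrightarrow> hi x < t \<Longrightarrow> pass A (hi x)"
  unfolding pass_def rte_def by force

lemma out_pass: "rte A \<Longrightarrow> x \<in> A \<Longrightarrow> s < lo x \<Longrightarrow> pass A (lo x)"
  unfolding pass_def rte_def by force

lemma strand_finite: "strand A \<Longrightarrow> finite A"
  using finite_E by (auto simp: strand_def intro: finite_subset)

text \<open>The comparison is decided at the edge with maximal head among those before
  \<open>v\<close> that lie on exactly one of the routes.\<close>

lemma ltp_total:
  assumes A: "rte A" and B: "rte B" and pA: "pass A v" and pB: "pass B v"
  shows "ltp v A B \<or> ltp v B A \<or> preeq v A B"
proof (rule ccontr)
  assume neg: "\<not> ?thesis"
  note sA = rte_strand[OF A] and sB = rte_strand[OF B]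
  have vt: "v < t" using pass_hi_less_t[OF A pA] by simp
  define D where "D = {x \<in> A \<union> B. hi x \<le> v \<and> \<not> (x \<in> A \<and> x \<in> B)}"
  have ne: "D \<noteq> {}" using neg unfolding D_def preeq_def by blast
  have fin: "finite D" using strand_finite[OF sA] strand_finite[OF sB] by (auto simp: D_def)
  obtain x where x: "x \<in> D" "hi x = Max (hi ` D)"
    using Max_in[of "hi ` D"] ne fin by fastforce
  have xmax: "hi y \<le> hi x" if "y \<in> D" for y
    using Max_ge[of "hi ` D" "hi y"] fin that x by simp
  \<comment> \<open>Stated for both assignments of \<open>P\<close>, \<open>Q\<close> to
    \<open>A\<close>, \<open>B\<close>, since \<open>x\<close> may lie on either route.\<close>
  have main: "ltp v P Q \<or> ltp v Q P"
    if P: "rte P" and Q: "rte Q" and pP: "pass P v" and pQ: "pass Q v" and PQ: "{P, Q} = {A, B}"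
      and xP: "x \<in> P" and xQ: "x \<notin> Q" for P Q
  proof -
    note sP = rte_strand[OF P] and sQ = rte_strand[OF Q]
    have xv: "hi x \<le> v" using x by (auto simp: D_def)
    have Dm: "y \<in> P \<longleftrightarrow> y \<in> Q" if "hi y \<le> v" "hi x < hi y" for y
    proof -
      have "y \<notin> D" using xmax[of y] that by auto
      then show ?thesis using that PQ by (auto simp: D_def doubleton_eq_iff)
    qed
    \<comment> \<open>Beyond \<open>hi x\<close> the routes coincide, so the edge of
      \<open>P\<close> following \<open>x\<close> is also on \<open>Q\<close>, and \<open>Q\<close>
      has to enter its tail.\<close>
    have "\<exists>y\<in>Q. hi y = hi x"
    proof (cases "hi x = v")
      case True
      then show ?thesis using pQ by (auto simp: pass_def)
    next
      case False
      then have xv': "hi x < v" using xv by simp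
      then have "pass P (hi x)" using in_pass[OF P xP] vt by simp
      then obtain z where z: "z \<in> P" "lo z = hi x" by (auto simp: pass_def)
      have zv: "hi z \<le> v" using pass_split[OF sP pP z(1)] xv' z by auto
      have "z \<in> Q" using Dm[OF zv] z strand_lt[OF sP z(1)] by auto
      moreover have "s < lo z" using z strand_lt[OF sP xP] s_le_lo[OF strand_E[OF sP xP]] by auto
      ultimately have "pass Q (lo z)" using out_pass[OF Q] by blast
      then show ?thesis using z by (auto simp: pass_def)
    qed
    then obtain y where y: "y \<in> Q" "hi y = hi x" by blast
    have "agree P Q (hi x) v"
      unfolding agree_def
    proof (intro allI impI)
      fix z assume "hi x \<le> lo z" "hi z \<le> v"
      then show "z \<in> P \<longleftrightarrow> z \<in> Q"
        using Dm[of z] strand_lt[OF sP, of z] strand_lt[OF sQ, of z] by force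
    qed
    moreover have "il x y \<or> il y x"
      using il_total strand_E sP sQ xP y xQ by metis
    ultimately show ?thesis
      using ltpI[of x P y Q v] ltpI[of y Q x P v] xP y xv agree_sym[of P Q "hi x" v] by auto
  qed
  show False
    using main[OF A B pA pB] main[OF B A pB pA] x(1) neg by (auto simp: D_def doubleton_eq_iff)
qed

section \<open>Duality under reversal of edges\<close>

interpretation rv: framed_edges E "\<lambda>e. - hi e" "\<lambda>e. - lo e" "- t" "- s" "\<lambda>a b. ol b a" "\<lambda>a b. il b a"
  by (rule framed_edges_rev)

lemma rv_strand: "rv.strand P \<longleftrightarrow> strand P"
  by (auto simp: rv.strand_def strand_def)

lemma rv_rte: "rv.rte P \<longleftrightarrow> rte P"
  by (auto simp: rv.rte_def rte_def rv_strand)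

lemma rv_pass: "rv.pass P v \<longleftrightarrow> pass P (- v)"
  unfolding rv.pass_def pass_def by (metis minus_minus)

lemma rv_agree: "rv.agree P Q u v \<longleftrightarrow> agree P Q (- v) (- u)"
  unfolding rv.agree_def agree_def by (metis le_minus_iff minus_le_iff)

lemma rv_preeq: "rv.preeq v P Q \<longleftrightarrow> sufeq (- v) P Q"
  unfolding rv.preeq_def sufeq_def by (metis minus_le_iff)

lemma rv_sufeq: "rv.sufeq v P Q \<longleftrightarrow> preeq (- v) P Q"
  unfolding rv.sufeq_def preeq_def by (metis le_minus_iff)

text \<open>The arguments are exchanged because the order on entering edges of the reversed
  structure is the converse of \<open>ol\<close>; this is what makes \<open>cw\<close>
  self-dual.\<close>

lemma rv_ltp: "rv.ltp v P Q \<longleftrightarrow> lts (- v) Q P"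
  unfolding rv.ltp_def lts_def rv_agree by (auto simp: minus_le_iff) (metis agree_sym)+

lemma rv_lts: "rv.lts v P Q \<longleftrightarrow> ltp (- v) Q P"
  unfolding rv.lts_def ltp_def rv_agree by (auto simp: le_minus_iff) (metis agree_sym)+

lemma rv_cws: "rv.cws w w' P Q \<longleftrightarrow> cws (- w') (- w) P Q"
  unfolding rv.cws_def cws_def rv_agree minus_equation_iff[of "lo _"] minus_equation_iff[of "hi _"]
  by (auto simp: eq_commute[of "- w"] eq_commute[of "- w'"])

lemma rv_cw: "rv.cw P Q \<longleftrightarrow> cw P Q"
  unfolding rv.cw_def cw_def rv_cws by (metis minus_minus)

lemma rv_splice: "rv.splice A v B = splice B (- v) A"
  by (auto simp: rv.splice_def splice_def)

lemmas rv_simps = rv_strand rv_rte rv_pass rv_agree rv_preeq rv_sufeq rv_ltp rv_lts rv_cws rv_cw rv_splice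
  minus_minus

lemma ltsE:
  assumes "lts v P Q"
  obtains c d where "c \<in> P" "d \<in> Q" "lo c = lo d" "v \<le> lo c" "ol c d" "agree P Q v (lo c)"
  using assms by (auto simp: lts_def)

lemma ltsI: "c \<in> P \<Longrightarrow> d \<in> Q \<Longrightarrow> v \<le> lo c \<Longrightarrow> ol c d \<Longrightarrow> agree P Q v (lo c) \<Longrightarrow> lts v P Q"
  using ol_E by (force simp: lts_def)

lemma lts_at: "c \<in> P \<Longrightarrow> d \<in> Q \<Longrightarrow> lo c = v \<Longrightarrow> ol c d \<Longrightarrow> P \<subseteq> E \<Longrightarrow> Q \<subseteq> E \<Longrightarrow> lts v P Q"
  by (rule ltsI) (use lo_less_hi in \<open>force simp: agree_def\<close>)+

lemma lts_irrefl: "strand P \<Longrightarrow> \<not> lts v P P"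
  using framed_edges.ltp_irrefl[OF framed_edges_rev, of P "- v", unfolded rv_simps] by auto

lemma lts_trans: "strand A \<Longrightarrow> strand B \<Longrightarrow> strand C \<Longrightarrow> lts v A B \<Longrightarrow> lts v B C \<Longrightarrow> lts v A C"
  using framed_edges.ltp_trans[OF framed_edges_rev, of C B A "- v", unfolded rv_simps] by auto

lemma lts_cong1: "sufeq v A A' \<Longrightarrow> lts v A B \<Longrightarrow> lts v A' B"
  using framed_edges.ltp_cong2[OF framed_edges_rev, of "- v" A A' B, unfolded rv_simps] by auto

lemma lts_cong2: "sufeq v B B' \<Longrightarrow> lts v A B \<Longrightarrow> lts v A B'"
  using framed_edges.ltp_cong1[OF framed_edges_rev, of "- v" B B' A, unfolded rv_simps] by auto

lemma lts_total:
  "rte A \<Longrightarrow> rte B \<Longrightarrow> pass A v \<Longrightarrow> pass B v \<Longrightarrow> lts v A B \<or> lts v B A \<or> sufeq v A B"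
  using framed_edges.ltp_total[OF framed_edges_rev, of A B "- v", unfolded rv_simps] by auto

lemma ltp_up:
  assumes "strand A" "strand B" "pass A u" "pass B u" "ltp u A B" "agree A B u v" "u \<le> v"
  shows "ltp v A B"
proof -
  obtain a b where ab: "a \<in> A" "b \<in> B" "hi a = hi b" "hi a \<le> u" "il a b" "agree A B (hi a) u"
    using assms(5) by (rule ltpE)
  show ?thesis
    using ab agree_join[OF ab(6) assms(6,1-4)] assms(7) ltpI[of a A b B v] by auto
qed

lemma lts_down:
  "strand A \<Longrightarrow> strand B \<Longrightarrow> pass A u \<Longrightarrow> pass B u \<Longrightarrow> lts u A B \<Longrightarrow> agree A B v u \<Longrightarrow> v \<le> u
    \<Longrightarrow> lts v A B"
  using framed_edges.ltp_up[OF framed_edges_rev, of B A "- u" "- v", unfolded rv_simps] by (auto intro: agree_sym)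

text \<open>If the deciding edge of \<open>A\<close> lay beyond \<open>u\<close>, the agreement from
  \<open>u\<close> to \<open>v\<close> would put it on \<open>B\<close> as well.\<close>

lemma ltp_down:
  assumes "strand A" "strand B" "pass A u" "ltp v A B" "agree A B u v" "u \<le> v"
  shows "ltp u A B"
proof -
  obtain a b where ab: "a \<in> A" "b \<in> B" "hi a = hi b" "hi a \<le> v" "il a b" "agree A B (hi a) v"
    using assms(4) by (rule ltpE)
  have "\<not> u \<le> lo a"
  proof
    assume "u \<le> lo a"
    then have "a \<in> B" using assms(5) ab by (auto simp: agree_def)
    then have "a = b" using strand_hi_inj assms(2) ab by blast
    then show False using ab il_irrefl by blast
  qed
  then have "hi a \<le> u" using pass_split[OF assms(1,3) ab(1)] by auto
  then show ?thesis using ab ltpI[of a A b B u] agree_mono[OF ab(6), of "hi a" u] assms(6) by auto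
qed

lemma cwsI:
  "a \<in> P \<Longrightarrow> b \<in> Q \<Longrightarrow> hi a = w \<Longrightarrow> il a b \<Longrightarrow> c \<in> Q \<Longrightarrow> d \<in> P \<Longrightarrow> lo c = w' \<Longrightarrow> ol c d \<Longrightarrow> w \<le> w' \<Longrightarrow>
    agree P Q w w' \<Longrightarrow> cws w w' P Q"
  using il_E[of a b] ol_E[of c d] unfolding cws_def by auto

lemma cwsE:
  assumes "cws w w' P Q"
  obtains a b c d where "a \<in> P" "b \<in> Q" "c \<in> Q" "d \<in> P" "hi a = w" "hi b = w" "lo c = w'" "lo d = w'"
    "il a b" "ol c d" "w \<le> w'" "agree P Q w w'"
  using assms that unfolding cws_def by (elim conjE bexE)

lemma cws_at:
  assumes "cws w w' P Q" "w \<le> v" "v \<le> w'"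
  shows "ltp v P Q" "lts v Q P"
proof -
  obtain a b c d where *: "a \<in> P" "b \<in> Q" "c \<in> Q" "d \<in> P" "hi a = w" "hi b = w" "lo c = w'" "lo d = w'"
    "il a b" "ol c d" "w \<le> w'" "agree P Q w w'" using assms(1) by (rule cwsE)
  show "ltp v P Q" using * assms agree_mono[OF *(12), of w v] ltpI[of a P b Q v] by auto
  show "lts v Q P" using * assms agree_sym[OF agree_mono[OF *(12), of v w']] ltsI[of c Q d P v] by auto
qed

lemma ltp_hi_ex:
  assumes "ltp v P Q" "strand P" "\<exists>x\<in>P. hi x = v"
  shows "\<exists>x\<in>Q. hi x = v"
proof -
  obtain a b where ab: "a \<in> P" "b \<in> Q" "hi a = hi b" "hi a \<le> v" "il a b" "agree P Q (hi a) v"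
    using assms(1) by (rule ltpE)
  obtain x where x: "x \<in> P" "hi x = v" using assms(3) by blast
  show ?thesis
  proof (cases "hi a = v")
    case False
    then have "x \<noteq> a" using x(2) by blast
    then have "hi a \<le> lo x" using strandD[OF assms(2) x(1) ab(1)] strand_lt[OF assms(2) ab(1)] x(2) ab(4)
      by linarith
    then show ?thesis using x ab(6) unfolding agree_def by blast
  qed (use ab in auto)
qed

lemma ltp_hi_ex':
  assumes "ltp v P Q" "strand Q" "\<exists>x\<in>Q. hi x = v"
  shows "\<exists>x\<in>P. hi x = v"
proof -
  obtain a b where ab: "a \<in> P" "b \<in> Q" "hi a = hi b" "hi a \<le> v" "il a b" "agree P Q (hi a) v"
    using assms(1) by (rule ltpE)
  obtain x where x: "x \<in> Q" "hi x = v" using assms(3) by blast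
  show ?thesis
  proof (cases "hi a = v")
    case False
    then have "x \<noteq> b" using x(2) ab(3) by blast
    then have "hi a \<le> lo x" using strandD[OF assms(2) x(1) ab(2)] strand_lt[OF assms(2) ab(2)] x(2) ab(3,4)
      by linarith
    then show ?thesis using x ab(6) unfolding agree_def by blast
  qed (use ab in auto)
qed

lemma lts_lo_ex: "lts v P Q \<Longrightarrow> strand P \<Longrightarrow> \<exists>x\<in>P. lo x = v \<Longrightarrow> \<exists>x\<in>Q. lo x = v"
  using framed_edges.ltp_hi_ex'[OF framed_edges_rev, of "- v" Q P, unfolded rv_simps] by simp

lemma lts_lo_ex': "lts v P Q \<Longrightarrow> strand Q \<Longrightarrow> \<exists>x\<in>Q. lo x = v \<Longrightarrow> \<exists>x\<in>P. lo x = v"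
  using framed_edges.ltp_hi_ex[OF framed_edges_rev, of "- v" Q P, unfolded rv_simps] by simp

text \<open>One passing route suffices: comparability before \<open>v\<close> forces the other to
  enter \<open>v\<close> too, so no edge jumps over \<open>v\<close> and the agreements on its two
  sides join.\<close>

lemma cw_at:
  assumes "strand P" "strand Q" "pass P v \<or> pass Q v" "ltp v P Q" "lts v Q P"
  shows "\<exists>w w'. w \<le> v \<and> v \<le> w' \<and> cws w w' P Q"
proof -
  obtain a b where ab: "a \<in> P" "b \<in> Q" "hi a = hi b" "hi a \<le> v" "il a b" "agree P Q (hi a) v"
    using assms(4) by (rule ltpE)
  obtain c d where cd: "c \<in> Q" "d \<in> P" "lo c = lo d" "v \<le> lo c" "ol c d" "agree Q P v (lo c)"
    using assms(5) by (rule ltsE)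
  have ex: "\<exists>x\<in>P. hi x = v" "\<exists>x\<in>Q. hi x = v"
    using assms(3) ltp_hi_ex[OF assms(4,1)] ltp_hi_ex'[OF assms(4,2)] unfolding pass_def by blast+
  have "hi x \<le> v \<or> v \<le> lo x" if "x \<in> P \<or> x \<in> Q" for x
    using that ex hi_split[OF assms(1), of x] hi_split[OF assms(2), of x] by metis
  then have "agree P Q (hi a) (lo c)"
    by (rule agree_joinI[OF ab(6) agree_sym[OF cd(6)]])
  then have "cws (hi a) (lo c) P Q"
    using ab(4) cd(4) by (intro cwsI[OF ab(1,2) refl ab(5) cd(1,2) refl cd(5)]) auto
  then show ?thesis using ab(4) cd(4) by blast
qed

lemma cwI: "strand P \<Longrightarrow> strand Q \<Longrightarrow> pass P v \<or> pass Q v \<Longrightarrow> ltp v P Q \<Longrightarrow> lts v Q P \<Longrightarrow> cw P Q"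
  using cw_at unfolding cw_def by blast

lemma cws_pass:
  assumes "cws w w' P Q"
  shows "rte P \<Longrightarrow> pass P w \<and> pass P w'" "rte Q \<Longrightarrow> pass Q w \<and> pass Q w'"
proof -
  obtain a b c d where *: "a \<in> P" "b \<in> Q" "c \<in> Q" "d \<in> P" "hi a = w" "hi b = w" "lo c = w'" "lo d = w'"
    "il a b" "ol c d" "w \<le> w'" using assms(1) by (rule cwsE)
  have "a \<in> E" "d \<in> E" using il_E[OF *(9)] ol_E[OF *(10)] by simp_all
  then have "w < t" "s < w'"
    using *(5,8,11) hi_le_t[of d] lo_less_hi[of d] s_le_lo[of a] lo_less_hi[of a] by simp_all
  then show "rte P \<Longrightarrow> pass P w \<and> pass P w'" "rte Q \<Longrightarrow> pass Q w \<and> pass Q w'"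
    using in_pass[of P a] in_pass[of Q b] out_pass[of P d] out_pass[of Q c] *(1-8) by simp_all
qed

text \<open>A crossing that ends strictly before \<open>v\<close> depends only on the part of
  \<open>P\<close> up to \<open>v\<close>. Strictness matters: the edge by which \<open>P\<close>
  leaves the crossing has to end at \<open>v\<close> or earlier.\<close>

lemma cws_cong_pre1:
  assumes "cws w w' P Q" "preeq v P P'" "w' < v" "strand P" "pass P v"
  shows "cws w w' P' Q"
proof -
  obtain a b c d where *: "a \<in> P" "b \<in> Q" "c \<in> Q" "d \<in> P" "hi a = w" "hi b = w" "lo c = w'" "lo d = w'"
    "il a b" "ol c d" "w \<le> w'" "agree P Q w w'" using assms(1) by (rule cwsE)
  have "hi d \<le> v" using pass_split[OF assms(4,5) *(4)] * assms by auto
  then have "a \<in> P'" "d \<in> P'" using assms * by (auto simp: preeq_def)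
  moreover have "agree P' Q w w'"
    using assms(3) by (intro agree_trans[OF agree_mono[OF preeq_agree[OF preeq_sym[OF assms(2)]]] *(12)]) auto
  ultimately show ?thesis using * cwsI[of a P' b Q w c d w'] by auto
qed

lemma cws_cong_pre2:
  assumes "cws w w' Q P" "preeq v P P'" "w' < v" "strand P" "pass P v"
  shows "cws w w' Q P'"
proof -
  obtain a b c d where *: "a \<in> Q" "b \<in> P" "c \<in> P" "d \<in> Q" "hi a = w" "hi b = w" "lo c = w'" "lo d = w'"
    "il a b" "ol c d" "w \<le> w'" "agree Q P w w'" using assms(1) by (rule cwsE)
  have "hi c \<le> v" using pass_split[OF assms(4,5) *(3)] * assms by auto
  then have "b \<in> P'" "c \<in> P'" using assms * by (auto simp: preeq_def)
  moreover have "agree Q P' w w'"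
    using assms(3) by (intro agree_trans[OF *(12) agree_mono[OF preeq_agree[OF assms(2)]]]) auto
  ultimately show ?thesis using * cwsI[of a Q b P' w c d w'] by auto
qed

lemma cws_cong_suf1:
  "cws w w' P Q \<Longrightarrow> sufeq v P P' \<Longrightarrow> v < w \<Longrightarrow> strand P \<Longrightarrow> pass P v \<Longrightarrow> cws w w' P' Q"
  using framed_edges.cws_cong_pre1[OF framed_edges_rev, of "- w'" "- w" P Q "- v" P', unfolded rv_simps] by auto

lemma cws_cong_suf2:
  "cws w w' Q P \<Longrightarrow> sufeq v P P' \<Longrightarrow> v < w \<Longrightarrow> strand P \<Longrightarrow> pass P v \<Longrightarrow> cws w w' Q P'"
  using framed_edges.cws_cong_pre2[OF framed_edges_rev, of "- w'" "- w" Q P "- v" P', unfolded rv_simps] by auto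

section \<open>Exchanging the ends of two routes\<close>

lemma splice_preeq: "strand A \<Longrightarrow> strand B \<Longrightarrow> preeq v (splice A v B) A"
  by (auto simp: preeq_def splice_def dest: strand_lt)

lemma splice_sufeq: "strand A \<Longrightarrow> strand B \<Longrightarrow> sufeq v (splice A v B) B"
  by (auto simp: sufeq_def splice_def dest: strand_lt)

lemma splice_memI1: "x \<in> A \<Longrightarrow> hi x \<le> v \<Longrightarrow> x \<in> splice A v B"
  and splice_memI2: "x \<in> B \<Longrightarrow> v \<le> lo x \<Longrightarrow> x \<in> splice A v B"
  by (simp_all add: splice_def)

lemma splice_memE:
  assumes "x \<in> splice A v B"
  obtains "x \<in> A" "hi x \<le> v" | "x \<in> B" "v \<le> lo x"
  using assms by (auto simp: splice_def)

lemma passE: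
  assumes "pass A v"
  obtains x y where "x \<in> A" "hi x = v" "y \<in> A" "lo y = v"
  using assms by (auto simp: pass_def)

lemma passI: "x \<in> A \<Longrightarrow> hi x = v \<Longrightarrow> y \<in> A \<Longrightarrow> lo y = v \<Longrightarrow> pass A v"
  by (auto simp: pass_def)

lemma splice_pass:
  assumes "pass A v" "pass B v"
  shows "pass (splice A v B) v"
proof -
  obtain x where x: "x \<in> A" "hi x = v" using assms(1) by (rule passE)
  obtain y where y: "y \<in> B" "lo y = v" using assms(2) by (rule passE)
  show ?thesis
    using passI[of x "splice A v B" v y] splice_memI1[OF x(1), of v B] splice_memI2[OF y(1), of v A] x y
    by simp
qed

lemma splice_rte:
  assumes A: "rte A" and B: "rte B" and pA: "pass A v" and pB: "pass B v"
  shows "rte (splice A v B)"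
proof -
  note sA = rte_strand[OF A] and sB = rte_strand[OF B]
  have "strand (splice A v B)"
    unfolding strand_def
  proof (intro conjI ballI)
    show "splice A v B \<subseteq> E" using sA sB by (auto simp: splice_def strand_def)
    fix x y assume "x \<in> splice A v B" "y \<in> splice A v B"
    then consider "x \<in> A" "y \<in> A" | "x \<in> B" "y \<in> B" | "hi x \<le> v" "v \<le> lo y" | "hi y \<le> v" "v \<le> lo x"
      by (auto simp: splice_def)
    then show "x = y \<or> hi x \<le> lo y \<or> hi y \<le> lo x"
      by cases (use strandD[OF sA] strandD[OF sB] in auto)
  qed
  moreover have "hi x = t \<or> (\<exists>y\<in>splice A v B. lo y = hi x)" if "x \<in> splice A v B" for x
    using that
  proof (cases rule: splice_memE)
    case 1
    have "hi x < t" using pass_hi_less_t[OF A pA] 1 by simp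
    then obtain y where y: "y \<in> A" "lo y = hi x" using in_pass[OF A 1(1)] by (auto elim: passE)
    show ?thesis
    proof (cases "hi x = v")
      case True
      obtain z where "z \<in> B" "lo z = v" using pB by (rule passE)
      then show ?thesis using splice_memI2[of z B v A] True by auto
    next
      case False
      then have "hi y \<le> v" using pass_split[OF sA pA y(1)] y(2) 1(2) by linarith
      then show ?thesis using splice_memI1[OF y(1)] y(2) by blast
    qed
  next
    case 2
    then have "hi x = t \<or> (\<exists>y\<in>B. lo y = hi x)" using B by (simp add: rte_def)
    moreover have "v \<le> hi x" using 2 strand_lt[OF sB 2(1)] by simp
    ultimately show ?thesis using splice_memI2[of _ B v A] by metis
  qed
  moreover have "lo x = s \<or> (\<exists>y\<in>splice A v B. hi y = lo x)" if "x \<in> splice A v B" for x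
    using that
  proof (cases rule: splice_memE)
    case 1
    then have "lo x = s \<or> (\<exists>y\<in>A. hi y = lo x)" using A by (simp add: rte_def)
    moreover have "lo x \<le> v" using 1 strand_lt[OF sA 1(1)] by simp
    ultimately show ?thesis using splice_memI1[of _ A v B] by metis
  next
    case 2
    have "s < lo x" using pass_hi_less_t[OF B pB] 2 by simp
    then obtain y where y: "y \<in> B" "hi y = lo x" using out_pass[OF B 2(1)] by (auto elim: passE)
    show ?thesis
    proof (cases "lo x = v")
      case True
      obtain z where "z \<in> A" "hi z = v" using pA by (rule passE)
      then show ?thesis using splice_memI1[of z A v B] True by auto
    next
      case False
      then have "v \<le> lo y" using pass_split[OF sB pB y(1)] y(2) 2(2) by linarith
      then show ?thesis using splice_memI2[OF y(1)] y(2) by blast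
    qed
  qed
  moreover have "splice A v B \<noteq> {}"
    using splice_pass[OF pA pB] by (auto elim: passE)
  ultimately show ?thesis unfolding rte_def by blast
qed

lemma preeq_pass:
  assumes "preeq v A B" "strand A" "pass A v" "pass A u" "u < v"
  shows "pass B u"
proof -
  obtain x y where "x \<in> A" "hi x = u" "y \<in> A" "lo y = u" using assms(4) by (auto simp: pass_def)
  moreover from this have "hi y \<le> v" using pass_split[OF assms(2,3)] assms(5) by force
  ultimately show ?thesis using assms(1,5) by (auto simp: pass_def preeq_def)
qed

lemma sufeq_pass: "sufeq v A B \<Longrightarrow> strand A \<Longrightarrow> pass A v \<Longrightarrow> pass A u \<Longrightarrow> v < u \<Longrightarrow> pass B u"
  using framed_edges.preeq_pass[OF framed_edges_rev, of "- v" A B "- u", unfolded rv_simps] by auto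

lemma pre_suf_eq: "strand A \<Longrightarrow> strand B \<Longrightarrow> pass A v \<Longrightarrow> pass B v \<Longrightarrow> preeq v A B \<Longrightarrow> sufeq v A B \<Longrightarrow> A = B"
  using pass_split[of A v] pass_split[of B v] unfolding preeq_def sufeq_def by (intro Set.set_eqI) metis

lemma cw_split:
  assumes "cw P Q"
  obtains (before) w w' where "cws w w' P Q" "w' < v"
  | (after) w w' where "cws w w' P Q" "v < w"
  | (at) w w' where "cws w w' P Q" "w \<le> v" "v \<le> w'" "ltp v P Q" "lts v Q P"
proof -
  obtain w w' where w: "cws w w' P Q" using assms(1) by (auto simp: cw_def)
  then show thesis using before[OF w] after[OF w] at[OF w] cws_at[OF w, of v] by linarith
qed

text \<open>A crossing before \<open>v\<close> is one of \<open>A\<close>, a crossing after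
  \<open>v\<close> is one of \<open>B\<close>, and a crossing whose segment contains
  \<open>v\<close> shows in the comparisons at \<open>v\<close>. Most coherence proofs for spliced
  routes reduce to this trichotomy.\<close>

lemma splice_cw1:
  assumes "rte A" "rte B" "pass A v" "pass B v" "strand V" "cw (splice A v B) V"
  shows "cw A V \<or> cw B V \<or> (ltp v A V \<and> lts v V B)"
proof -
  let ?N = "splice A v B"
  note N = splice_rte[OF assms(1-4)] and pN = splice_pass[OF assms(3,4)]
  note sN = rte_strand[OF N] and sA = rte_strand[OF assms(1)] and sB = rte_strand[OF assms(2)]
  from assms(6) show ?thesis
  proof (cases rule: cw_split[where v = v])
    case (before w w')
    then show ?thesis using cws_cong_pre1[OF before(1) splice_preeq[OF sA sB] _ sN pN] cw_def by blast
  next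
    case (after w w')
    then show ?thesis using cws_cong_suf1[OF after(1) splice_sufeq[OF sA sB] _ sN pN] cw_def by blast
  next
    case (at w w')
    then show ?thesis
      using ltp_cong1[OF splice_preeq[OF sA sB]] lts_cong2[OF splice_sufeq[OF sA sB]] by blast
  qed
qed

lemma splice_cw2:
  assumes "rte A" "rte B" "pass A v" "pass B v" "strand V" "cw V (splice A v B)"
  shows "cw V A \<or> cw V B \<or> (ltp v V A \<and> lts v B V)"
proof -
  let ?N = "splice A v B"
  note N = splice_rte[OF assms(1-4)] and pN = splice_pass[OF assms(3,4)]
  note sN = rte_strand[OF N] and sA = rte_strand[OF assms(1)] and sB = rte_strand[OF assms(2)]
  from assms(6) show ?thesis
  proof (cases rule: cw_split[where v = v])
    case (before w w')
    then show ?thesis using cws_cong_pre2[OF before(1) splice_preeq[OF sA sB] _ sN pN] cw_def by blast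
  next
    case (after w w')
    then show ?thesis using cws_cong_suf2[OF after(1) splice_sufeq[OF sA sB] _ sN pN] cw_def by blast
  next
    case (at w w')
    then show ?thesis
      using ltp_cong2[OF splice_preeq[OF sA sB]] lts_cong1[OF splice_sufeq[OF sA sB]] by blast
  qed
qed

lemma cw_irrefl: "strand P \<Longrightarrow> \<not> cw P P"
  using cws_at(1)[of _ _ P P] ltp_irrefl[of P] unfolding cw_def cws_def by blast

section \<open>Maximal cliques\<close>

lemma rv_mc: "rv.mc C \<longleftrightarrow> mc C"
  unfolding rv.mc_def mc_def rv_rte rv_cw ..

lemma mc_rte: "mc C \<Longrightarrow> R \<in> C \<Longrightarrow> rte R"
  and mc_cw: "mc C \<Longrightarrow> P \<in> C \<Longrightarrow> Q \<in> C \<Longrightarrow> \<not> cw P Q"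
  and mc_max: "mc C \<Longrightarrow> rte R \<Longrightarrow> (\<And>Q. Q \<in> C \<Longrightarrow> \<not> cw R Q \<and> \<not> cw Q R) \<Longrightarrow> R \<in> C"
  unfolding mc_def by blast+

lemma mc_strand: "mc C \<Longrightarrow> R \<in> C \<Longrightarrow> strand R"
  using mc_rte rte_strand by blast

lemma mc_at:
  "mc C \<Longrightarrow> P \<in> C \<Longrightarrow> Q \<in> C \<Longrightarrow> pass P v \<or> pass Q v \<Longrightarrow> ltp v P Q \<Longrightarrow> \<not> lts v Q P"
  using mc_cw cwI mc_strand by metis

lemma finite_mc: "mc C \<Longrightarrow> finite C"
proof (rule finite_subset)
  show "mc C \<Longrightarrow> C \<subseteq> Pow E" using mc_strand by (auto simp: strand_def)
qed (simp add: finite_E)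

lemma mc_subset: "mc C \<Longrightarrow> mc D \<Longrightarrow> C \<subseteq> D \<Longrightarrow> C = D"
  using mc_max[of C] mc_rte[of D] mc_cw[of D] by blast

lemma below_refl: "mc C \<Longrightarrow> below C C"
  by (simp add: below_def mc_cw)

text \<open>Both relations together make every route of \<open>C\<close> coherent with all of
  \<open>D\<close>, so maximality of \<open>D\<close> absorbs it.\<close>

lemma below_antisym: "mc C \<Longrightarrow> mc D \<Longrightarrow> below C D \<Longrightarrow> below D C \<Longrightarrow> C = D"
  by (rule mc_subset) (auto simp: below_def intro!: mc_max dest: mc_rte)

section \<open>Flips\<close>

definition crosses :: "int \<Rightarrow> 'e set \<Rightarrow> 'e set \<Rightarrow> bool" where
  "crosses u R R' \<longleftrightarrow> pass R u \<and> pass R' u \<and>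
     (ltp u R R' \<and> lts u R' R \<or> ltp u R' R \<and> lts u R R')"

lemma crosses_sym: "crosses u R R' \<longleftrightarrow> crosses u R' R"
  by (auto simp: crosses_def)

lemma cws_crosses:
  assumes "rte R" "rte R'" "cws w w' R R'" "w \<le> u" "u \<le> w'" "u = w \<or> u = w'"
  shows "crosses u R R'" "crosses u R' R"
  using cws_at[OF assms(3-5)] cws_pass[OF assms(3)] assms(1,2,6) by (auto simp: crosses_def)

text \<open>Being coherent with \<open>R\<close> and \<open>R'\<close>, \<open>V\<close> can cross
  the splice only at \<open>u\<close>. Transitivity through the crossing of \<open>R\<close> and
  \<open>R'\<close> at \<open>u\<close> then turns this into a crossing of \<open>V\<close> with one
  of them.\<close>

lemma splice_coherent:
  assumes R: "rte R" "rte R'" and V: "strand V"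
    and coh: "\<not> cw R V" "\<not> cw V R" "\<not> cw R' V" "\<not> cw V R'" and cr: "crosses u R R'"
  shows "\<not> cw (splice R u R') V" "\<not> cw V (splice R u R')"
proof -
  note sR = rte_strand[OF R(1)] and sR' = rte_strand[OF R(2)]
  have p: "pass R u" "pass R' u" using cr by (auto simp: crosses_def)
  show "\<not> cw (splice R u R') V"
  proof
    assume "cw (splice R u R') V"
    then have "ltp u R V" "lts u V R'" using splice_cw1[OF R p V] coh by blast+
    then show False
      using cr cwI sR sR' V p coh ltp_trans[OF sR' sR V] lts_trans[OF V sR' sR]
      unfolding crosses_def by blast
  qed
  show "\<not> cw V (splice R u R')"
  proof
    assume "cw V (splice R u R')"
    then have "ltp u V R" "lts u R' V" using splice_cw2[OF R p V] coh by blast+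
    then show False
      using cr cwI sR sR' V p coh ltp_trans[OF V sR sR'] lts_trans[OF sR sR' V]
      unfolding crosses_def by blast
  qed
qed

lemma not_cws_sufeq:
  assumes "strand P" "strand Q" "sufeq v P Q" "v \<le> w'"
  shows "\<not> cws w w' P Q"
proof
  assume "cws w w' P Q"
  then obtain c d where cd: "c \<in> Q" "d \<in> P" "lo c = w'" "lo d = w'" "ol c d" by (rule cwsE)
  then have "c \<in> P" using assms by (auto simp: sufeq_def)
  then have "c = d" using cd strand_lo_inj[OF assms(1)] by auto
  then show False using cd ol_irrefl by blast
qed

lemma not_cws_preeq:
  assumes "strand P" "strand Q" "preeq v P Q" "w \<le> v"
  shows "\<not> cws w w' P Q"
proof
  assume "cws w w' P Q"
  then obtain a b where ab: "a \<in> P" "b \<in> Q" "hi a = w" "hi b = w" "il a b" by (rule cwsE)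
  then have "a \<in> Q" using assms by (auto simp: preeq_def)
  then have "a = b" using ab strand_hi_inj[OF assms(2)] by auto
  then show False using ab il_irrefl by blast
qed

text \<open>
  The routes exchanged by a flip cross only once: for \<open>u\<close> the last crossing vertex, the route that
  follows \<open>R\<close> to \<open>u\<close> and then \<open>R'\<close> is in the clique, and would cross \<open>R'\<close> at an earlier crossing.
\<close>

lemma exchange:
  assumes mR: "mc (insert R D)" and mR': "mc (insert R' D)" and nR: "R \<notin> D" "R' \<notin> D" and cw: "cw R R'"
  obtains u where "pass R u" "pass R' u" "ltp u R R'" "lts u R' R" "splice R u R' \<in> D" "splice R' u R \<in> D"
    "\<not> cw R' R"
proof -
  have R: "rte R" "rte R'" using mc_rte mR mR' by blast+
  note sR = rte_strand[OF R(1)] and sR' = rte_strand[OF R(2)]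
  obtain w0 w0' where w0: "cws w0 w0' R R'" using cw by (auto simp: cw_def)
  define U where "U = {u. crosses u R R'}"
  have "U \<subseteq> {s..t}"
    using pass_hi_less_t[OF R(1)] unfolding U_def crosses_def by force
  then have fin: "finite U" by (rule finite_subset) simp
  have "w0 \<in> U" using cws_crosses[OF R w0, of w0] w0 by (auto simp: U_def cws_def)
  define u where "u = Max U"
  have uU: "crosses u R R'" using Max_in[OF fin] \<open>w0 \<in> U\<close> by (auto simp: U_def u_def)
  \<comment> \<open>\<open>U\<close> records crossings in both directions and contains the start of
    each, so no crossing starts after \<open>u\<close>.\<close>
  have umax: "w \<le> u" if "cws w w' R R' \<or> cws w w' R' R" for w w'
  proof -
    have "w \<le> w'" using that by (auto elim: cwsE)
    then have "w \<in> U" using that cws_crosses[OF R, of w w' w] cws_crosses[OF R(2,1), of w w' w]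
      by (auto simp: U_def)
    then show ?thesis using fin by (simp add: u_def)
  qed
  have p: "pass R u" "pass R' u" using uU by (auto simp: crosses_def)
  define Y where "Y = splice R u R'"
  define Z where "Z = splice R' u R"
  have Y: "rte Y" "pass Y u" "preeq u Y R" "sufeq u Y R'"
    unfolding Y_def using splice_rte[OF R p] splice_pass[OF p] splice_preeq[OF sR sR'] splice_sufeq[OF sR sR']
    by auto
  have Z: "rte Z" "pass Z u" "preeq u Z R'" "sufeq u Z R"
    unfolding Z_def using splice_rte[OF R(2,1)] splice_pass splice_preeq[OF sR' sR] splice_sufeq[OF sR' sR] p
    by auto
  note sY = rte_strand[OF Y(1)] and sZ = rte_strand[OF Z(1)]
  have cohD: "\<not> cw R V \<and> \<not> cw V R \<and> \<not> cw R' V \<and> \<not> cw V R'" if "V \<in> D" for V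
    using that mc_cw[OF mR] mc_cw[OF mR'] by blast
  have sD: "strand V" if "V \<in> D" for V using that mc_strand[OF mR] by blast
  \<comment> \<open>\<open>Y\<close> coincides with \<open>R\<close> up to \<open>u\<close>, so a
    crossing of the two would start after \<open>u\<close>, where \<open>Y\<close> is
    \<open>R'\<close>; this contradicts the choice of \<open>u\<close>.\<close>
  have YD: "Y \<in> D"
  proof -
    have "\<not> cws w w' Y R" for w w'
    proof
      assume c: "cws w w' Y R"
      then have "u < w" using not_cws_preeq[OF sY sR Y(3)] by (meson not_le)
      then have "cws w w' R' R" using cws_cong_suf1[OF c Y(4) _ sY Y(2)] by simp
      then show False using umax \<open>u < w\<close> by (meson not_le)
    qed
    moreover have "\<not> cws w w' R Y" for w w'
    proof
      assume c: "cws w w' R Y"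
      then have "u < w" using not_cws_preeq[OF sR sY preeq_sym[OF Y(3)]] by (meson not_le)
      then have "cws w w' R R'" using cws_cong_suf2[OF c Y(4) _ sY Y(2)] by simp
      then show False using umax \<open>u < w\<close> by (meson not_le)
    qed
    ultimately have "Y \<in> insert R D"
      using splice_coherent[OF R sD _ _ _ _ uU] cohD
      by (intro mc_max[OF mR Y(1)]) (auto simp: cw_def Y_def)
    moreover have "Y \<noteq> R"
    proof
      assume "Y = R"
      then have "sufeq u R R'" using Y(4) by simp
      then show False using uU lts_cong1[of u R R'] lts_cong2[of u R R'] lts_irrefl[OF sR'] unfolding crosses_def
        by blast
    qed
    ultimately show ?thesis by blast
  qed
  \<comment> \<open>A crossing that ends before \<open>u\<close> sees \<open>Y\<close> in place of
    \<open>R\<close>, and \<open>Y\<close> shares a clique with \<open>R'\<close>.\<close>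
  have early: "\<not> (cws w w' R R' \<or> cws w w' R' R)" if "w' < u" for w w'
    using cws_cong_pre1[OF _ preeq_sym[OF Y(3)] that sR p(1)]
      cws_cong_pre2[OF _ preeq_sym[OF Y(3)] that sR p(1)] cohD[OF YD] unfolding cw_def by blast
  have ZD: "Z \<in> D"
  proof -
    have "\<not> cws w w' Z R" for w w'
    proof
      assume c: "cws w w' Z R"
      then have "w' < u" using not_cws_sufeq[OF sZ sR Z(4)] by (meson not_le)
      then show False using cws_cong_pre1[OF c Z(3) _ sZ Z(2)] early by blast
    qed
    moreover have "\<not> cws w w' R Z" for w w'
    proof
      assume c: "cws w w' R Z"
      then have "w' < u" using not_cws_sufeq[OF sR sZ sufeq_sym[OF Z(4)]] by (meson not_le)
      then show False using cws_cong_pre2[OF c Z(3) _ sZ Z(2)] early by blast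
    qed
    ultimately have "Z \<in> insert R D"
      using splice_coherent[OF R(2,1) sD] cohD uU crosses_sym
      by (intro mc_max[OF mR Z(1)]) (auto simp: cw_def Z_def)
    moreover have "Z \<noteq> R"
    proof
      assume "Z = R"
      then have "preeq u R R'" using Z(3) by simp
      then show False using uU ltp_cong1[of u R R'] ltp_cong2[of u R R'] ltp_irrefl[OF sR'] unfolding crosses_def
        by blast
    qed
    ultimately show ?thesis by blast
  qed
  \<comment> \<open>So all crossings contain \<open>u\<close>, and their common direction is decided
    by the comparison at \<open>u\<close>.\<close>
  have mid: "w \<le> u \<and> u \<le> w'" if "cws w w' R R' \<or> cws w w' R' R" for w w'
    using umax[OF that] early[of w' w] that by (meson not_le)
  have lt: "ltp u R R'" "lts u R' R" using cws_at[OF w0, of u] mid w0 by blast+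
  have "\<not> cws w w' R' R" for w w'
    using mid[of w w'] cws_at(1)[of w w' R' R u] ltp_asym[OF sR sR' lt(1)] by blast
  then have "\<not> cw R' R" by (simp add: cw_def)
  then show thesis using that p lt YD ZD unfolding Y_def Z_def by blast
qed

text \<open>Thus \<open>R'\<close> is made of two routes that an exchange leaves in the clique,
  which is how \<open>below_flip\<close> controls it.\<close>

lemma splice_back:
  assumes "strand R" "strand R'" "pass R' u" "pass R u"
  shows "splice (splice R' u R) u (splice R u R') = R'"
proof (intro Set.set_eqI)
  fix x
  show "x \<in> splice (splice R' u R) u (splice R u R') \<longleftrightarrow> x \<in> R'"
    using splice_preeq[OF assms(2,1), of u] splice_sufeq[OF assms(1,2), of u] pass_split[OF assms(2,3), of x]
    unfolding preeq_def sufeq_def splice_def[of "splice _ _ _"] by blast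
qed

lemma flip_mc: "flip C C' \<Longrightarrow> mc C" "flip C C' \<Longrightarrow> mc C'"
  by (auto simp: flip_def)

lemma flip_below: "flip C C' \<Longrightarrow> below C C'"
proof -
  assume "flip C C'"
  then obtain D R R' where *: "mc C" "mc C'" "R \<notin> D" "R' \<notin> D" "C = insert R D" "C' = insert R' D" "cw R R'"
    by (auto simp: flip_def)
  then obtain u where "\<not> cw R' R" using exchange[of R D R'] by blast
  then show "below C C'"
    using * mc_cw[OF *(1)] mc_cw[OF *(2)] unfolding below_def by blast
qed

text \<open>Only the new route \<open>R'\<close> could be cw-below some \<open>P\<close> in
  \<open>A\<close>. As its constituents \<open>splice R' u R\<close> and
  \<open>splice R u R'\<close> stay in \<open>C\<close>, the crossing would be visible at
  \<open>u\<close>, and \<open>R\<close>, which is cw-below \<open>R'\<close> there, would be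
  cw-below \<open>P\<close> as well.\<close>

lemma below_flip:
  assumes "mc A" "below A C" "flip C C'"
  shows "below A C'"
proof -
  obtain D R R' where *: "mc C" "mc C'" "R \<notin> D" "R' \<notin> D" "C = insert R D" "C' = insert R' D" "cw R R'"
    using assms(3) by (auto simp: flip_def)
  then obtain u where u: "pass R u" "pass R' u" "ltp u R R'" "lts u R' R" "splice R u R' \<in> D" "splice R' u R \<in> D"
    using exchange[of R D R'] by blast
  have R: "rte R" "rte R'" using mc_rte * by blast+
  note sR = rte_strand[OF R(1)] and sR' = rte_strand[OF R(2)]
  have "\<not> cw R' P" if P: "P \<in> A" for P
  proof
    note sP = mc_strand[OF assms(1) P]
    assume "cw R' P"
    then have "cw (splice (splice R' u R) u (splice R u R')) P"
      using splice_back[OF sR sR' u(2,1)] by simp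
    moreover have "\<not> cw (splice R' u R) P" "\<not> cw (splice R u R') P" "\<not> cw R P"
      using u assms(2) P * by (auto simp: below_def)
    ultimately have "ltp u (splice R' u R) P" "lts u P (splice R u R')"
      using splice_cw1[OF _ _ _ _ sP, of "splice R' u R" "splice R u R'" u] splice_rte splice_pass R u(1,2) by blast+
    then have "ltp u R' P" "lts u P R'"
      using ltp_cong1[OF splice_preeq[OF sR' sR]] lts_cong2[OF splice_sufeq[OF sR sR']] by blast+
    then have "cw R P"
      using ltp_trans[OF sR sR' sP u(3)] lts_trans[OF sP sR' sR _ u(4)] cwI[OF sR sP] u(1) by blast
    then show False using \<open>\<not> cw R P\<close> by blast
  qed
  then show ?thesis using assms(2) * unfolding below_def by blast
qed

text \<open>With \<open>u \<le> v\<close>, all exchanges can be made at the single vertex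
  \<open>v\<close>. If \<open>Ra\<close> and \<open>Rb\<close> differed before or after
  \<open>v\<close>, one of them would cross a route obtained by exchanging the other with
  \<open>R'\<close>, and these routes lie in \<open>D\<close>.\<close>

lemma ridge_unique_aux:
  assumes m: "mc (insert Ra D)" "mc (insert Rb D)" "mc (insert R' D)"
    and u: "pass Ra u" "pass R' u" "ltp u Ra R'" "lts u R' Ra" "splice Ra u R' \<in> D" "splice R' u Ra \<in> D"
    and v: "pass Rb v" "ltp v Rb R'" "lts v R' Rb" "pass R' v" "splice Rb v R' \<in> D" "splice R' v Rb \<in> D"
    and uv: "u \<le> v"
  shows "Ra = Rb"
proof -
  have R: "rte Ra" "rte Rb" "rte R'" using mc_rte m by blast+
  note sa = rte_strand[OF R(1)] and sb = rte_strand[OF R(2)] and s' = rte_strand[OF R(3)]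
  have coh: "\<not> cw Ra V \<and> \<not> cw V Ra \<and> \<not> cw Rb V \<and> \<not> cw V Rb" if "V \<in> D" for V
    using that mc_cw[OF m(1)] mc_cw[OF m(2)] by blast
  have sD: "strand V" if "V \<in> D" for V using that mc_strand[OF m(1)] by blast
  obtain w w' where w: "w \<le> u" "u \<le> w'" "cws w w' Ra R'"
    using cw_at[OF sa s' _ u(3,4)] u by blast
  \<comment> \<open>If the crossing of \<open>Ra\<close> with \<open>R'\<close> ended before
    \<open>v\<close>, \<open>Ra\<close> would cross \<open>splice R' v Rb\<close> in the same place,
    and that route is in \<open>D\<close>.\<close>
  have "v \<le> w'"
  proof (rule ccontr)
    assume "\<not> v \<le> w'"
    then have "cws w w' Ra (splice R' v Rb)"
      using cws_cong_pre2[OF w(3) preeq_sym[OF splice_preeq[OF s' sb]] _ s' v(4)] by simp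
    then show False using coh[OF v(6)] by (auto simp: cw_def)
  qed
  then have va: "ltp v Ra R'" "lts v R' Ra" using cws_at[OF w(3), of v] w uv by auto
  have ag: "agree Ra R' u v"
    using w(3) \<open>v \<le> w'\<close> w(1) by (auto simp: cws_def intro: agree_mono)
  have pa: "pass Ra v"
  proof (cases "v = w'")
    case True
    then show ?thesis using cws_pass[OF w(3)] R by blast
  next
    case False
    obtain x y where xy: "x \<in> R'" "hi x = v" "y \<in> R'" "lo y = v" using v(4) by (rule passE)
    show ?thesis
    proof (cases "u = v")
      case False
      then have "u \<le> lo x" using pass_split[OF s' u(2) xy(1)] xy uv by auto
      then have "x \<in> Ra" using ag xy by (auto simp: agree_def)
      then show ?thesis using in_pass[OF R(1)] xy pass_hi_less_t[OF R(3) v(4)] by auto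
    qed (use u in simp)
  qed
  \<comment> \<open>Between \<open>u\<close> and \<open>v\<close> the routes \<open>Ra\<close> and
    \<open>R'\<close> agree, so it does not matter at which of the two the ends are
    exchanged.\<close>
  have "splice Ra u R' = splice Ra v R'"
  proof (rule pre_suf_eq[of _ _ u])
    show "strand (splice Ra u R')" "strand (splice Ra v R')"
      using splice_rte R pa v u rte_strand by blast+
    show "pass (splice Ra u R') u" using splice_pass u by blast
    show "preeq u (splice Ra u R') (splice Ra v R')"
      using preeq_trans[OF splice_preeq[OF sa s'] preeq_sym[OF preeq_mono[OF splice_preeq[OF sa s'] uv]]] .
    have "x \<in> R' \<longleftrightarrow> x \<in> splice Ra v R'" if "u \<le> lo x" for x
      using that ag pass_split[OF s' v(4), of x] pass_split[OF sa pa, of x] strand_lt[OF sa, of x] strand_lt[OF s', of x]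
      unfolding splice_def agree_def by fastforce
    then show "sufeq u (splice Ra u R') (splice Ra v R')"
      using splice_sufeq[OF sa s', of u] by (auto simp: sufeq_def)
    show "pass (splice Ra v R') u"
    proof (cases "u = v")
      case True
      then show ?thesis using splice_pass pa v by blast
    next
      case False
      then show ?thesis
        using preeq_pass[OF preeq_sym[OF splice_preeq[OF sa s']] sa pa u(1)] uv by simp
    qed
  qed
  then have Ya: "splice Ra v R' \<in> D" using u by simp
  have "splice R' u Ra = splice R' v Ra"
  proof (rule pre_suf_eq[of _ _ u])
    show "strand (splice R' u Ra)" "strand (splice R' v Ra)"
      using splice_rte R pa v u rte_strand by blast+
    show "pass (splice R' u Ra) u" using splice_pass u by blast
    show "preeq u (splice R' u Ra) (splice R' v Ra)"
      using preeq_trans[OF splice_preeq[OF s' sa] preeq_sym[OF preeq_mono[OF splice_preeq[OF s' sa] uv]]] .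
    have "x \<in> Ra \<longleftrightarrow> x \<in> splice R' v Ra" if "u \<le> lo x" for x
      using that ag pass_split[OF s' v(4), of x] pass_split[OF sa pa, of x] strand_lt[OF sa, of x] strand_lt[OF s', of x]
      unfolding splice_def agree_def by fastforce
    then show "sufeq u (splice R' u Ra) (splice R' v Ra)"
      using splice_sufeq[OF s' sa, of u] by (auto simp: sufeq_def)
    show "pass (splice R' v Ra) u"
    proof (cases "u = v")
      case True
      then show ?thesis using splice_pass pa v by blast
    next
      case False
      then show ?thesis
        using preeq_pass[OF preeq_sym[OF splice_preeq[OF s' sa]] s' v(4) u(2)] uv by simp
    qed
  qed
  then have Za: "splice R' v Ra \<in> D" using u by simp
  \<comment> \<open>Replacing the end of \<open>Q\<close> by that of \<open>R'\<close> keeps the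
    comparison before \<open>v\<close> and makes the one after \<open>v\<close> opposite.
    \<open>suf\<close> does the same on the other side.\<close>
  have pre: "\<not> ltp v P Q"
    if "strand P" "strand Q" "lts v R' P" "splice Q v R' \<in> D" "pass P v" "\<not> cw P (splice Q v R')" for P Q
  proof
    assume "ltp v P Q"
    then have "ltp v P (splice Q v R')" using ltp_cong2[OF preeq_sym[OF splice_preeq[OF that(2) s']]] by blast
    moreover have "lts v (splice Q v R') P"
      using lts_cong1[OF sufeq_sym[OF splice_sufeq[OF that(2) s']] that(3)] .
    ultimately show False using cwI[OF that(1) sD[OF that(4)]] that by blast
  qed
  have suf: "\<not> lts v Q P"
    if "strand P" "strand Q" "ltp v P R'" "splice R' v Q \<in> D" "pass P v" "\<not> cw P (splice R' v Q)" for P Q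
  proof
    assume "lts v Q P"
    then have "lts v (splice R' v Q) P" using lts_cong1[OF sufeq_sym[OF splice_sufeq[OF s' that(2)]]] by blast
    moreover have "ltp v P (splice R' v Q)"
      using ltp_cong2[OF preeq_sym[OF splice_preeq[OF s' that(2)]] that(3)] .
    ultimately show False using cwI[OF that(1) sD[OF that(4)]] that by blast
  qed
  have "preeq v Ra Rb"
    using ltp_total[OF R(1,2) pa v(1)] pre[OF sa sb va(2) v(5) pa] pre[OF sb sa v(3) Ya v(1)] coh Ya v by blast
  moreover have "sufeq v Ra Rb"
    using lts_total[OF R(1,2) pa v(1)] suf[OF sa sb va(1) v(6) pa] suf[OF sb sa v(2) Za v(1)] coh Za v by blast
  ultimately show ?thesis using pre_suf_eq[OF sa sb pa v(1)] by blast
qed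

lemma ridge_unique:
  assumes m: "mc (insert Ra D)" "mc (insert Rb D)" "mc (insert R' D)"
    and n: "Ra \<notin> D" "Rb \<notin> D" "R' \<notin> D" and c: "cw Ra R'" "cw Rb R'"
  shows "Ra = Rb"
proof -
  obtain u where u: "pass Ra u" "pass R' u" "ltp u Ra R'" "lts u R' Ra" "splice Ra u R' \<in> D" "splice R' u Ra \<in> D"
    using exchange[OF m(1,3) n(1,3) c(1)] by blast
  obtain v where v: "pass Rb v" "pass R' v" "ltp v Rb R'" "lts v R' Rb" "splice Rb v R' \<in> D" "splice R' v Rb \<in> D"
    using exchange[OF m(2,3) n(2,3) c(2)] by blast
  show ?thesis
    using ridge_unique_aux[OF m u v(1,3,4,2,5,6)] ridge_unique_aux[OF m(2,1,3) v u(1,3,4,2,5,6)]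
    by force
qed

section \<open>Corners and the flips at them\<close>

lemma pass_of_lt:
  assumes "strand P" "strand V" "ltp v P V \<or> ltp v V P" "lts v Q V \<or> lts v V Q" "pass P v" "pass Q v" "strand Q"
  shows "pass V v"
proof -
  have "\<exists>x\<in>V. hi x = v"
    using assms ltp_hi_ex[of v P V] ltp_hi_ex'[of v V P] unfolding pass_def by blast
  moreover have "\<exists>x\<in>V. lo x = v"
    using assms lts_lo_ex[of v Q V] lts_lo_ex'[of v V Q] unfolding pass_def by blast
  ultimately show ?thesis by (simp add: pass_def)
qed

text \<open>Read backwards from \<open>v\<close> the order is lexicographic, so the paths sharing a
  given final part form an interval.\<close>

lemma interval_pre:
  assumes s: "strand A" "strand B" "strand D" and lt: "ltp v A B" "ltp v B D" and ag: "agree A D u v"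
    and p: "pass A u" "pass D u"
  shows "agree A B u v"
proof -
  obtain a b where ab: "a \<in> A" "b \<in> B" "hi a = hi b" "hi a \<le> v" "il a b" "agree A B (hi a) v"
    using lt(1) by (rule ltpE)
  obtain b' d where bd: "b' \<in> B" "d \<in> D" "hi b' = hi d" "hi b' \<le> v" "il b' d" "agree B D (hi b') v"
    using lt(2) by (rule ltpE)
  have "hi a \<le> u"
  proof (rule ccontr)
    assume "\<not> hi a \<le> u"
    then have "u \<le> lo a" using pass_split[OF s(1) p(1) ab(1)] by simp
    then have aD: "a \<in> D" using ag ab by (simp add: agree_def)
    consider "hi b' < hi b" | "hi b' = hi b" | "hi b < hi b'" by linarith
    then show False
    proof cases
      case 1
      then have "hi b' \<le> lo b" using hi_split[OF s(2) ab(2) bd(1)] by auto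
      then have "b \<in> D" using bd(6) ab by (simp add: agree_def)
      then show False using aD ab strand_hi_inj[OF s(3)] il_irrefl by metis
    next
      case 2
      then have "b' = b" using strand_hi_inj[OF s(2) bd(1) ab(2)] by simp
      moreover have "d = a" using 2 strand_hi_inj[OF s(3) bd(2) aD] bd(3) ab(3) by simp
      ultimately show False using il_trans[OF ab(5)] bd(5) il_irrefl by blast
    next
      case 3
      then have "hi b \<le> lo b'" using hi_split[OF s(2) bd(1) ab(2)] by auto
      then have "b' \<in> A" using ab(3,6) bd by (simp add: agree_def)
      moreover have "u \<le> lo d"
        using pass_split[OF s(3) p(2) bd(2)] bd(3) 3 ab(3) \<open>\<not> hi a \<le> u\<close> by linarith
      then have "d \<in> A" using ag bd by (simp add: agree_def)
      ultimately show False using bd strand_hi_inj[OF s(1)] il_irrefl by metis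
    qed
  qed
  then show ?thesis using agree_mono[OF ab(6), of u v] by simp
qed

text \<open>Excludes a rival \<open>W\<close> for the place of \<open>X\<close> that ends like
  \<open>Z\<close> and lies strictly between \<open>Y\<close> and \<open>X\<close> before
  \<open>v\<close>: giving \<open>W\<close> the end of \<open>X\<close> yields a route of
  \<open>C\<close> in the gap between \<open>Y\<close> and \<open>X\<close>.\<close>

lemma flip_corner_aux:
  assumes C: "mc C" "Y \<in> C" "X \<in> C" "Z \<in> C" and p: "pass Y v" "pass X v" "pass Z v" "pass W v"
    and eq: "sufeq v Y X" "preeq v Z X" and lt: "ltp v Y X" "lts v X Z"
    and gap: "\<And>V. V \<in> C \<Longrightarrow> pass V v \<Longrightarrow> sufeq v V X \<Longrightarrow> ltp v Y V \<Longrightarrow> \<not> ltp v V X"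
    and W: "rte W" "\<And>V. V \<in> C \<Longrightarrow> V \<noteq> X \<Longrightarrow> \<not> cw V W \<and> \<not> cw W V"
    and W': "ltp v Y W" "ltp v W X" "lts v X W" "sufeq v W Z"
  shows False
proof -
  note S = mc_strand[OF C(1)]
  note sY = S[OF C(2)] and sX = S[OF C(3)] and sZ = S[OF C(4)] and sW = rte_strand[OF W(1)]
  note rX = mc_rte[OF C(1,3)]
  have YX: "Y \<noteq> X" using lt ltp_irrefl[OF sX] by blast
  have ZX: "Z \<noteq> X" using lt lts_irrefl[OF sX] by blast
  have XW: "\<not> cw X W"
  proof
    assume "cw X W"
    moreover have "X = splice Z v Y"
    proof (rule pre_suf_eq[OF sX _ p(2)])
      show "strand (splice Z v Y)" using splice_rte mc_rte C p rte_strand by metis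
      show "preeq v X (splice Z v Y)"
        using preeq_trans[OF preeq_sym[OF eq(2)] preeq_sym[OF splice_preeq[OF sZ sY]]] .
      show "sufeq v X (splice Z v Y)"
        using sufeq_trans[OF sufeq_sym[OF eq(1)] sufeq_sym[OF splice_sufeq[OF sZ sY]]] .
      show "pass (splice Z v Y) v" using splice_pass p by blast
    qed
    ultimately have "ltp v Z W"
      using splice_cw1[of Z Y v W] mc_rte C p sW W(2)[OF C(2) YX] W(2)[OF C(4) ZX] by metis
    then have "ltp v X W" using ltp_cong1[OF eq(2)] by blast
    then show False using W'(2) ltp_asym[OF sX sW] by blast
  qed
  define N where "N = splice W v X"
  have N: "rte N" "pass N v" "preeq v N W" "sufeq v N X"
    unfolding N_def using splice_rte[OF W(1) rX p(4,2)] splice_pass[OF p(4,2)] splice_preeq[OF sW sX]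
      splice_sufeq[OF sW sX] by auto
  note sN = rte_strand[OF N(1)]
  have "N \<in> C"
  proof (rule mc_max[OF C(1) N(1)])
    fix V assume V: "V \<in> C"
    note sV = S[OF V]
    have "\<not> cw V N"
    proof
      assume "cw V N"
      then consider "cw V W" | "ltp v V W" "lts v X V"
        using splice_cw2[OF W(1) rX p(4,2) sV] mc_cw[OF C(1) V C(3)] unfolding N_def by blast
      then show False
      proof cases
        case 1
        then show False using XW W(2)[OF V] by blast
      next
        case 2
        then show False using ltp_trans[OF sV sW sX _ W'(2)] mc_at[OF C(1) V C(3)] p by blast
      qed
    qed
    moreover have "\<not> cw N V"
    proof (cases "V = X")
      case True
      have "\<not> cws w w' N X" for w w'
      proof
        assume c: "cws w w' N X"
        then have "w' < v" using not_cws_sufeq[OF sN sX N(4)] by (meson not_le)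
        then have "cws w w' W X" using cws_cong_pre1[OF c N(3) _ sN N(2)] by simp
        \<comment> \<open>\<open>W\<close> may cross \<open>X\<close>, which is to be removed, but
          before \<open>v\<close> the route \<open>Z\<close> is indistinguishable from
          \<open>X\<close>.\<close>
        then have "cws w w' W Z" using cws_cong_pre2[OF _ preeq_sym[OF eq(2)] \<open>w' < v\<close> sX p(2)] by simp
        then show False using W(2)[OF C(4) ZX] by (auto simp: cw_def)
      qed
      then show ?thesis using True by (simp add: cw_def)
    next
      case False
      show ?thesis
      proof
        assume "cw N V"
        then have "ltp v W V" "lts v V X"
          using splice_cw1[OF W(1) rX p(4,2) sV] mc_cw[OF C(1,3) V] W(2)[OF V False] unfolding N_def by blast+
        then show False
          using ltp_trans[OF sY sW sV W'(1)] lts_cong2[OF sufeq_sym[OF eq(1)]] mc_at[OF C(1,2) V] p(1) by blast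
      qed
    qed
    ultimately show "\<not> cw N V \<and> \<not> cw V N" by blast
  qed
  moreover have "ltp v Y N" using ltp_cong2[OF preeq_sym[OF N(3)] W'(1)] .
  moreover have "ltp v N X" using ltp_cong1[OF preeq_sym[OF N(3)] W'(2)] .
  ultimately show False using gap N by blast
qed

text \<open>Edge reversal exchanges the roles of \<open>Y\<close> and \<open>Z\<close>.\<close>

lemma flip_corner_aux':
  assumes C: "mc C" "Y \<in> C" "X \<in> C" "Z \<in> C" and p: "pass Y v" "pass X v" "pass Z v" "pass W v"
    and eq: "sufeq v Y X" "preeq v Z X" and lt: "ltp v Y X" "lts v X Z"
    and gap: "\<And>V. V \<in> C \<Longrightarrow> pass V v \<Longrightarrow> preeq v V X \<Longrightarrow> lts v X V \<Longrightarrow> \<not> lts v V Z"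
    and W: "rte W" "\<And>V. V \<in> C \<Longrightarrow> V \<noteq> X \<Longrightarrow> \<not> cw V W \<and> \<not> cw W V"
    and W': "lts v W Z" "ltp v W X" "lts v X W" "preeq v W Y"
  shows False
  using framed_edges.flip_corner_aux[OF framed_edges_rev, of C Z X Y "- v" W, unfolded rv_simps rv_mc]
    assms by blast

text \<open>
  The routes of a clique through \<open>v\<close> form a chain, seen as a lattice path in the grid of pairs
  of a path ending and a path starting at \<open>v\<close>. A corner is a step in the first
  coordinate from \<open>Y\<close> to \<open>X\<close> followed by a step in the second coordinate from \<open>X\<close> to \<open>Z\<close>.
\<close>

definition corner :: "'e set set \<Rightarrow> int \<Rightarrow> 'e set \<Rightarrow> 'e set \<Rightarrow> 'e set \<Rightarrow> bool" where
  "corner C v Y X Z \<longleftrightarrow> mc C \<and> Y \<in> C \<and> X \<in> C \<and> Z \<in> C \<and> pass Y v \<and> pass X v \<and> pass Z v \<and>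
     sufeq v Y X \<and> preeq v Z X \<and> ltp v Y X \<and> lts v X Z \<and>
     (\<forall>V\<in>C. pass V v \<longrightarrow> sufeq v V X \<longrightarrow> ltp v Y V \<longrightarrow> \<not> ltp v V X) \<and>
     (\<forall>V\<in>C. pass V v \<longrightarrow> preeq v V X \<longrightarrow> lts v X V \<longrightarrow> \<not> lts v V Z)"

text \<open>\<open>X\<close> and \<open>splice Y v Z\<close> are the opposite corners of a grid
  square whose other two corners are \<open>Y\<close> and \<open>Z\<close>. A route coherent with
  all of \<open>C\<close> except \<open>X\<close> is either in \<open>C\<close> or lies in this
  square, where the gap conditions leave only \<open>splice Y v Z\<close>.\<close>

lemma flip_corner:
  assumes K: "corner C v Y X Z"
  shows "flip (insert (splice Y v Z) (C - {X})) C"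
proof -
  have C: "mc C" "Y \<in> C" "X \<in> C" "Z \<in> C" and p: "pass Y v" "pass X v" "pass Z v"
    and eq: "sufeq v Y X" "preeq v Z X" and lt: "ltp v Y X" "lts v X Z"
    using K by (simp_all add: corner_def)
  have gapY: "\<not> ltp v V X" if "V \<in> C" "pass V v" "sufeq v V X" "ltp v Y V" for V
    using K that by (simp add: corner_def)
  have gapZ: "\<not> lts v V Z" if "V \<in> C" "pass V v" "preeq v V X" "lts v X V" for V
    using K that by (simp add: corner_def)
  define R where "R = splice Y v Z"
  note S = mc_strand[OF C(1)]
  note sY = S[OF C(2)] and sX = S[OF C(3)] and sZ = S[OF C(4)]
  note rY = mc_rte[OF C(1,2)] and rX = mc_rte[OF C(1,3)] and rZ = mc_rte[OF C(1,4)]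
  have R: "rte R" "pass R v" "preeq v R Y" "sufeq v R Z"
    unfolding R_def using splice_rte[OF rY rZ p(1,3)] splice_pass[OF p(1,3)] splice_preeq[OF sY sZ]
      splice_sufeq[OF sY sZ] by auto
  note sR = rte_strand[OF R(1)]
  have YX: "Y \<noteq> X" using lt ltp_irrefl[OF sX] by blast
  have ZX: "Z \<noteq> X" using lt lts_irrefl[OF sX] by blast
  have cwRX: "cw R X"
    using ltp_cong1[OF preeq_sym[OF R(3)] lt(1)] lts_cong2[OF sufeq_sym[OF R(4)] lt(2)] cwI[OF sR sX] p by blast
  then have RC: "R \<notin> C" using mc_cw[OF C(1) _ C(3)] by blast
  have XZY: "X = splice Z v Y"
  proof (rule pre_suf_eq[OF sX _ p(2)])
    show "strand (splice Z v Y)" using splice_rte[OF rZ rY] p rte_strand by blast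
    show "preeq v X (splice Z v Y)"
      using preeq_trans[OF preeq_sym[OF eq(2)] preeq_sym[OF splice_preeq[OF sZ sY]]] .
    show "sufeq v X (splice Z v Y)"
      using sufeq_trans[OF sufeq_sym[OF eq(1)] sufeq_sym[OF splice_sufeq[OF sZ sY]]] .
    show "pass (splice Z v Y) v" using splice_pass p by blast
  qed
  have coh1: "\<not> cw V R" if V: "V \<in> C" for V
  proof
    assume "cw V R"
    then have *: "ltp v V Y" "lts v Z V"
      using splice_cw2[OF rY rZ p(1,3) S[OF V]] mc_cw[OF C(1) V] C unfolding R_def by blast+
    have "lts v Y V"
      using lts_trans[OF sX sZ S[OF V] lt(2) *(2)] lts_cong1[OF sufeq_sym[OF eq(1)]] by blast
    then show False using mc_at[OF C(1) V C(2)] p *(1) by blast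
  qed
  \<comment> \<open>Such a \<open>V\<close> would lie in the square. Differing from \<open>X\<close>
    on both sides of \<open>v\<close> it would cross \<open>X\<close>, on one side it would lie in a
    gap, and on neither it would be \<open>X\<close>.\<close>
  have coh2: "\<not> cw R V" if V: "V \<in> C" "V \<noteq> X" for V
  proof
    note sV = S[OF V(1)]
    assume "cw R V"
    then have *: "ltp v Y V" "lts v V Z"
      using splice_cw1[OF rY rZ p(1,3) sV] mc_cw[OF C(1) _ V(1)] C unfolding R_def by blast+
    have pV: "pass V v" using pass_of_lt[OF sY sV _ _ p(1,3) sZ] * by blast
    note at = mc_at[OF C(1)]
    have nXV: "\<not> ltp v X V"
      using ltp_cong1[OF preeq_sym[OF eq(2)], of V] at[OF C(4) V(1)] *(2) p by blast
    have nVX: "\<not> lts v V X"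
      using lts_cong2[OF sufeq_sym[OF eq(1)], of V] at[OF C(2) V(1)] *(1) p by blast
    have "ltp v V X \<or> preeq v V X" using ltp_total[OF mc_rte[OF C(1) V(1)] rX pV p(2)] nXV by blast
    moreover have "lts v X V \<or> sufeq v V X"
      using lts_total[OF mc_rte[OF C(1) V(1)] rX pV p(2)] nVX by blast
    ultimately show False
      using at[OF V(1) C(3)] pV gapY[OF V(1) pV] gapZ[OF V(1) pV] * pre_suf_eq[OF sV sX pV p(2)] V(2) by blast
  qed
  have "mc (insert R (C - {X}))"
    unfolding mc_def
  proof (intro conjI ballI allI impI)
    show "rte P" if "P \<in> insert R (C - {X})" for P using that mc_rte[OF C(1)] R by blast
    show "\<not> cw P Q" if "P \<in> insert R (C - {X})" "Q \<in> insert R (C - {X})" for P Q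
      using that coh1 coh2 cw_irrefl[OF sR] mc_cw[OF C(1)] by blast
    fix W assume W: "rte W" "\<forall>Q\<in>insert R (C - {X}). \<not> cw W Q \<and> \<not> cw Q W"
    note sW = rte_strand[OF W(1)]
    have Wc: "\<not> cw V W \<and> \<not> cw W V" if "V \<in> C" "V \<noteq> X" for V using W(2) that by blast
    note WY = Wc[OF C(2) YX] and WZ = Wc[OF C(4) ZX]
    have nXW: "\<not> cw X W"
    proof
      assume "cw X W"
      then have *: "ltp v Z W" "lts v W Y"
        using splice_cw1[OF rZ rY p(3,1) sW] WY WZ XZY by auto
      have pW: "pass W v" using pass_of_lt[OF sZ sW _ _ p(3,1) sY] * by blast
      have "ltp v Y W"
        using ltp_trans[OF sY sX sW lt(1)] ltp_cong1[OF eq(2)] *(1) by blast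
      then show False using cwI[OF sY sW] *(2) WY p by blast
    qed
    show "W \<in> insert R (C - {X})"
    proof (cases "cw W X")
      case False
      then have "W \<in> C" using mc_max[OF C(1) W(1)] Wc nXW by blast
      moreover have "W \<noteq> X" using W(2) cwRX by blast
      ultimately show ?thesis by blast
    next
      case True
      then have *: "ltp v W Z" "lts v Y W"
        using splice_cw2[OF rZ rY p(3,1) sW] WY WZ XZY by auto
      then have pW: "pass W v" using pass_of_lt[OF sZ sW _ _ p(3,1) sY] by blast
      have WX: "ltp v W X" "lts v X W" using * ltp_cong2[OF eq(2)] lts_cong1[OF eq(1)] by blast+
      \<comment> \<open>Of the four positions of \<open>W\<close> relative to \<open>Y\<close>
        before \<open>v\<close> and \<open>Z\<close> after it, strictness on both sides makes
        \<open>W\<close> cross \<open>R\<close>, strictness on one side is excluded by the two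
        auxiliary lemmas, and equality on both gives \<open>R\<close>.\<close>
      have "ltp v Y W \<or> preeq v W Y"
        using ltp_total[OF W(1) rY pW p(1)] cwI[OF sW sY] *(2) WY pW by blast
      moreover have "lts v W Z \<or> sufeq v W Z"
        using lts_total[OF W(1) rZ pW p(3)] cwI[OF sW sZ] *(1) WZ pW by blast
      moreover have "\<not> (ltp v Y W \<and> lts v W Z)"
        using W(2) cwI[OF sR sW] R ltp_cong1[OF preeq_sym[OF R(3)]] lts_cong2[OF sufeq_sym[OF R(4)]] by blast
      moreover have "\<not> (ltp v Y W \<and> sufeq v W Z)"
        using flip_corner_aux[OF C p pW eq lt gapY W(1) Wc _ WX] by blast
      moreover have "\<not> (lts v W Z \<and> preeq v W Y)"
        using flip_corner_aux'[OF C p pW eq lt gapZ W(1) Wc _ WX] by blast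
      ultimately have "preeq v W R" "sufeq v W R"
        using preeq_trans[OF _ preeq_sym[OF R(3)]] sufeq_trans[OF _ sufeq_sym[OF R(4)]] by blast+
      then show ?thesis using pre_suf_eq[OF sW sR pW R(2)] by blast
    qed
  qed
  moreover have "C = insert X (C - {X})" "R \<notin> C - {X}" "X \<notin> C - {X}" using C RC by blast+
  ultimately show ?thesis using C(1) cwRX unfolding flip_def R_def by metis
qed

text \<open>
  Among all routes that end like \<open>X\<close>, enter \<open>v\<close> by \<open>\<beta>\<close>, lie above \<open>W\<close> and are crossed from below
  by no route of the clique, one that is maximal up to \<open>v\<close> is coherent with the clique: a route crossing it
  from above could be used to enlarge it.
\<close>

lemma push:
  assumes C: "mc C" "X \<in> C" and pX: "pass X v" and W: "rte W" "pass W v" "\<And>V. V \<in> C \<Longrightarrow> \<not> cw V W"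
    and e: "\<beta> \<in> W" "\<gamma> \<in> X" "hi \<beta> = v" "il \<beta> \<gamma>"
    and gap: "\<And>V. V \<in> C \<Longrightarrow> ltp v W V \<Longrightarrow> \<not> lts v V X"
  obtains N where "N \<in> C" "pass N v" "sufeq v N X" "\<beta> \<in> N" "ltp v W N \<or> preeq v W N"
proof -
  note S = mc_strand[OF C(1)] and sX = mc_strand[OF C] and rX = mc_rte[OF C] and sW = rte_strand[OF W(1)]
  have hg: "hi \<gamma> = v" using il_E[OF e(4)] e(3) by simp
  define \<N> where "\<N> = {N. rte N \<and> pass N v \<and> sufeq v N X \<and> \<beta> \<in> N \<and> (ltp v W N \<or> preeq v W N) \<and>
    (\<forall>V\<in>C. \<not> cw V N)}"
  have "\<N> \<subseteq> Pow E" using rte_strand by (auto simp: \<N>_def strand_def)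
  then have fin: "finite \<N>" using finite_E by (meson finite_Pow_iff finite_subset)
  have "splice W v X \<in> \<N>"
  proof -
    have "\<not> cw V (splice W v X)" if V: "V \<in> C" for V
    proof
      assume "cw V (splice W v X)"
      then have *: "ltp v V W" "lts v X V"
        using splice_cw2[OF W(1) rX W(2) pX S[OF V]] mc_cw[OF C(1) V C(2)] W(3)[OF V] by blast+
      have "ltp v W X" using ltp_at[OF e(1,2,3,4)] sW sX by (simp add: strand_def)
      then show False using ltp_trans[OF S[OF V] sW sX *(1)] *(2) mc_at[OF C(1) V C(2)] pX by blast
    qed
    then show ?thesis
      using splice_rte[OF W(1) rX W(2) pX] splice_pass[OF W(2) pX] splice_preeq[OF sW sX] splice_sufeq[OF sW sX]
        splice_memI1[OF e(1)] e(3) preeq_sym unfolding \<N>_def by blast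
  qed
  then have ne: "\<N> \<noteq> {}" by blast
  have sN: "strand N" if "N \<in> \<N>" for N using that rte_strand by (auto simp: \<N>_def)
  have "\<exists>N\<in>\<N>. \<forall>N'\<in>\<N>. \<not> ltp v N N'"
    by (rule finite_maximal_rel[OF fin ne]) (use sN ltp_irrefl ltp_trans in blast)+
  then obtain N where "N \<in> \<N>" and max: "\<And>N'. N' \<in> \<N> \<Longrightarrow> \<not> ltp v N N'" by blast
  then have N: "rte N" "pass N v" "sufeq v N X" "\<beta> \<in> N" "ltp v W N \<or> preeq v W N" "\<And>V. V \<in> C \<Longrightarrow> \<not> cw V N"
    by (auto simp: \<N>_def)
  note sN = rte_strand[OF N(1)]
  have above: "ltp v W N'" if "strand N'" "ltp v N N'" for N'
    using N(5) that ltp_trans[OF sW sN that(1)] ltp_cong1[OF preeq_sym] by blast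
  have "N \<in> C"
  proof (rule mc_max[OF C(1) N(1)])
    fix V assume V: "V \<in> C"
    note sV = S[OF V] and rV = mc_rte[OF C(1) V]
    have "\<not> cws w w' N V" for w w'
    proof
      assume c: "cws w w' N V"
      consider "v < w" | "w' < v" | "w \<le> v" "v \<le> w'" by linarith
      then show False
      proof cases
        case 1
        then have "cws w w' X V" using cws_cong_suf1[OF c N(3) _ sN N(2)] by simp
        then show False using mc_cw[OF C V] by (auto simp: cw_def)
      next
        case 3
        then have "ltp v N V" "lts v V N" using cws_at[OF c] by blast+
        then show False using above[OF sV] lts_cong2[OF N(3)] gap[OF V] by blast
      next
        case 2
        have ww: "w \<le> w'" using c by (simp add: cws_def)
        have pu: "pass N w'" "pass V w'" using cws_pass[OF c] N(1) rV by blast+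
        have lt: "ltp w' N V" "lts w' V N" using cws_at[OF c ww] by blast+
        define N' where "N' = splice V w' N"
        have N': "rte N'" "pass N' w'" "preeq w' N' V" "sufeq w' N' N"
          unfolding N'_def using splice_rte[OF rV N(1) pu(2,1)] splice_pass[OF pu(2,1)]
            splice_preeq[OF sV sN] splice_sufeq[OF sV sN] by auto
        note sN' = rte_strand[OF N'(1)]
        have "ltp w' N N'" using ltp_cong2[OF preeq_sym[OF N'(3)] lt(1)] .
        then have NN': "ltp v N N'"
          using ltp_up[OF sN sN' pu(1) N'(2) _ sufeq_agree[OF sufeq_sym[OF N'(4)]]] 2 by simp
        have "w' \<le> lo \<beta>" using pass_split[OF sN pu(1) N(4)] e(3) 2 by auto
        then have "\<beta> \<in> N'" unfolding N'_def using N(4) by (rule splice_memI2[rotated])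
        moreover have "sufeq v N' X"
          using sufeq_trans[OF sufeq_mono[OF N'(4)] N(3)] 2 by simp
        moreover have "pass N' v" using sufeq_pass[OF sufeq_sym[OF N'(4)] sN pu(1) N(2)] 2 by blast
        moreover have "\<not> cw U N'" if U: "U \<in> C" for U
        proof
          assume "cw U N'"
          then have *: "ltp w' U V" "lts w' N U"
            using splice_cw2[OF rV N(1) pu(2,1) S[OF U]] mc_cw[OF C(1) U V] N(6)[OF U] unfolding N'_def by blast+
          then show False
            using lts_trans[OF sV sN S[OF U] lt(2)] mc_at[OF C(1) U V] pu by blast
        qed
        ultimately have "N' \<in> \<N>"
          using N'(1) above[OF sN' NN'] by (simp add: \<N>_def)
        then show False using max NN' by blast
      qed
    qed
    then show "\<not> cw N V \<and> \<not> cw V N" using N(6)[OF V] by (simp add: cw_def)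
  qed
  then show thesis using that N by blast
qed

lemma push':
  assumes C: "mc C" "X \<in> C" and pX: "pass X v" and W: "rte W" "pass W v" "\<And>V. V \<in> C \<Longrightarrow> \<not> cw V W"
    and e: "\<sigma> \<in> W" "\<tau> \<in> X" "lo \<sigma> = v" "ol \<tau> \<sigma>"
    and gap: "\<And>V. V \<in> C \<Longrightarrow> lts v V W \<Longrightarrow> \<not> ltp v X V"
  obtains N where "N \<in> C" "pass N v" "preeq v N X" "\<sigma> \<in> N" "lts v N W \<or> sufeq v W N"
proof (rule framed_edges.push[OF framed_edges_rev, of C X "- v" W \<sigma> \<tau>, unfolded rv_simps rv_mc, OF C pX W e(1,2) _ e(4)])
  show "- lo \<sigma> = - v" using e(3) by simp
qed (use gap that in blast)+

text \<open>Coherence forbids opposite strict comparisons on the two sides of \<open>v\<close>, so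
  this relation is the strict product order, restricted to the clique's routes through
  \<open>v\<close>.\<close>

lemma chain_trans:
  assumes C: "mc C" "A \<in> C" "B \<in> C" "D \<in> C" and p: "pass A v" "pass B v" "pass D v"
    and r: "ltp v A B \<or> lts v A B" "ltp v B D \<or> lts v B D"
  shows "ltp v A D \<or> lts v A D"
proof -
  have sA: "strand A" and sB: "strand B" and sD: "strand D" using mc_strand C by blast+
  have lp: "ltp v P Q \<or> preeq v P Q"
    if "P \<in> C" "Q \<in> C" "pass P v" "pass Q v" "ltp v P Q \<or> lts v P Q" for P Q
    using that ltp_total[of P Q v] mc_rte[OF C(1)] mc_at[OF C(1), of Q P v] by blast
  have ls: "lts v P Q \<or> sufeq v P Q"
    if "P \<in> C" "Q \<in> C" "pass P v" "pass Q v" "ltp v P Q \<or> lts v P Q" for P Q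
    using that lts_total[of P Q v] mc_rte[OF C(1)] mc_at[OF C(1), of P Q v] by blast
  show ?thesis
    using lp[OF C(2,3) p(1,2) r(1)] lp[OF C(3,4) p(2,3) r(2)] ls[OF C(2,3) p(1,2) r(1)]
      ls[OF C(3,4) p(2,3) r(2)] r
      ltp_trans[OF sA sB sD] lts_trans[OF sA sB sD]
      ltp_cong2[of v B D A] lts_cong2[of v B D A]
      ltp_cong1[of v B A D] lts_cong1[of v B A D] preeq_sym[of v A B] sufeq_sym[of v A B]
    by blast
qed

text \<open>
  In the chain of a maximal clique at a vertex, neighbours differ in only one of the two parts into
  which the vertex cuts them.
\<close>

lemma chain_step_down:
  assumes C: "mc C" "V0 \<in> C" "X \<in> C" and p: "pass V0 v" "pass X v" and lt: "ltp v V0 X \<or> lts v V0 X"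
  obtains Y where "Y \<in> C" "pass Y v" "sufeq v Y X" "ltp v Y X"
  | Y where "Y \<in> C" "pass Y v" "preeq v Y X" "lts v Y X"
proof -
  note S = mc_strand[OF C(1)] and at = mc_at[OF C(1)] and rt = mc_rte[OF C(1)]
  note sX = S[OF C(3)]
  define r where "r = (\<lambda>A B. ltp v A B \<or> lts v A B)"
  define \<V> where "\<V> = {V\<in>C. pass V v \<and> r V X}"
  have "\<exists>V\<in>\<V>. \<forall>V'\<in>\<V>. \<not> r V V'"
  proof (rule finite_maximal_rel)
    show "finite \<V>" using finite_mc[OF C(1)] by (simp add: \<V>_def)
    show "\<V> \<noteq> {}" using C p lt by (auto simp: \<V>_def r_def)
    show "\<not> r V V" if "V \<in> \<V>" for V using that S ltp_irrefl lts_irrefl by (auto simp: \<V>_def r_def)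
    show "r A D" if "A \<in> \<V>" "B \<in> \<V>" "D \<in> \<V>" "r A B" "r B D" for A B D
      using that chain_trans[OF C(1), of A B D v] by (auto simp: \<V>_def r_def)
  qed
  then obtain V where "V \<in> \<V>" and max: "\<And>V'. V' \<in> \<V> \<Longrightarrow> \<not> r V V'" by blast
  then have V: "V \<in> C" "pass V v" "ltp v V X \<or> lts v V X" by (auto simp: \<V>_def r_def)
  note sV = S[OF V(1)]
  have np: "\<not> ltp v X V \<or> ltp v V X" "\<not> lts v X V \<or> lts v V X"
    using V at[OF V(1) C(3)] at[OF C(3) V(1)] p by blast+
  consider (pre) "ltp v V X" "sufeq v V X" | (suf) "lts v V X" "preeq v V X" | (both) "ltp v V X" "lts v V X"
    using V(3) np ltp_total[OF rt[OF V(1)] rt[OF C(3)] V(2) p(2)]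
      lts_total[OF rt[OF V(1)] rt[OF C(3)] V(2) p(2)] by blast
  then show thesis
  proof cases
    case pre
    show thesis by (rule that(1)[OF V(1,2) pre(2,1)])
  next
    case suf
    show thesis by (rule that(2)[OF V(1,2) suf(2,1)])
  next
    case both
    \<comment> \<open>Both coordinates change. The route that changes only the first is coherent
      with the clique because nothing lies between \<open>V\<close> and \<open>X\<close>, so it
      serves as \<open>Y\<close>.\<close>
    define N where "N = splice V v X"
    note rV = rt[OF V(1)] and rX = rt[OF C(3)]
    have N: "rte N" "pass N v" "preeq v N V" "sufeq v N X"
      unfolding N_def using splice_rte[OF rV rX V(2) p(2)] splice_pass[OF V(2) p(2)] splice_preeq[OF sV sX]
        splice_sufeq[OF sV sX] by auto
    have "N \<in> C"
    proof (rule mc_max[OF C(1) N(1)])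
      fix U assume U: "U \<in> C"
      note sU = S[OF U]
      have "\<not> cw U N"
      proof
        assume "cw U N"
        then have *: "ltp v U V" "lts v X U"
          using splice_cw2[OF rV rX V(2) p(2) sU] mc_cw[OF C(1) U] V C unfolding N_def by blast+
        then show False using lts_trans[OF sV sX sU both(2)] at[OF U V(1)] V by blast
      qed
      moreover have "\<not> cw N U"
      proof
        assume "cw N U"
        then have *: "ltp v V U" "lts v U X"
          using splice_cw1[OF rV rX V(2) p(2) sU] mc_cw[OF C(1) _ U] V C unfolding N_def by blast+
        have "pass U v" using pass_of_lt[OF sV sU _ _ V(2) p(2) sX] * by blast
        then have "U \<in> \<V>" using U * by (simp add: \<V>_def r_def)
        then show False using max * by (auto simp: r_def)
      qed
      ultimately show "\<not> cw N U \<and> \<not> cw U N" by blast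
    qed
    then show thesis using that(1)[of N] N ltp_cong1[OF preeq_sym[OF N(3)] both(1)] by blast
  qed
qed

lemma chain_step_up:
  assumes C: "mc C" "V0 \<in> C" "X \<in> C" and p: "pass V0 v" "pass X v" and lt: "ltp v X V0 \<or> lts v X V0"
  obtains Z where "Z \<in> C" "pass Z v" "preeq v Z X" "lts v X Z"
  | Z where "Z \<in> C" "pass Z v" "sufeq v Z X" "ltp v X Z"
  using framed_edges.chain_step_down[OF framed_edges_rev, of C V0 X "- v", unfolded rv_simps rv_mc, OF C p] lt
  by blast

section \<open>Segments of routes and the labels of flips\<close>

definition seg :: "'e set \<Rightarrow> int \<Rightarrow> int \<Rightarrow> 'e set" where
  "seg X u v = {x\<in>X. u \<le> lo x \<and> hi x \<le> v}"

lemma strand_seg: "strand X \<Longrightarrow> strand (seg X u v)"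
  by (rule strand_sub) (auto simp: seg_def)

text \<open>The bounds on \<open>b\<close> and \<open>c\<close> ensure that the edges by which
  \<open>X\<close> enters and leaves the crossing belong to the segment.\<close>

lemma cws_segI:
  assumes "strand X" "cws w w' W X" "b \<in> X" "c \<in> X" "hi b \<le> w" "w' \<le> lo c"
  shows "cws w w' W (seg X (lo b) (hi c))"
proof -
  obtain \<beta> \<gamma> \<tau> \<sigma> where *: "\<beta> \<in> W" "\<gamma> \<in> X" "\<tau> \<in> X" "\<sigma> \<in> W" "hi \<beta> = w" "hi \<gamma> = w" "lo \<tau> = w'" "lo \<sigma> = w'"
    "il \<beta> \<gamma>" "ol \<tau> \<sigma>" "w \<le> w'" "agree W X w w'" using assms(2) by (rule cwsE)
  have lts: "lo b < hi b" "lo c < hi c" using strand_lt assms by blast+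
  have "lo b \<le> lo \<gamma>"
    using strandD[OF assms(1,3) *(2)] strand_lt[OF assms(1) *(2)] assms(5) *(6) lts by auto
  then have g: "\<gamma> \<in> seg X (lo b) (hi c)" using * assms(6) lts by (auto simp: seg_def)
  have "hi \<tau> \<le> hi c"
    using strandD[OF assms(1) *(3) assms(4)] strand_lt[OF assms(1) *(3)] assms(6) *(7) lts by auto
  then have t: "\<tau> \<in> seg X (lo b) (hi c)" using * assms(5) lts by (auto simp: seg_def)
  have "agree W (seg X (lo b) (hi c)) w w'"
    using *(12) assms(5,6) lts by (auto simp: agree_def seg_def)
  then show ?thesis using cwsI[OF *(1) g *(5,9) t *(4,7,10,11)] by blast
qed

lemma cws_segD:
  assumes "strand X" "cws w w' W (seg X u v)"
  shows "cws w w' W X"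
proof -
  obtain \<beta> \<gamma> \<tau> \<sigma> where *: "\<beta> \<in> W" "\<gamma> \<in> seg X u v" "\<tau> \<in> seg X u v" "\<sigma> \<in> W" "hi \<beta> = w" "hi \<gamma> = w"
    "lo \<tau> = w'" "lo \<sigma> = w'" "il \<beta> \<gamma>" "ol \<tau> \<sigma>" "w \<le> w'" "agree W (seg X u v) w w'"
    using assms(2) by (rule cwsE)
  have "lo \<gamma> < hi \<gamma>" "lo \<tau> < hi \<tau>" using * strand_lt[OF strand_seg[OF assms(1)]] by blast+
  then have "u \<le> w" "w' \<le> v" using * by (auto simp: seg_def)
  then have "agree W X w w'" using *(12) by (auto simp: agree_def seg_def)
  moreover have "\<gamma> \<in> X" "\<tau> \<in> X" using * by (auto simp: seg_def)
  ultimately show ?thesis using cwsI[OF *(1) _ *(5,9) _ *(4,7,10,11)] by blast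
qed

lemma cw_segD: "strand X \<Longrightarrow> cw W (seg X u v) \<Longrightarrow> cw W X"
  unfolding cw_def using cws_segD by blast

text \<open>By convexity of the order, \<open>W\<close> agrees with \<open>X\<close> from
  \<open>hi b\<close> to \<open>v\<close>. If it entered \<open>hi b\<close> by a different edge,
  \<open>push\<close> at that vertex would produce a route of \<open>C\<close> strictly between
  \<open>Y\<close> and \<open>X\<close>.\<close>

lemma corner_in:
  assumes C: "mc C" "Y \<in> C" "X \<in> C" and p: "pass Y v" "pass X v" and eq: "sufeq v Y X"
    and ab: "a \<in> Y" "b \<in> X" "hi a = hi b" "hi b \<le> v" "il a b" "agree Y X (hi b) v"
    and gap: "\<And>V. V \<in> C \<Longrightarrow> pass V v \<Longrightarrow> sufeq v V X \<Longrightarrow> ltp v Y V \<Longrightarrow> \<not> ltp v V X"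
    and W: "rte W" "pass W v" "\<And>V. V \<in> C \<Longrightarrow> \<not> cw V W" "ltp v Y W" "ltp v W X \<or> preeq v W X"
  shows "b \<in> W" "agree W X (hi b) v"
proof -
  note S = mc_strand[OF C(1)]
  note sY = S[OF C(2)] and sX = S[OF C(3)] and sW = rte_strand[OF W(1)]
  note rY = mc_rte[OF C(1,2)] and rX = mc_rte[OF C(1,3)]
  define w where "w = hi b"
  have wt: "s < w" "w < t"
    using pass_hi_less_t[OF rX p(2)] ab(4) strand_lt[OF sX ab(2)] s_le_lo[OF strand_E[OF sX ab(2)]]
    by (auto simp: w_def)
  have wv: "w \<le> v" using ab by (simp add: w_def)
  have pw: "pass Y w" "pass X w"
    using in_pass[OF rY ab(1)] in_pass[OF rX ab(2)] wt ab(3) by (auto simp: w_def)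
  have "b \<in> W \<and> agree W X w v"
  proof (cases "preeq v W X")
    case True
    then show ?thesis using ab preeq_agree by (auto simp: preeq_def)
  next
    case False
    then have WX: "ltp v W X" using W(5) by blast
    have agYW: "agree Y W w v"
      using interval_pre[OF sY sW sX W(4) WX _ pw] ab(6) by (simp add: w_def)
    have agYX: "agree Y X w v" using ab(6) by (simp add: w_def)
    have agWX: "agree W X w v" using agree_trans[OF agree_sym[OF agYW] agYX] .
    have pWw: "pass W w"
    proof (cases "w = v")
      case False
      obtain x where x: "x \<in> X" "lo x = w" using pw(2) by (rule passE)
      then have "hi x \<le> v" using pass_split[OF sX p(2) x(1)] False wv by auto
      then have "x \<in> W" using agWX x by (auto simp: agree_def)
      then show ?thesis using out_pass[OF W(1)] x wt by auto
    qed (use W in simp)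
    then obtain e where e: "e \<in> W" "hi e = w" by (rule passE)
    have "e = b"
    proof (rule ccontr)
      assume "e \<noteq> b"
      have YW: "ltp w Y W" using ltp_down[OF sY sW pw(1) W(4) agYW wv] .
      have WXw: "ltp w W X" using ltp_down[OF sW sX pWw WX agWX wv] .
      have "\<not> il b e"
        using ltp_at[OF ab(2) e(1) refl] sX sW ltp_asym[OF sX sW] WXw unfolding strand_def w_def by blast
      then have eb: "il e b"
        using il_total[of e b] strand_E[OF sW e(1)] strand_E[OF sX ab(2)] e \<open>e \<noteq> b\<close> by (auto simp: w_def)
      \<comment> \<open>The agreement of \<open>Y\<close> and \<open>X\<close> on
        \<open>[w, v]\<close> extends their common part after \<open>v\<close>, so that
        \<open>w\<close> can play the role of \<open>v\<close> below.\<close>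
      have sufw: "sufeq w Y X"
        unfolding sufeq_def
      proof (intro allI impI)
        fix x assume "w \<le> lo x"
        then show "x \<in> Y \<longleftrightarrow> x \<in> X"
          using agYX eq pass_split[OF sY p(1), of x] pass_split[OF sX p(2), of x]
          unfolding agree_def sufeq_def by blast
      qed
      have "\<not> lts w V X" if V: "V \<in> C" "ltp w W V" for V
        using ltp_trans[OF sY sW S[OF V(1)] YW V(2)] lts_cong2[OF sufeq_sym[OF sufw]] mc_at[OF C(1,2) V(1)] pw
        by blast
      then obtain N where N: "N \<in> C" "pass N w" "sufeq w N X" "e \<in> N" "ltp w W N \<or> preeq w W N"
        using push[OF C(1,3) pw(2) W(1) pWw W(3) e(1) ab(2) e(2) eb] by blast
      note sN = S[OF N(1)]
      have YN: "ltp w Y N" using N(5) ltp_trans[OF sY sW sN YW] ltp_cong2[OF _ YW] by blast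
      have NX: "ltp w N X" using ltp_at[OF N(4) ab(2) e(2) eb] sN sX by (simp add: strand_def)
      have pN: "pass N v"
        using sufeq_pass[OF sufeq_sym[OF N(3)] sX pw(2) p(2)] N(2) wv by force
      have agNX: "agree N X w v" using sufeq_agree[OF N(3)] .
      have "ltp v Y N"
        using ltp_up[OF sY sN pw(1) N(2) YN agree_trans[OF agYX agree_sym[OF agNX]] wv] .
      moreover have "ltp v N X" using ltp_up[OF sN sX N(2) pw(2) NX agNX wv] .
      moreover have "sufeq v N X" using sufeq_mono[OF N(3) wv] .
      ultimately show False using gap[OF N(1) pN] by blast
    qed
    then show ?thesis using e agWX by blast
  qed
  then show "b \<in> W" "agree W X (hi b) v" by (auto simp: w_def)
qed

lemma corner_out:
  assumes C: "mc C" "Z \<in> C" "X \<in> C" and p: "pass Z v" "pass X v" and eq: "preeq v Z X"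
    and cd: "c \<in> X" "d \<in> Z" "lo c = lo d" "v \<le> lo c" "ol c d" "agree X Z v (lo c)"
    and gap: "\<And>V. V \<in> C \<Longrightarrow> pass V v \<Longrightarrow> preeq v V X \<Longrightarrow> lts v X V \<Longrightarrow> \<not> lts v V Z"
    and W: "rte W" "pass W v" "\<And>V. V \<in> C \<Longrightarrow> \<not> cw V W" "lts v W Z" "lts v X W \<or> sufeq v W X"
  shows "c \<in> W" "agree W X v (lo c)"
proof -
  note * = framed_edges.corner_in[OF framed_edges_rev, of C Z X "- v" d c W, unfolded rv_simps rv_mc,
      OF C p eq cd(2,1) _ _ cd(5) _ _ W]
  show "c \<in> W" "agree W X v (lo c)"
    using *(1) *(2) cd(3,4) agree_sym[OF cd(6)] gap by auto
qed

text \<open>A route crossing \<open>splice Y v Z\<close> from above, but crossed from below by no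
  route of \<open>C\<close>, lies in the grid square at \<open>v\<close>. Then
  \<open>corner_in\<close> and \<open>corner_out\<close> make it follow \<open>X\<close> from
  \<open>b\<close> to \<open>v\<close> and from \<open>v\<close> to \<open>c\<close>.\<close>

lemma label_subset:
  assumes K: "corner C v Y X Z"
    and ab: "a \<in> Y" "b \<in> X" "hi a = hi b" "hi b \<le> v" "il a b" "agree Y X (hi b) v"
    and cd: "c \<in> X" "d \<in> Z" "lo c = lo d" "v \<le> lo c" "ol c d" "agree X Z v (lo c)"
    and W: "rte W" "\<And>V. V \<in> C \<Longrightarrow> \<not> cw V W" and R: "cw (splice Y v Z) W"
  shows "seg X (lo b) (hi c) \<subseteq> W"
proof -
  have C: "mc C" "Y \<in> C" "X \<in> C" "Z \<in> C" and p: "pass Y v" "pass X v" "pass Z v"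
    and eq: "sufeq v Y X" "preeq v Z X" and lt: "ltp v Y X" "lts v X Z"
    using K by (simp_all add: corner_def)
  have gapY: "\<not> ltp v V X" if "V \<in> C" "pass V v" "sufeq v V X" "ltp v Y V" for V
    using K that by (simp add: corner_def)
  have gapZ: "\<not> lts v V Z" if "V \<in> C" "pass V v" "preeq v V X" "lts v X V" for V
    using K that by (simp add: corner_def)
  note S = mc_strand[OF C(1)]
  note sY = S[OF C(2)] and sX = S[OF C(3)] and sZ = S[OF C(4)] and sW = rte_strand[OF W(1)]
  have *: "ltp v Y W" "lts v W Z"
    using splice_cw1[OF mc_rte[OF C(1,2)] mc_rte[OF C(1,4)] p(1,3) sW R] W C by blast+
  have pW: "pass W v" using pass_of_lt[OF sY sW _ _ p(1,3) sZ] * by blast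
  have "\<not> ltp v X W" using ltp_cong1[OF preeq_sym[OF eq(2)]] cwI[OF sZ sW] p(3) *(2) W(2) C by blast
  then have 1: "ltp v W X \<or> preeq v W X"
    using ltp_total[OF W(1) mc_rte[OF C(1,3)] pW p(2)] by blast
  have "\<not> lts v W X" using lts_cong2[OF sufeq_sym[OF eq(1)]] cwI[OF sY sW] p(1) *(1) W(2) C by blast
  then have 2: "lts v X W \<or> sufeq v W X"
    using lts_total[OF W(1) mc_rte[OF C(1,3)] pW p(2)] by blast
  note b = corner_in[OF C(1-3) p(1,2) eq(1) ab gapY W(1) pW W(2) *(1) 1]
  note c = corner_out[OF C(1,4,3) p(3,2) eq(2) cd gapZ W(1) pW W(2) *(2) 2]
  show ?thesis
  proof
    fix x assume "x \<in> seg X (lo b) (hi c)"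
    then have x: "x \<in> X" "lo b \<le> lo x" "hi x \<le> hi c" by (auto simp: seg_def)
    have "x = b \<or> hi b \<le> lo x"
      using strandD[OF sX x(1) ab(2)] strand_lt[OF sX x(1)] x(2) by auto
    moreover have "x = c \<or> hi x \<le> lo c"
      using strandD[OF sX x(1) cd(1)] strand_lt[OF sX cd(1)] strand_lt[OF sX x(1)] x(3) by auto
    ultimately show "x \<in> W"
      using b c x(1) pass_split[OF sX p(2) x(1)] unfolding agree_def by blast
  qed
qed

section \<open>The order of the framing lattice\<close>

lemma interval_suf:
  assumes s: "strand A" "strand B" "strand D" and lt: "lts v A B" "lts v B D" and ag: "agree A D v u"
    and p: "pass A u" "pass D u"
  shows "agree A B v u"
  using framed_edges.interval_pre[OF framed_edges_rev, of D B A "- v" "- u", unfolded rv_simps,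
      OF s(3,2,1) lt(2,1) agree_sym[OF ag] p(2,1)] agree_trans[OF ag] by blast

text \<open>Since \<open>W\<close> runs through the whole interval, each edge of \<open>P\<close>
  there overlaps an edge of \<open>W\<close>, which is in \<open>Q\<close> and hence in
  \<open>P\<close>; overlapping edges of a strand are equal.\<close>

lemma agree_superset:
  assumes W: "rte W" "pass W w" "pass W w'" and ag: "agree W Q w w'" and QP: "Q \<subseteq> P" "strand P"
  shows "agree W P w w'"
  unfolding agree_def
proof (intro allI impI iffI)
  note sW = rte_strand[OF W(1)]
  fix x assume x: "w \<le> lo x" "hi x \<le> w'"
  then show "x \<in> P" if "x \<in> W" using that ag QP by (auto simp: agree_def)
  assume xP: "x \<in> P"
  \<comment> \<open>The last edge of \<open>W\<close> that starts no later than \<open>x\<close> is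
    the one overlapping \<open>x\<close>.\<close>
  define L where "L = {y\<in>W. lo y \<le> lo x}"
  have "finite L" using strand_finite[OF sW] by (simp add: L_def)
  moreover have "L \<noteq> {}"
  proof -
    obtain z where "z \<in> W" "lo z = w" using W(2) by (rule passE)
    then show ?thesis using x(1) by (auto simp: L_def)
  qed
  ultimately obtain y where y: "y \<in> L" "\<And>z. z \<in> L \<Longrightarrow> lo z \<le> lo y"
    using Max_in[of "lo ` L"] Max_ge[of "lo ` L"] by (metis (no_types, lifting) finite_imageI image_iff image_is_empty)
  have yW: "y \<in> W" "lo y \<le> lo x" using y by (auto simp: L_def)
  have xx: "lo x < hi x" using strand_lt[OF QP(2) xP] .
  have "lo x < hi y"
  proof (rule ccontr)
    assume n: "\<not> lo x < hi y"
    then have "hi y < t" using x xx pass_hi_less_t[OF W(1,3)] by linarith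
    then obtain z where "z \<in> W" "lo z = hi y" using in_pass[OF W(1) yW(1)] by (auto elim: passE)
    then show False using y(2)[of z] n strand_lt[OF sW yW(1)] by (auto simp: L_def)
  qed
  then have "w \<le> lo y" "hi y \<le> w'"
    using pass_split[OF sW W(2) yW(1)] pass_split[OF sW W(3) yW(1)] x xx yW(2) by linarith+
  then have "y \<in> P" using ag yW QP by (auto simp: agree_def)
  then have "x = y" using strandD[OF QP(2) xP] yW(2) \<open>lo x < hi y\<close> xx by force
  then show "x \<in> W" using yW by simp
qed

text \<open>
  Choose the segment \<open>[w, w']\<close> on which \<open>W\<close> crosses a route of the clique with \<open>w'\<close> minimal and then
  \<open>w\<close> maximal. The routes crossing \<open>W\<close> on this segment form an interval of the chain at \<open>w\<close>, which is
  entered by a step in the first and left by a step in the second coordinate.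
\<close>

lemma exists_corner:
  assumes C: "mc C" and W: "rte W" "\<And>V. V \<in> C \<Longrightarrow> \<not> cw V W" and ex: "X0 \<in> C" "cw W X0"
  obtains Y X Z v a b c d where "corner C v Y X Z"
    "a \<in> Y" "b \<in> X" "hi a = hi b" "hi b \<le> v" "il a b" "agree Y X (hi b) v"
    "c \<in> X" "d \<in> Z" "lo c = lo d" "v \<le> lo c" "ol c d" "agree X Z v (lo c)"
    "cw W (seg X (lo b) (hi c))"
proof -
  note S = mc_strand[OF C] and rt = mc_rte[OF C] and sW = rte_strand[OF W(1)]
  define \<S> where "\<S> = {(w, w'). \<exists>X\<in>C. cws w w' W X}"
  have "\<S> \<subseteq> {s..t} \<times> {s..t}"
    using cws_pass(1) pass_hi_less_t W(1) unfolding \<S>_def by force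
  then have fin: "finite \<S>" by (rule finite_subset) simp
  have "\<S> \<noteq> {}" using ex by (auto simp: \<S>_def cw_def)
  define w' where "w' = Min (snd ` \<S>)"
  have "w' \<in> snd ` \<S>" unfolding w'_def using fin \<open>\<S> \<noteq> {}\<close> by (intro Min_in) auto
  then have ne: "{w. (w, w') \<in> \<S>} \<noteq> {}" by auto
  have fin1: "finite {w. (w, w') \<in> \<S>}"
    by (rule finite_subset[of _ "fst ` \<S>"]) (use fin in \<open>force+\<close>)
  define w where "w = Max {w. (w, w') \<in> \<S>}"
  have ww': "(w, w') \<in> \<S>" using Max_in[OF fin1 ne] by (simp add: w_def)
  have min_w': "w' \<le> y" if "cws x y W V" "V \<in> C" for x y V
    unfolding w'_def using fin that by (intro Min_le) (force simp: \<S>_def)+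
  have max_w: "x \<le> w" if "cws x w' W V" "V \<in> C" for x V
    unfolding w_def using fin1 that by (intro Max_ge) (auto simp: \<S>_def)
  define I where "I = {X\<in>C. cws w w' W X}"
  have "I \<noteq> {}" using ww' by (auto simp: I_def \<S>_def)
  have finI: "finite I" using finite_mc[OF C] by (simp add: I_def)
  have le: "w \<le> w'" using \<open>I \<noteq> {}\<close> by (auto simp: I_def cws_def)
  have pW: "pass W w" "pass W w'" using \<open>I \<noteq> {}\<close> cws_pass(1) W(1) by (auto simp: I_def)
  obtain \<beta> where \<beta>: "\<beta> \<in> W" "hi \<beta> = w" using pW(1) by (rule passE)
  obtain \<sigma> where \<sigma>: "\<sigma> \<in> W" "lo \<sigma> = w'" using pW(2) by (rule passE)
  have IC: "X \<in> C" "pass X w" "pass X w'" "agree W X w w'" "cws w w' W X" if X: "X \<in> I" for X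
  proof -
    show 1: "X \<in> C" "cws w w' W X" using X by (simp_all add: I_def)
    show "pass X w" "pass X w'" using cws_pass(2)[OF 1(2) rt[OF 1(1)]] by simp_all
    show "agree W X w w'" using 1(2) by (simp add: cws_def)
  qed
  have Ig: "\<exists>\<gamma>\<in>X. hi \<gamma> = w \<and> il \<beta> \<gamma>" if X: "X \<in> I" for X
  proof -
    obtain a b where ab: "a \<in> W" "b \<in> X" "hi a = w" "hi b = w" "il a b" using IC(5)[OF X] by (rule cwsE)
    have "a = \<beta>" using strand_hi_inj[OF sW ab(1) \<beta>(1)] ab(3) \<beta>(2) by simp
    then show ?thesis using ab by blast
  qed
  have It: "\<exists>\<tau>\<in>X. lo \<tau> = w' \<and> ol \<tau> \<sigma>" if X: "X \<in> I" for X
  proof -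
    obtain c d where cd: "c \<in> X" "d \<in> W" "lo c = w'" "lo d = w'" "ol c d" using IC(5)[OF X] by (rule cwsE)
    have "d = \<sigma>" using strand_lo_inj[OF sW cd(2) \<sigma>(1)] cd(4) \<sigma>(2) by simp
    then show ?thesis using cd by blast
  qed
  have II: "V \<in> I" if "V \<in> C" "\<gamma> \<in> V" "hi \<gamma> = w" "il \<beta> \<gamma>" "\<tau> \<in> V" "lo \<tau> = w'" "ol \<tau> \<sigma>" "agree W V w w'" for V \<gamma> \<tau>
    using that cwsI[OF \<beta>(1) _ \<beta>(2) _ _ \<sigma>(1)] le by (simp add: I_def)
  define r where "r = (\<lambda>v A B. ltp v A B \<or> lts v A B)"
  have r_irrefl: "\<not> r v A A" if "A \<in> C" for v A using ltp_irrefl lts_irrefl S that by (auto simp: r_def)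
  define good where "good = (\<lambda>X. \<exists>Y\<in>C. pass Y w \<and> sufeq w Y X \<and> ltp w Y X)"
  have r_trans: "r w A D" if "A \<in> I" "B \<in> I" "D \<in> I" "r w A B" "r w B D" for A B D
    using chain_trans[OF C IC(1)[OF that(1)] IC(1)[OF that(2)] IC(1)[OF that(3)] IC(2)[OF that(1)]
        IC(2)[OF that(2)] IC(2)[OF that(3)]] that(4,5) by (simp add: r_def)
  have "\<exists>X\<in>I. \<forall>V\<in>I. \<not> r w V X"
    by (rule finite_maximal_rel[OF finI \<open>I \<noteq> {}\<close>]) (blast intro: r_trans dest: r_irrefl[OF IC(1)])+
  then obtain X1 where X1: "X1 \<in> I" "\<And>V. V \<in> I \<Longrightarrow> \<not> r w V X1" by blast
  \<comment> \<open>The lowest route of \<open>I\<close> is entered by a step in the first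
    coordinate.\<close>
  have "good X1"
  proof -
    note sX = S[OF IC(1)[OF X1(1)]]
    obtain \<gamma> where \<gamma>: "\<gamma> \<in> X1" "hi \<gamma> = w" "il \<beta> \<gamma>" using Ig[OF X1(1)] by blast
    obtain \<tau> where \<tau>: "\<tau> \<in> X1" "lo \<tau> = w'" "ol \<tau> \<sigma>" using It[OF X1(1)] by blast
    have "\<exists>V\<in>C. pass V w \<and> r w V X1"
    proof (cases "\<exists>V\<in>C. ltp w W V \<and> lts w V X1")
      case True
      then obtain V where V: "V \<in> C" "ltp w W V" "lts w V X1" by blast
      then show ?thesis using pass_of_lt[OF sW S _ _ pW(1) IC(2)[OF X1(1)] sX] unfolding r_def by blast
    next
      case False
      then obtain N where N: "N \<in> C" "pass N w" "\<beta> \<in> N"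
        using push[OF C IC(1,2)[OF X1(1)] W(1) pW(1) W(2) \<beta>(1) \<gamma>(1) \<beta>(2) \<gamma>(3)] by blast
      then have "ltp w N X1"
        using ltp_at[OF N(3) \<gamma>(1) \<beta>(2) \<gamma>(3)] S[OF N(1)] sX by (simp add: strand_def)
      then show ?thesis using N by (auto simp: r_def)
    qed
    then obtain V where V: "V \<in> C" "pass V w" "ltp w V X1 \<or> lts w V X1" by (auto simp: r_def)
    then show ?thesis
    proof (cases rule: chain_step_down[OF C V(1) IC(1)[OF X1(1)] V(2) IC(2)[OF X1(1)] V(3), case_names 1 2])
      case (1 Y)
      then show ?thesis by (auto simp: good_def)
    next
      case (2 Y)
      note sY = S[OF 2(1)]
      obtain c d where cd: "c \<in> Y" "d \<in> X1" "lo c = lo d" "w \<le> lo c" "ol c d" "agree Y X1 w (lo c)"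
        using 2(4) by (rule ltsE)
      have gY: "\<gamma> \<in> Y" using 2(3) \<gamma> by (auto simp: preeq_def)
      have agWX: "agree W X1 w w'" using IC[OF X1(1)] by blast
      \<comment> \<open>A step in the second coordinate is impossible: if it happens before
        \<open>w'\<close>, then \<open>W\<close> crosses \<open>Y\<close> on a segment ending
        earlier; otherwise \<open>Y\<close> belongs to \<open>I\<close> and is lower than
        \<open>X1\<close>.\<close>
      consider "lo c < w'" | "lo c = w'" | "w' < lo c" by linarith
      then have False
      proof cases
        case 1
        have "hi d \<le> w'" using pass_split[OF sX IC(3)[OF X1(1)] cd(2)] 1 cd(3) by linarith
        then have dW: "d \<in> W" using agWX cd by (auto simp: agree_def)
        have "agree W Y w (lo c)"
          using agree_trans[OF agree_mono[OF agWX] agree_sym[OF cd(6)]] 1 by simp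
        then have "cws w (lo c) W Y"
          using cwsI[OF \<beta>(1) gY \<beta>(2) \<gamma>(3) cd(1) dW refl cd(5,4)] by blast
        then show False using min_w'[OF _ 2(1)] 1 by fastforce
      next
        case c2: 2
        have "d = \<tau>" using strand_lo_inj[OF sX cd(2) \<tau>(1)] c2 cd(3) \<tau>(2) by simp
        then have "ol c \<sigma>" using ol_trans[OF cd(5)] \<tau>(3) by blast
        moreover have "agree W Y w w'" using agree_trans[OF agWX agree_sym[OF cd(6)[unfolded c2]]] .
        ultimately have "Y \<in> I" using II[OF 2(1) gY \<gamma>(2,3) cd(1) c2] by blast
        then show False using X1(2) 2(4) by (auto simp: r_def)
      next
        case 3
        have "hi \<tau> \<le> lo c" using lo_split[OF sX \<tau>(1) cd(2)] 3 cd(3) \<tau>(2) by linarith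
        then have "\<tau> \<in> Y" using cd(6) \<tau> le by (auto simp: agree_def)
        moreover have "agree W Y w w'"
          using agree_trans[OF agWX agree_sym[OF agree_mono[OF cd(6)]]] 3 by simp
        ultimately have "Y \<in> I" using II[OF 2(1) gY \<gamma>(2,3) _ \<tau>(2,3)] by blast
        then show False using X1(2) 2(4) by (auto simp: r_def)
      qed
      then show ?thesis ..
    qed
  qed
  then have ne2: "{X\<in>I. good X} \<noteq> {}" using X1 by blast
  \<comment> \<open>The highest good route is taken, so that the next step up cannot be in the first
    coordinate and stay in \<open>I\<close>.\<close>
  have "\<exists>X\<in>{X\<in>I. good X}. \<forall>V\<in>{X\<in>I. good X}. \<not> r w X V"
  proof (rule finite_maximal_rel[OF _ ne2])
    show "finite {X\<in>I. good X}" using finI by simp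
  qed (blast intro: r_trans dest: r_irrefl[OF IC(1)])+
  then obtain X where X: "X \<in> I" "good X" "\<And>V. V \<in> I \<Longrightarrow> good V \<Longrightarrow> \<not> r w X V" by blast
  note XC = IC(1)[OF X(1)] and pX = IC(2,3)[OF X(1)] and agWX = IC(4)[OF X(1)] and sX = S[OF IC(1)[OF X(1)]]
  obtain \<gamma> where \<gamma>: "\<gamma> \<in> X" "hi \<gamma> = w" "il \<beta> \<gamma>" using Ig[OF X(1)] by blast
  obtain \<tau> where \<tau>: "\<tau> \<in> X" "lo \<tau> = w'" "ol \<tau> \<sigma>" using It[OF X(1)] by blast
  have "\<exists>Z\<in>C. pass Z w \<and> pass Z w' \<and> preeq w Z X \<and> lts w X Z \<and> agree X Z w w'"
  proof -
    \<comment> \<open>The upper neighbour is sought in the chain at \<open>w'\<close>, so that a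
      change after \<open>w'\<close> automatically keeps the agreement on \<open>[w, w']\<close>. A
      change before \<open>w'\<close> either starts a crossing of \<open>W\<close> later than
      \<open>w\<close> or gives a higher good route.\<close>
    have "\<exists>V\<in>C. pass V w' \<and> r w' X V"
    proof (cases "\<exists>V\<in>C. lts w' V W \<and> ltp w' X V")
      case True
      then obtain V where V: "V \<in> C" "lts w' V W" "ltp w' X V" by blast
      then show ?thesis using pass_of_lt[OF sX S _ _ pX(2) pW(2) sW] unfolding r_def by blast
    next
      case False
      then obtain N where N: "N \<in> C" "pass N w'" "\<sigma> \<in> N"
        using push'[OF C XC pX(2) W(1) pW(2) W(2) \<sigma>(1) \<tau>(1) \<sigma>(2) \<tau>(3)] by blast
      then have "lts w' X N"
        using lts_at[OF \<tau>(1) N(3) \<tau>(2,3)] S[OF N(1)] sX by (simp add: strand_def)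
      then show ?thesis using N by (auto simp: r_def)
    qed
    then obtain V where V: "V \<in> C" "pass V w'" "ltp w' X V \<or> lts w' X V" by (auto simp: r_def)
    then show ?thesis
    proof (cases rule: chain_step_up[OF C V(1) XC V(2) pX(2) V(3), case_names 1 2])
      case (1 Z)
      have pZ: "pass Z w"
        using preeq_pass[OF preeq_sym[OF 1(3)] sX pX(2,1)] 1(2) le by force
      have ag: "agree X Z w w'" using preeq_agree[OF preeq_sym[OF 1(3)]] .
      have "lts w X Z" using lts_down[OF sX S[OF 1(1)] pX(2) 1(2,4) ag le] .
      then show ?thesis using 1 pZ ag preeq_mono[OF 1(3) le] by blast
    next
      case (2 Z)
      note sZ = S[OF 2(1)]
      obtain a b where ab: "a \<in> X" "b \<in> Z" "hi a = hi b" "hi a \<le> w'" "il a b" "agree X Z (hi a) w'"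
        using 2(4) by (rule ltpE)
      have tZ: "\<tau> \<in> Z" using 2(3) \<tau> by (auto simp: sufeq_def)
      have False
      proof (cases "w < hi a")
        case True
        then have "w \<le> lo a" using pass_split[OF sX pX(1) ab(1)] by linarith
        then have aW: "a \<in> W" using agWX ab by (auto simp: agree_def)
        have "agree W Z (hi a) w'" using agree_trans[OF agree_mono[OF agWX] ab(6)] True by simp
        then have "cws (hi a) w' W Z" using cwsI[OF aW ab(2) refl ab(5) tZ \<sigma>(1) \<tau>(2,3) ab(4)] by blast
        then show False using max_w[OF _ 2(1)] True by fastforce
      next
        case False
        have agXZ: "agree X Z w w'" using agree_mono[OF ab(6)] False by simp
        have "\<exists>g\<in>Z. hi g = w \<and> il \<beta> g"
        proof (cases "hi a = w")
          case True
          then have "a = \<gamma>" using strand_hi_inj[OF sX ab(1) \<gamma>(1)] \<gamma>(2) by simp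
          then show ?thesis using ab True il_trans[OF \<gamma>(3)] by metis
        next
          case n: False
          then have "hi a \<le> lo \<gamma>" using hi_split[OF sX \<gamma>(1) ab(1)] \<gamma>(2) False by linarith
          then have "\<gamma> \<in> Z" using ab(6) \<gamma> le by (auto simp: agree_def)
          then show ?thesis using \<gamma> by blast
        qed
        then have ZI: "Z \<in> I"
          using II[OF 2(1) _ _ _ tZ \<tau>(2,3) agree_trans[OF agWX agXZ]] by blast
        have suf: "sufeq w X Z"
          unfolding sufeq_def
        proof (intro allI impI)
          fix x assume "w \<le> lo x"
          then show "x \<in> X \<longleftrightarrow> x \<in> Z"
            using agXZ 2(3) pass_split[OF sX pX(2), of x] pass_split[OF sZ 2(2), of x]
            unfolding agree_def sufeq_def by blast
        qed
        have "ltp w X Z" using ltpI[OF ab(1,2) _ ab(5)] agree_mono[OF ab(6), of "hi a" w] False le by simp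
        then show False using X(3)[OF ZI] XC pX(1) suf by (auto simp: good_def r_def)
      qed
      then show ?thesis ..
    qed
  qed
  then obtain Z0 where Z0: "Z0 \<in> C" "pass Z0 w" "pass Z0 w'" "preeq w Z0 X" "lts w X Z0" "agree X Z0 w w'" by blast
  \<comment> \<open>The nearest neighbours of \<open>X\<close> on both sides are chosen, to satisfy
    the gap conditions of \<open>corner\<close>.\<close>
  define \<Y> where "\<Y> = {Y\<in>C. pass Y w \<and> sufeq w Y X \<and> ltp w Y X}"
  have "\<exists>Y\<in>\<Y>. \<forall>V\<in>\<Y>. \<not> ltp w Y V"
  proof (rule finite_maximal_rel)
    show "finite \<Y>" using finite_mc[OF C] by (simp add: \<Y>_def)
    show "\<Y> \<noteq> {}" using X(2) by (auto simp: \<Y>_def good_def)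
    show "\<not> ltp w V V" if "V \<in> \<Y>" for V using that S ltp_irrefl by (auto simp: \<Y>_def)
    show "ltp w A D" if "A \<in> \<Y>" "B \<in> \<Y>" "D \<in> \<Y>" "ltp w A B" "ltp w B D" for A B D
      using that ltp_trans[OF S S S] by (auto simp: \<Y>_def)
  qed
  then obtain Y where Y: "Y \<in> \<Y>" "\<And>V. V \<in> \<Y> \<Longrightarrow> \<not> ltp w Y V" by blast
  define \<Z> where "\<Z> = {Z\<in>C. pass Z w \<and> preeq w Z X \<and> lts w X Z}"
  have "\<exists>Z\<in>\<Z>. \<forall>V\<in>\<Z>. \<not> lts w V Z"
  proof (rule finite_maximal_rel[where r = "\<lambda>A B. lts w B A"])
    show "finite \<Z>" using finite_mc[OF C] by (simp add: \<Z>_def)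
    show "\<Z> \<noteq> {}" using Z0 by (auto simp: \<Z>_def)
    show "\<not> lts w V V" if "V \<in> \<Z>" for V using that S lts_irrefl by (auto simp: \<Z>_def)
    show "lts w D A" if "A \<in> \<Z>" "B \<in> \<Z>" "D \<in> \<Z>" "lts w B A" "lts w D B" for A B D
      using that lts_trans[OF S S S] by (auto simp: \<Z>_def)
  qed
  then obtain Z where Z: "Z \<in> \<Z>" "\<And>V. V \<in> \<Z> \<Longrightarrow> \<not> lts w V Z" by blast
  have Y': "Y \<in> C" "pass Y w" "sufeq w Y X" "ltp w Y X" using Y by (auto simp: \<Y>_def)
  have Z': "Z \<in> C" "pass Z w" "preeq w Z X" "lts w X Z" using Z by (auto simp: \<Z>_def)
  note sZ = S[OF Z'(1)]
  \<comment> \<open>\<open>Z\<close> lies between \<open>X\<close> and \<open>Z0\<close>, which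
    agree up to \<open>w'\<close>. Consequently \<open>c\<close> leaves \<open>X\<close> at
    \<open>w'\<close> or later, and the label covers the crossing with \<open>W\<close>.\<close>
  have agXZ: "agree X Z w w'"
  proof -
    have "\<not> lts w Z0 Z" using Z(2) Z0 by (auto simp: \<Z>_def)
    then consider "lts w Z Z0" | "sufeq w Z Z0"
      using lts_total[OF rt[OF Z'(1)] rt[OF Z0(1)] Z'(2) Z0(2)] by blast
    then show ?thesis
    proof cases
      case 1
      then show ?thesis using interval_suf[OF sX sZ S[OF Z0(1)] Z'(4) 1 Z0(6) pX(2) Z0(3)] by blast
    next
      case 2
      then show ?thesis using agree_trans[OF Z0(6) sufeq_agree[OF sufeq_sym]] by blast
    qed
  qed
  obtain a b where ab: "a \<in> Y" "b \<in> X" "hi a = hi b" "hi a \<le> w" "il a b" "agree Y X (hi a) w"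
    using Y'(4) by (rule ltpE)
  obtain c d where cd: "c \<in> X" "d \<in> Z" "lo c = lo d" "w \<le> lo c" "ol c d" "agree X Z w (lo c)"
    using Z'(4) by (rule ltsE)
  have w'c: "w' \<le> lo c"
  proof (rule ccontr)
    assume "\<not> w' \<le> lo c"
    then have "hi c \<le> w'" using pass_split[OF sX pX(2) cd(1)] by blast
    then have "c \<in> Z" using agXZ cd by (auto simp: agree_def)
    then have "c = d" using strand_lo_inj[OF sZ _ cd(2)] cd(3) by blast
    then show False using cd ol_irrefl by blast
  qed
  have "cws w w' W (seg X (lo b) (hi c))"
    using cws_segI[OF sX IC(5)[OF X(1)] ab(2) cd(1)] ab w'c by simp
  then have lab: "cw W (seg X (lo b) (hi c))" by (auto simp: cw_def)
  have "corner C w Y X Z"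
    unfolding corner_def using C XC pX Y' Z' Y(2) Z(2) by (auto simp: \<Y>_def \<Z>_def)
  then show thesis
    by (rule that[OF _ ab(1-3) ab(4)[unfolded ab(3)] ab(5) ab(6)[unfolded ab(3)] cd lab])
qed

text \<open>Maximality provides \<open>W\<close> in \<open>C'\<close> that crosses a route of
  \<open>C\<close> from below, and the flip is made at a corner whose label \<open>W\<close>
  crosses. If the inserted route were cw-below some \<open>P\<close> in \<open>C'\<close>, then
  \<open>P\<close> would contain the label and be crossed by \<open>W\<close>.\<close>

lemma descent:
  assumes C: "mc C" "mc C'" "below C' C" "C' \<noteq> C"
  obtains D where "flip D C" "below C' D"
proof -
  have "\<exists>W\<in>C'. \<exists>X0\<in>C. cw W X0"
  proof (rule ccontr)
    assume "\<not> ?thesis"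
    then have "R \<in> C" if "R \<in> C'" for R
      using mc_max[OF C(1) mc_rte[OF C(2) that]] C(3) that unfolding below_def by blast
    then show False using mc_subset[OF C(2,1)] C(4) by blast
  qed
  then obtain W X0 where W: "W \<in> C'" "X0 \<in> C" "cw W X0" by blast
  have up: "\<not> cw V P" if "V \<in> C" "P \<in> C'" for V P using C(3) that by (auto simp: below_def)
  obtain Y X Z v a b c d where K: "corner C v Y X Z"
    and ab: "a \<in> Y" "b \<in> X" "hi a = hi b" "hi b \<le> v" "il a b" "agree Y X (hi b) v"
    and cd: "c \<in> X" "d \<in> Z" "lo c = lo d" "v \<le> lo c" "ol c d" "agree X Z v (lo c)"
    and lab: "cw W (seg X (lo b) (hi c))"
    by (rule exists_corner[OF C(1) mc_rte[OF C(2) W(1)] up[OF _ W(1)] W(2,3)])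
  have "flip (insert (splice Y v Z) (C - {X})) C"
    using flip_corner[OF K] .
  moreover have "\<not> cw (splice Y v Z) P" if P: "P \<in> C'" for P
  proof
    assume "cw (splice Y v Z) P"
    then have sub: "seg X (lo b) (hi c) \<subseteq> P"
      using label_subset[OF K ab cd mc_rte[OF C(2) P] up[OF _ P]] by blast
    obtain w w' where w: "cws w w' W (seg X (lo b) (hi c))" using lab by (auto simp: cw_def)
    have rW: "rte W" using mc_rte[OF C(2) W(1)] .
    have "agree W P w w'"
      using agree_superset[OF rW _ _ _ sub mc_strand[OF C(2) P]] cws_pass(1)[OF w rW] w by (auto simp: cws_def)
    then have "cws w w' W P" using w sub by (auto simp: cws_def)
    then show False using mc_cw[OF C(2) W(1) P] by (auto simp: cw_def)
  qed
  then have "below C' (insert (splice Y v Z) (C - {X}))" using up by (auto simp: below_def)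
  ultimately show thesis by (rule that)
qed

lemma flipE:
  assumes "flip C C'"
  obtains D R R' where "mc C" "mc C'" "R \<notin> D" "R' \<notin> D" "C = insert R D" "C' = insert R' D" "cw R R'"
  using assms that unfolding flip_def by (elim conjE exE)

lemma flip_irrefl: "\<not> flip D D"
proof
  assume "flip D D"
  then obtain D0 R R' where *: "mc D" "D = insert R D0" "D = insert R' D0" "cw R R'" by (rule flipE)
  have "R \<in> D" by (subst *(2)) simp
  moreover have "R' \<in> D" by (subst *(3)) simp
  ultimately show False using mc_cw[OF *(1)] *(4) by blast
qed

lemma flips_imp_below:
  assumes "flip\<^sup>*\<^sup>* A C" "mc A"
  shows "below A C"
  using assms(1)
proof (induction rule: rtranclp_induct)
  case base
  show ?case by (rule below_refl[OF assms(2)])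
next
  case (step D C)
  show ?case by (rule below_flip[OF assms(2) step(3,2)])
qed

text \<open>Well-founded induction along downward flips of \<open>C\<close> that stay above
  \<open>A\<close>: there are finitely many, and antisymmetry of \<open>below\<close> rules out
  cycles.\<close>

lemma below_imp_flips:
  assumes "mc A" "mc C" "below A C"
  shows "flip\<^sup>*\<^sup>* A C"
proof -
  define F where "F = {(D, C). flip D C}"
  have "C \<subseteq> Pow E" if "mc C" for C using mc_strand[OF that] by (auto simp: strand_def)
  then have "F \<subseteq> Pow (Pow E) \<times> Pow (Pow E)"
    using flip_mc unfolding F_def by blast
  moreover have "finite (Pow (Pow E) \<times> Pow (Pow E))" using finite_E by simp
  ultimately have "finite F" by (rule finite_subset)
  moreover have "acyclic F"
  proof (rule acyclicI, intro allI notI)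
    fix D assume "(D, D) \<in> F\<^sup>+"
    then obtain D' where *: "(D, D') \<in> F" "(D', D) \<in> F\<^sup>*" by (blast dest: tranclD)
    then have f: "flip D D'" by (simp add: F_def)
    have "flip\<^sup>*\<^sup>* D' D" using *(2) by (simp add: F_def rtrancl_def)
    then have "below D' D" using flips_imp_below flip_mc(2)[OF f] by blast
    then have "D = D'" using below_antisym[OF flip_mc[OF f] flip_below[OF f]] by blast
    then show False using f flip_irrefl by simp
  qed
  ultimately have "wf F" by (rule finite_acyclic_wf)
  then show ?thesis using assms(2,3)
  proof (induction C rule: wf_induct_rule)
    case (less C)
    show ?case
    proof (cases "A = C")
      case False
      obtain D where D: "flip D C" "below A D" using descent[OF less(2) assms(1) less(3) False] .
      have "(D, C) \<in> F" using D(1) by (simp add: F_def)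
      then have "flip\<^sup>*\<^sup>* A D" using less(1) flip_mc(1)[OF D(1)] D(2) by blast
      then show ?thesis using D(1) by (rule rtranclp.rtrancl_into_rtrancl)
    qed simp
  qed
qed

lemma flips_iff_below: "mc A \<Longrightarrow> mc C \<Longrightarrow> flip\<^sup>*\<^sup>* A C \<longleftrightarrow> below A C"
  using flips_imp_below below_imp_flips by blast

section \<open>Join-irreducible elements\<close>

text \<open>
  For a ccw-extended path \<open>P\<close> this is the least maximal clique none of whose routes \<open>R\<close> satisfies
  \<open>cw R P\<close>; for \<open>P = {}\<close> it is the bottom element.
\<close>

definition least_avoiding :: "'e set \<Rightarrow> 'e set set" where
  "least_avoiding P = {R. rte R \<and> \<not> cw R P \<and> (\<forall>V. rte V \<longrightarrow> cw V R \<longrightarrow> cw V P)}"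

text \<open>By \<open>ex\<close>, a route \<open>X\<close> coherent with all members is not cw-below
  \<open>P\<close>. If a route not cw-below \<open>P\<close> were cw-below \<open>X\<close>, an
  extremal such route would be a member crossing \<open>X\<close>.\<close>

lemma mc_least_avoiding:
  assumes P: "strand P" and ex: "\<And>X. rte X \<Longrightarrow> cw X P \<Longrightarrow> \<exists>R\<in>least_avoiding P. cw X R"
  shows "mc (least_avoiding P)"
  unfolding mc_def
proof (intro conjI ballI allI impI)
  show "rte R" if "R \<in> least_avoiding P" for R using that by (simp add: least_avoiding_def)
  show "\<not> cw R Q" if "R \<in> least_avoiding P" "Q \<in> least_avoiding P" for R Q
    using that by (auto simp: least_avoiding_def)
  fix X assume X: "rte X" and coh: "\<forall>Q\<in>least_avoiding P. \<not> cw X Q \<and> \<not> cw Q X"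
  note sX = rte_strand[OF X]
  have nXP: "\<not> cw X P" using ex[OF X] coh by blast
  have "cw V P" if V: "rte V" "cw V X" for V
  proof (rule ccontr)
    assume nVP: "\<not> cw V P"
    obtain v v' where c: "cws v v' V X" using V(2) by (auto simp: cw_def)
    have vv: "v \<le> v'" using c by (simp add: cws_def)
    have pX: "pass X v" using cws_pass(2)[OF c X] by blast
    \<comment> \<open>Candidates for a member crossing \<open>X\<close> at \<open>v\<close>. The
      choice is minimal before \<open>v\<close> and then maximal after it, that is, as far below
      \<open>X\<close> as possible.\<close>
    define \<V> where "\<V> = {R. rte R \<and> pass R v \<and> ltp v R X \<and> lts v X R \<and> \<not> cw R P}"
    have V\<V>: "V \<in> \<V>" using V nVP cws_at[OF c order_refl vv] cws_pass(1)[OF c V(1)] by (simp add: \<V>_def)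
    have "\<V> \<subseteq> Pow E" using rte_strand by (auto simp: \<V>_def strand_def)
    then have fin: "finite \<V>" using finite_E by (meson finite_Pow_iff finite_subset)
    have s\<V>: "strand R" if "R \<in> \<V>" for R using that rte_strand by (auto simp: \<V>_def)
    have "\<exists>R\<in>\<V>. \<forall>R'\<in>\<V>. \<not> ltp v R' R"
    proof (rule finite_maximal_rel[OF fin, where r = "\<lambda>A B. ltp v B A"])
      show "\<V> \<noteq> {}" using V\<V> by blast
      show "\<not> ltp v A A" if "A \<in> \<V>" for A using ltp_irrefl[OF s\<V>[OF that]] .
      show "ltp v D A" if "A \<in> \<V>" "B \<in> \<V>" "D \<in> \<V>" "ltp v B A" "ltp v D B" for A B D
        using ltp_trans[OF s\<V>[OF that(3)] s\<V>[OF that(2)] s\<V>[OF that(1)] that(5,4)] .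
    qed
    then obtain R1 where R1: "R1 \<in> \<V>" "\<And>R'. R' \<in> \<V> \<Longrightarrow> \<not> ltp v R' R1" by blast
    define \<V>' where "\<V>' = {R\<in>\<V>. preeq v R R1}"
    have "\<exists>R\<in>\<V>'. \<forall>R'\<in>\<V>'. \<not> lts v R R'"
    proof (rule finite_maximal_rel)
      show "finite \<V>'" using fin by (simp add: \<V>'_def)
      show "\<V>' \<noteq> {}" using R1 by (auto simp: \<V>'_def)
      show "\<not> lts v A A" if "A \<in> \<V>'" for A using that lts_irrefl[OF s\<V>] by (simp add: \<V>'_def)
      show "lts v A D" if "A \<in> \<V>'" "B \<in> \<V>'" "D \<in> \<V>'" "lts v A B" "lts v B D" for A B D
        using that lts_trans[OF s\<V> s\<V> s\<V>, of A B D] by (simp add: \<V>'_def)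
    qed
    then obtain R where R: "R \<in> \<V>'" "\<And>R'. R' \<in> \<V>' \<Longrightarrow> \<not> lts v R R'" by blast
    have R\<V>: "R \<in> \<V>" "preeq v R R1" using R by (auto simp: \<V>'_def)
    have Rmin: "\<not> ltp v R' R" if "R' \<in> \<V>" for R'
      using R1(2)[OF that] ltp_cong2[OF R\<V>(2)] by blast
    have Rmax: "\<not> lts v R R'" if "R' \<in> \<V>" "preeq v R' R" for R'
      using R(2)[of R'] that preeq_trans[OF that(2) R\<V>(2)] by (auto simp: \<V>'_def)
    have rR: "rte R" "pass R v" "ltp v R X" "lts v X R" "\<not> cw R P" using R\<V> by (auto simp: \<V>_def)
    note sR = rte_strand[OF rR(1)]
    have "cw U P" if U: "rte U" "cw U R" for U
    proof (rule ccontr)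
      assume nUP: "\<not> cw U P"
      note sU = rte_strand[OF U(1)]
      \<comment> \<open>A crossing of the splice with \<open>P\<close> would show at
        \<open>u\<close>, and the comparison of \<open>B\<close> with \<open>A\<close> carries it
        over to one of them.\<close>
      have spl: "\<not> cw (splice A u B) P"
        if "rte A" "rte B" "\<not> cw A P" "\<not> cw B P" "pass A u" "pass B u" "lts u B A \<or> ltp u B A"
        for A B u
      proof
        note sA = rte_strand[OF that(1)] and sB = rte_strand[OF that(2)]
        assume "cw (splice A u B) P"
        then have *: "ltp u A P" "lts u P B" using splice_cw1[OF that(1,2,5,6) P] that(3,4) by blast+
        have "ltp u B P \<or> lts u P A"
          using that(7) ltp_trans[OF sB sA P _ *(1)] lts_trans[OF P sB sA *(2)] by blast
        then show False using * cwI[OF sA P] cwI[OF sB P] that by blast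
      qed
      obtain w w' where w: "cws w w' U R" using U(2) by (auto simp: cw_def)
      have ww: "w \<le> w'" using w by (simp add: cws_def)
      have pw: "pass U w" "pass U w'" "pass R w" "pass R w'" using cws_pass[OF w] U rR by blast+
      \<comment> \<open>In each case \<open>U\<close> improves on \<open>R\<close>: by lending its
        beginning, by lending its end, or by being a better candidate itself.\<close>
      consider "w' < v" | "v < w" | "w \<le> v" "v \<le> w'" by linarith
      then show False
      proof cases
        case 1
        have lt: "ltp w' U R" "lts w' R U" using cws_at[OF w ww] by blast+
        define N where "N = splice U w' R"
        have N: "rte N" "pass N w'" "preeq w' N U" "sufeq w' N R"
          unfolding N_def using splice_rte[OF U(1) rR(1) pw(2,4)] splice_pass[OF pw(2,4)]
            splice_preeq[OF sU sR] splice_sufeq[OF sU sR] by auto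
        note sN = rte_strand[OF N(1)]
        have NR: "ltp v N R"
          using ltp_up[OF sN sR N(2) pw(4) ltp_cong1[OF preeq_sym[OF N(3)] lt(1)] sufeq_agree[OF N(4)]] 1 by simp
        have "pass N v" using sufeq_pass[OF sufeq_sym[OF N(4)] sR pw(4) rR(2)] 1 by blast
        moreover have "lts v X N" using lts_cong2[OF sufeq_sym[OF sufeq_mono[OF N(4)]] rR(4)] 1 by simp
        moreover have "\<not> cw N P" unfolding N_def using spl[OF U(1) rR(1) nUP rR(5) pw(2,4)] lt by blast
        ultimately have "N \<in> \<V>" using N(1) ltp_trans[OF sN sR sX NR rR(3)] by (simp add: \<V>_def)
        then show False using Rmin NR by blast
      next
        case 2
        have lt: "ltp w U R" "lts w R U" using cws_at[OF w order_refl ww] by blast+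
        define N where "N = splice R w U"
        have N: "rte N" "pass N w" "preeq w N R" "sufeq w N U"
          unfolding N_def using splice_rte[OF rR(1) U(1) pw(3,1)] splice_pass[OF pw(3,1)]
            splice_preeq[OF sR sU] splice_sufeq[OF sR sU] by auto
        note sN = rte_strand[OF N(1)]
        have RN: "lts v R N"
          using lts_down[OF sR sN pw(3) N(2) lts_cong2[OF sufeq_sym[OF N(4)] lt(2)]
              preeq_agree[OF preeq_sym[OF N(3)]]] 2 by simp
        have pre: "preeq v N R" using preeq_mono[OF N(3)] 2 by simp
        have "pass N v" using preeq_pass[OF preeq_sym[OF N(3)] sR pw(3) rR(2)] 2 by blast
        moreover have "ltp v N X" using ltp_cong1[OF preeq_sym[OF pre] rR(3)] .
        moreover have "\<not> cw N P" unfolding N_def using spl[OF rR(1) U(1) rR(5) nUP pw(3,1)] lt by blast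
        ultimately have "N \<in> \<V>" using N(1) lts_trans[OF sX sR sN rR(4) RN] by (simp add: \<V>_def)
        then show False using Rmax pre RN by blast
      next
        case 3
        have lt: "ltp v U R" "lts v R U" using cws_at[OF w 3] by blast+
        have "pass U v" using pass_of_lt[OF sR sU _ _ rR(2,2) sR] lt by blast
        then have "U \<in> \<V>"
          using U nUP ltp_trans[OF sU sR sX lt(1) rR(3)] lts_trans[OF sX sR sU rR(4) lt(2)] by (simp add: \<V>_def)
        then show False using Rmin lt by blast
      qed
    qed
    then have "R \<in> least_avoiding P" using rR by (simp add: least_avoiding_def)
    moreover have "cw R X" using cwI[OF sR sX] rR pX by blast
    ultimately show False using coh by blast
  qed
  then show "X \<in> least_avoiding P" using X nXP by (simp add: least_avoiding_def)
qed

lemma below_least_avoiding: "mc C \<Longrightarrow> (\<And>V. V \<in> C \<Longrightarrow> \<not> cw V P) \<Longrightarrow> below (least_avoiding P) C"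
  using mc_rte by (auto simp: below_def least_avoiding_def)

lemma not_cw_empty: "\<not> cw R {}"
  by (auto simp: cw_def cws_def)

lemma mc_bottom: "mc (least_avoiding {})"
  by (rule mc_least_avoiding) (auto simp: strand_def not_cw_empty)

lemma bottom_below: "mc C \<Longrightarrow> below (least_avoiding {}) C"
  by (rule below_least_avoiding) (simp_all add: not_cw_empty)

section \<open>Paths and their extension to routes\<close>

lemma path_empty: "path {} u u"
  by (simp add: path_def strand_def)

lemma path_single: "e \<in> E \<Longrightarrow> path {e} (lo e) (hi e)"
  using lo_less_hi[of e] by (auto simp: path_def strand_def)

lemma path_append:
  assumes A: "path A u v" and B: "path B v w"
  shows "path (A \<union> B) u w"
proof -
  have AB: "hi x \<le> v" if "x \<in> A" for x using A that by (simp add: path_def)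
  have BA: "v \<le> lo x" if "x \<in> B" for x using B that by (simp add: path_def)
  have sAB: "strand (A \<union> B)"
    unfolding strand_def
  proof (intro conjI ballI)
    show "A \<union> B \<subseteq> E" using A B by (simp add: path_def strand_def)
    fix x y assume "x \<in> A \<union> B" "y \<in> A \<union> B"
    then consider "x \<in> A" "y \<in> A" | "x \<in> B" "y \<in> B" | "x \<in> A" "y \<in> B" | "x \<in> B" "y \<in> A" by blast
    then show "x = y \<or> hi x \<le> lo y \<or> hi y \<le> lo x"
    proof cases
      case 1
      then show ?thesis using A strandD[of A x y] unfolding path_def by blast
    next
      case 2
      then show ?thesis using B strandD[of B x y] unfolding path_def by blast
    next
      case 3
      then show ?thesis using AB BA by force
    next
      case 4
      then show ?thesis using AB BA by force
    qed
  qed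
  have A': "u \<le> v" "\<And>x. x \<in> A \<Longrightarrow> u \<le> lo x" "\<And>x. x \<in> A \<Longrightarrow> hi x = v \<or> (\<exists>y\<in>A. lo y = hi x)"
      "\<And>x. x \<in> A \<Longrightarrow> lo x = u \<or> (\<exists>y\<in>A. hi y = lo x)" "u = v \<or> (\<exists>y\<in>A. hi y = v)" "u = v \<or> (\<exists>y\<in>A. lo y = u)"
    using A unfolding path_def by blast+
  have B': "v \<le> w" "\<And>x. x \<in> B \<Longrightarrow> hi x \<le> w" "\<And>x. x \<in> B \<Longrightarrow> hi x = w \<or> (\<exists>y\<in>B. lo y = hi x)"
      "\<And>x. x \<in> B \<Longrightarrow> lo x = v \<or> (\<exists>y\<in>B. hi y = lo x)" "v = w \<or> (\<exists>y\<in>B. hi y = w)" "v = w \<or> (\<exists>y\<in>B. lo y = v)"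
    using B unfolding path_def by blast+
  have 1: "hi x = w \<or> (\<exists>y\<in>A \<union> B. lo y = hi x)" "lo x = u \<or> (\<exists>y\<in>A \<union> B. hi y = lo x)"
    if "x \<in> A \<union> B" for x
  proof -
    show "hi x = w \<or> (\<exists>y\<in>A \<union> B. lo y = hi x)"
      using A'(3)[of x] B'(3)[of x] B'(6) that by (cases "x \<in> A"; cases "hi x = v") auto
    show "lo x = u \<or> (\<exists>y\<in>A \<union> B. hi y = lo x)"
      using A'(4)[of x] B'(4)[of x] A'(5) that by (cases "x \<in> B"; cases "lo x = v") auto
  qed
  have 2: "u \<le> lo x" "hi x \<le> w" if "x \<in> A \<union> B" for x
  proof -
    show "u \<le> lo x" using A'(1,2) BA that by force
    show "hi x \<le> w" using B'(1,2) AB that by force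
  qed
  have 3: "\<exists>x\<in>A \<union> B. lo x = u" "\<exists>x\<in>A \<union> B. hi x = w" if "u \<noteq> w"
  proof -
    show "\<exists>x\<in>A \<union> B. lo x = u" using A'(6) B'(6) that by (cases "u = v") auto
    show "\<exists>x\<in>A \<union> B. hi x = w" using A'(5) B'(5) that by (cases "v = w") auto
  qed
  have "u \<le> w" using A'(1) B'(1) by simp
  with sAB show ?thesis unfolding path_def by (intro conjI ballI impI 1 2 3)
qed

lemma path_tail:
  assumes M: "path M u v" and x: "x \<in> M" "lo x = u"
  shows "path (M - {x}) (hi x) v"
proof -
  have sM: "strand M" using M by (simp add: path_def)
  have b: "u \<le> lo y" "hi y \<le> v" "lo y < hi y" if "y \<in> M" for y
    using M that strand_lt[OF sM] by (auto simp: path_def)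
  have after: "hi x \<le> lo y" if "y \<in> M - {x}" for y
    using strandD[OF sM x(1), of y] b[of y] that x(2) by auto
  have 1: "hi y = v \<or> (\<exists>z\<in>M - {x}. lo z = hi y)" if y: "y \<in> M - {x}" for y
  proof -
    have "z \<noteq> x" if "lo z = hi y" for z using that x(2) b[of y] y by auto
    moreover have "hi y = v \<or> (\<exists>z\<in>M. lo z = hi y)" using M y by (simp add: path_def)
    ultimately show ?thesis by blast
  qed
  have 2: "lo y = hi x \<or> (\<exists>z\<in>M - {x}. hi z = lo y)" if y: "y \<in> M - {x}" for y
  proof -
    have "lo y \<noteq> u" using after[OF y] b[OF x(1)] x(2) by simp
    then obtain z where "z \<in> M" "hi z = lo y" using M y by (auto simp: path_def)
    then show ?thesis by (cases "z = x") auto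
  qed
  have 3: "\<exists>z\<in>M - {x}. lo z = hi x" "\<exists>z\<in>M - {x}. hi z = v" if n: "hi x \<noteq> v"
  proof -
    have "\<exists>z\<in>M. lo z = hi x" using M x(1) n by (auto simp: path_def)
    then show "\<exists>z\<in>M - {x}. lo z = hi x" using b[OF x(1)] by force
    have "u \<noteq> v" using b[OF x(1)] x(2) by simp
    then have "\<exists>z\<in>M. hi z = v" using M by (simp add: path_def)
    then show "\<exists>z\<in>M - {x}. hi z = v" using n by blast
  qed
  have "strand (M - {x})" by (rule strand_sub[OF sM]) blast
  then show ?thesis
    unfolding path_def by (intro conjI ballI impI after 1 2 3 b(2)[OF x(1)]) (auto dest: b(2))
qed

lemma path_rte: "path R s t \<Longrightarrow> rte R"
  unfolding path_def rte_def by blast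

lemma rte_path:
  assumes R: "rte R"
  shows "path R s t"
proof (cases "R = {}")
  case True
  then show ?thesis using R path_empty[of s] by (auto simp: rte_def)
next
  case False
  note sR = rte_strand[OF R]
  have fin: "finite R" using strand_finite[OF sR] .
  obtain x where x: "x \<in> R" "lo x = Min (lo ` R)" using Min_in[of "lo ` R"] fin False by fastforce
  have xm: "lo x \<le> lo y" if "y \<in> R" for y using x fin that by simp
  have "lo x = s"
  proof (rule ccontr)
    assume "lo x \<noteq> s"
    then obtain y where "y \<in> R" "hi y = lo x" using R x(1) unfolding rte_def by blast
    then show False using xm[of y] strand_lt[OF sR, of y] by simp
  qed
  obtain z where z: "z \<in> R" "hi z = Max (hi ` R)" using Max_in[of "hi ` R"] fin False by fastforce
  have zm: "hi y \<le> hi z" if "y \<in> R" for y using z fin that by simp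
  have "hi z = t"
  proof (rule ccontr)
    assume "hi z \<noteq> t"
    then obtain y where "y \<in> R" "lo y = hi z" using R z(1) unfolding rte_def by blast
    then show False using zm[of y] strand_lt[OF sR, of y] by simp
  qed
  have "s \<le> t" using s_le_lo[of x] hi_le_t[of x] lo_less_hi[of x] strand_E[OF sR x(1)] by simp
  moreover have "s \<le> lo y" "hi y \<le> t" if "y \<in> R" for y
    using s_le_lo hi_le_t strand_E[OF sR that] by simp_all
  moreover have "hi y = t \<or> (\<exists>z\<in>R. lo z = hi y)" "lo y = s \<or> (\<exists>z\<in>R. hi z = lo y)" if "y \<in> R" for y
    using R that by (simp_all add: rte_def)
  ultimately show ?thesis
    using sR x(1) z(1) \<open>lo x = s\<close> \<open>hi z = t\<close> unfolding path_def by (intro conjI ballI impI) blast+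
qed

lemma path_seg:
  assumes R: "rte R" "b \<in> R" "c \<in> R" "lo b < hi c"
  shows "path (seg R (lo b) (hi c)) (lo b) (hi c)"
proof -
  note sR = rte_strand[OF R(1)]
  have lt: "lo x < hi x" if "x \<in> R" for x using strand_lt[OF sR that] .
  have 1: "hi b \<le> hi c" using hi_split[OF sR R(2,3)] R(4) by linarith
  have 2: "lo b \<le> lo c" using lo_split[OF sR R(2,3)] lo_split[OF sR R(3,2)] R(4) lt[OF R(2)] lt[OF R(3)] by linarith
  have bc: "b \<in> seg R (lo b) (hi c)" "c \<in> seg R (lo b) (hi c)"
    using R(2,3) 1 2 by (simp_all add: seg_def)
  have i: "hi x = hi c \<or> (\<exists>y\<in>seg R (lo b) (hi c). lo y = hi x)" if x: "x \<in> seg R (lo b) (hi c)" for x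
  proof (cases "hi x = hi c")
    case False
    have xR: "x \<in> R" "lo b \<le> lo x" "hi x < hi c" using x False by (auto simp: seg_def)
    have "hi c \<le> t" using hi_le_t[OF strand_E[OF sR R(3)]] .
    then have "hi x \<noteq> t" using xR(3) by simp
    then obtain y where y: "y \<in> R" "lo y = hi x" using R(1) xR(1) unfolding rte_def by blast
    have "hi y \<le> hi c" using hi_split[OF sR y(1) R(3)] y xR by linarith
    then have "y \<in> seg R (lo b) (hi c)" using y xR lt[OF xR(1)] by (simp add: seg_def)
    then show ?thesis using y(2) by blast
  qed simp
  have j: "lo x = lo b \<or> (\<exists>y\<in>seg R (lo b) (hi c). hi y = lo x)" if x: "x \<in> seg R (lo b) (hi c)" for x
  proof (cases "lo x = lo b")
    case False
    have xR: "x \<in> R" "lo b < lo x" "hi x \<le> hi c" using x False by (auto simp: seg_def)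
    have "s \<le> lo b" using s_le_lo[OF strand_E[OF sR R(2)]] .
    then have "lo x \<noteq> s" using xR(2) by simp
    then obtain y where y: "y \<in> R" "hi y = lo x" using R(1) xR(1) unfolding rte_def by blast
    have "lo b \<le> lo y" using lo_split[OF sR y(1) R(2)] y xR by linarith
    then have "y \<in> seg R (lo b) (hi c)" using y xR lt[OF xR(1)] by (simp add: seg_def)
    then show ?thesis using y(2) by blast
  qed simp
  have k: "lo b \<le> lo x" "hi x \<le> hi c" if "x \<in> seg R (lo b) (hi c)" for x
    using that by (simp_all add: seg_def)
  show ?thesis
    unfolding path_def
    by (intro conjI ballI impI strand_seg[OF sR] order_less_imp_le[OF R(4)] i j k bexI[OF _ bc(1)] bexI[OF _ bc(2)] refl)
qed

text \<open>Follow a minimal entering edge backwards from \<open>v\<close>; its tail is closer to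
  \<open>s\<close>.\<close>

lemma min_path_from_source:
  assumes "v = s \<or> (\<exists>e\<in>E. hi e = v)"
  shows "\<exists>A. path A s v \<and> (\<forall>x\<in>A. \<forall>e. \<not> il e x)"
  using assms
proof (induction "nat (v - s)" arbitrary: v rule: less_induct)
  case less
  show ?case
  proof (cases "v = s")
    case True
    then show ?thesis using path_empty[of s] by blast
  next
    case False
    define I where "I = {e\<in>E. hi e = v}"
    have "\<exists>e\<in>I. \<forall>e'\<in>I. \<not> il e' e"
    proof (rule finite_maximal_rel[where r = "\<lambda>x y. il y x"])
      show "finite I" using finite_E by (simp add: I_def)
      show "I \<noteq> {}" using less(2) False by (auto simp: I_def)
      show "\<not> il x x" for x by (rule il_irrefl)
      show "il z x" if "il y x" "il z y" for x y z using that by (blast intro: il_trans)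
    qed
    then obtain e where e: "e \<in> E" "hi e = v" "\<forall>e'\<in>I. \<not> il e' e" unfolding I_def by blast
    have min: "\<not> il e' e" for e' using e il_E[of e' e] unfolding I_def by blast
    have "nat (lo e - s) < nat (v - s)" using lo_less_hi[OF e(1)] s_le_lo[OF e(1)] e(2) by simp
    then obtain A where A: "path A s (lo e)" "\<forall>x\<in>A. \<forall>e. \<not> il e x"
      using less(1)[of "lo e"] pred_ex[OF e(1)] by blast
    have "path (A \<union> {e}) s v" using path_append[OF A(1) path_single[OF e(1)]] e(2) by simp
    then show ?thesis using A(2) min by blast
  qed
qed

lemma rv_path: "rv.path M u v \<longleftrightarrow> path M (- v) (- u)"
proof -
  have 1: "u \<le> - h \<longleftrightarrow> h \<le> - u" "- h \<le> v \<longleftrightarrow> - v \<le> h" "- h = v \<longleftrightarrow> h = - v" "- h = u \<longleftrightarrow> h = - u"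
    for h :: int by auto
  have 2: "- h = - k \<longleftrightarrow> h = k" for h k :: int by auto
  have 3: "- v \<le> - u \<longleftrightarrow> u \<le> v" "- v = - u \<longleftrightarrow> u = v" by auto
  show ?thesis
    unfolding rv.path_def path_def rv_strand 3 2 1 by blast
qed

lemma max_path_to_sink:
  assumes "v = t \<or> (\<exists>e\<in>E. lo e = v)"
  shows "\<exists>A. path A v t \<and> (\<forall>x\<in>A. \<forall>e. \<not> ol x e)"
  using framed_edges.min_path_from_source[OF framed_edges_rev, of "- v", unfolded rv_path minus_minus] assms by auto

lemma edge_in_route:
  assumes "e \<in> E"
  obtains R where "rte R" "e \<in> R"
proof -
  obtain A where A: "path A s (lo e)"
    using min_path_from_source[of "lo e"] pred_ex[OF assms] by blast
  obtain B where B: "path B (hi e) t"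
    using max_path_to_sink[of "hi e"] succ_ex[OF assms] by blast
  have "rte (A \<union> {e} \<union> B)"
    using path_rte path_append[OF path_append[OF A path_single[OF assms]] B] by blast
  then show thesis using that by blast
qed

lemma mc_containing:
  assumes "rte R"
  obtains C where "mc C" "R \<in> C"
proof -
  define \<C> where "\<C> = {C. R \<in> C \<and> (\<forall>P\<in>C. rte P) \<and> (\<forall>P\<in>C. \<forall>Q\<in>C. \<not> cw P Q)}"
  have "\<C> \<subseteq> Pow (Pow E)" using rte_strand unfolding \<C>_def strand_def by blast
  then have "finite \<C>" using finite_E by (meson finite_Pow_iff finite_subset)
  moreover have "{R} \<in> \<C>" using assms cw_irrefl[OF rte_strand[OF assms]] by (simp add: \<C>_def)
  ultimately obtain C where C: "C \<in> \<C>" "\<And>D. D \<in> \<C> \<Longrightarrow> C \<subseteq> D \<Longrightarrow> C = D"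
    by (metis finite_has_maximal empty_iff)
  have "mc C"
    unfolding mc_def
  proof (intro conjI ballI allI impI)
    fix V assume V: "rte V" "\<forall>Q\<in>C. \<not> cw V Q \<and> \<not> cw Q V"
    then have "insert V C \<in> \<C>" using C(1) cw_irrefl[OF rte_strand[OF V(1)]] by (simp add: \<C>_def)
    then show "V \<in> C" using C(2)[of "insert V C"] by blast
  qed (use C(1) in \<open>auto simp: \<C>_def\<close>)
  then show thesis using that C(1) by (simp add: \<C>_def)
qed

text \<open>\<open>b\<close> and \<open>c\<close> are the first and the last edge, and
  \<open>hi b \<le> lo c\<close> encodes that there are at least two edges.\<close>

definition ccw_path :: "'e set \<Rightarrow> bool" where
  "ccw_path P \<longleftrightarrow> (\<exists>b c. path P (lo b) (hi c) \<and> b \<in> P \<and> c \<in> P \<and> hi b \<le> lo c \<and>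
     (\<exists>a. il a b) \<and> (\<exists>d. ol c d))"

text \<open>
  A ccw-extended path from \<open>b\<close> to \<open>c\<close> extended by minimal edges before and maximal edges after it.
  This is the route that the unique downward flip of the corresponding join-irreducible removes.
\<close>

definition ccw_route :: "'e set \<Rightarrow> 'e \<Rightarrow> 'e \<Rightarrow> bool" where
  "ccw_route R b c \<longleftrightarrow> rte R \<and> b \<in> R \<and> c \<in> R \<and> hi b \<le> lo c \<and> (\<exists>a. il a b) \<and> (\<exists>d. ol c d) \<and>
     (\<forall>x\<in>R. hi x \<le> lo b \<longrightarrow> (\<forall>e. \<not> il e x)) \<and> (\<forall>x\<in>R. hi c \<le> lo x \<longrightarrow> (\<forall>e. \<not> ol x e))"

lemma ccw_path_route:
  assumes "ccw_path P"
  obtains R b c where "ccw_route R b c" "P = seg R (lo b) (hi c)"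
proof -
  obtain b c where pP: "path P (lo b) (hi c)" and bcP: "b \<in> P" "c \<in> P" and bc: "hi b \<le> lo c"
    and ad: "\<exists>a. il a b" "\<exists>d. ol c d" using assms by (auto simp: ccw_path_def)
  have sP: "strand P" using pP by (simp add: path_def)
  have E: "b \<in> E" "c \<in> E" using bcP strand_E[OF sP] by blast+
  have lt: "lo b < hi b" "lo c < hi c" using lo_less_hi E by blast+
  obtain A where A: "path A s (lo b)" "\<forall>x\<in>A. \<forall>e. \<not> il e x"
    using min_path_from_source[of "lo b"] pred_ex[OF E(1)] by blast
  obtain B where B: "path B (hi c) t" "\<forall>x\<in>B. \<forall>e. \<not> ol x e"
    using max_path_to_sink[of "hi c"] succ_ex[OF E(2)] by blast
  define R where "R = A \<union> P \<union> B"
  have R: "rte R" unfolding R_def by (rule path_rte[OF path_append[OF path_append[OF A(1) pP] B(1)]])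
  have Ab: "lo x < lo b" "hi x \<le> lo b" if "x \<in> A" for x
    using A(1) that strand_lt[of A x] by (auto simp: path_def)
  have Bb: "hi c < hi x" "hi c \<le> lo x" if "x \<in> B" for x
    using B(1) that strand_lt[of B x] by (auto simp: path_def)
  have P: "lo b \<le> lo x" "hi x \<le> hi c" "lo x < hi x" if "x \<in> P" for x
    using pP that strand_lt[OF sP] by (auto simp: path_def)
  have RE: "x \<in> A \<or> x \<in> P \<or> x \<in> B" if "x \<in> R" for x using that by (simp add: R_def)
  have RA: "x \<in> A" if x: "x \<in> R" "hi x \<le> lo b" for x
  proof -
    have "x \<notin> P" using P[of x] x(2) by linarith
    moreover have "x \<notin> B" using Bb[of x] x(2) lt bc by linarith
    ultimately show ?thesis using RE[OF x(1)] by blast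
  qed
  have RB: "x \<in> B" if x: "x \<in> R" "hi c \<le> lo x" for x
  proof -
    have "x \<notin> P" using P[of x] x(2) by linarith
    moreover have "x \<notin> A" using Ab[of x] x(2) lt bc by linarith
    ultimately show ?thesis using RE[OF x(1)] by blast
  qed
  have bcR: "b \<in> R" "c \<in> R" using bcP by (simp_all add: R_def)
  have "\<forall>x\<in>R. hi x \<le> lo b \<longrightarrow> (\<forall>e. \<not> il e x)" using RA A(2) by blast
  moreover have "\<forall>x\<in>R. hi c \<le> lo x \<longrightarrow> (\<forall>e. \<not> ol x e)" using RB B(2) by blast
  ultimately have 1: "ccw_route R b c"
    unfolding ccw_route_def using R bcR bc ad by (intro conjI)
  have 2: "P = seg R (lo b) (hi c)"
  proof (intro Set.set_eqI iffI)
    fix x assume "x \<in> seg R (lo b) (hi c)"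
    then have x: "x \<in> R" "lo b \<le> lo x" "hi x \<le> hi c" by (simp_all add: seg_def)
    have "x \<notin> A" using Ab[of x] x(2) by linarith
    moreover have "x \<notin> B" using Bb[of x] x(3) by linarith
    ultimately show "x \<in> P" using RE[OF x(1)] by blast
  next
    fix x assume "x \<in> P"
    then show "x \<in> seg R (lo b) (hi c)" using P[of x] by (simp add: seg_def R_def)
  qed
  show thesis by (rule that[OF 1 2])
qed

text \<open>A crossing from below needs an edge of \<open>R\<close> with a smaller competitor where
  it starts and one with a larger competitor where it ends. The edges before \<open>b\<close> and
  after \<open>c\<close> have none, so the crossing falls within the segment.\<close>

lemma cw_ccw_route:
  assumes R: "ccw_route R b c" and V: "cw V R"
  shows "cw V (seg R (lo b) (hi c))"
proof -
  have r: "rte R" "b \<in> R" "c \<in> R" "hi b \<le> lo c" using R by (auto simp: ccw_route_def)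
  note sR = rte_strand[OF r(1)]
  obtain w w' where w: "cws w w' V R" using V by (auto simp: cw_def)
  obtain \<beta> \<gamma> \<tau> \<sigma> where *: "\<gamma> \<in> R" "\<tau> \<in> R" "hi \<gamma> = w" "lo \<tau> = w'" "il \<beta> \<gamma>" "ol \<tau> \<sigma>" "w \<le> w'"
    using w by (rule cwsE)
  have "\<not> hi \<gamma> \<le> lo b" "\<not> hi c \<le> lo \<tau>" using R * by (auto simp: ccw_route_def)
  then have "hi b \<le> w" "w' \<le> lo c"
    using hi_split[OF sR r(2) *(1)] strandD[OF sR r(2) *(1)] lo_split[OF sR *(2) r(3)] strandD[OF sR r(3) *(2)]
      strand_lt[OF sR *(1)] strand_lt[OF sR *(2)] *(3,4) by auto
  then show ?thesis using cws_segI[OF sR w r(2,3)] by (auto simp: cw_def)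
qed

lemma ccw_route_in: "ccw_route R b c \<Longrightarrow> R \<in> least_avoiding (seg R (lo b) (hi c))"
  using cw_ccw_route cw_segD rte_strand cw_irrefl unfolding least_avoiding_def ccw_route_def by blast

text \<open>\<open>R\<close> is a member, and whatever is cw-below its segment is cw-below
  \<open>R\<close>; so \<open>R\<close> is the witness required by
  \<open>mc_least_avoiding\<close>.\<close>

lemma mc_ccw_route: "ccw_route R b c \<Longrightarrow> mc (least_avoiding (seg R (lo b) (hi c)))"
  using mc_least_avoiding[OF strand_seg] ccw_route_in cw_segD rte_strand unfolding ccw_route_def by metis

lemma below_ccw_iff:
  assumes "ccw_route R b c" "mc C"
  shows "below (least_avoiding (seg R (lo b) (hi c))) C \<longleftrightarrow> (\<forall>V\<in>C. \<not> cw V (seg R (lo b) (hi c)))"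
proof
  assume "below (least_avoiding (seg R (lo b) (hi c))) C"
  then have "\<forall>V\<in>C. \<not> cw V R" using ccw_route_in[OF assms(1)] by (auto simp: below_def)
  then show "\<forall>V\<in>C. \<not> cw V (seg R (lo b) (hi c))"
    using cw_segD rte_strand assms(1) unfolding ccw_route_def by blast
qed (use below_least_avoiding[OF assms(2)] in blast)

text \<open>The route through \<open>a\<close>, the interior of the path and \<open>d\<close>, for \<open>a\<close> below \<open>b\<close> and \<open>d\<close> above \<open>c\<close>.\<close>

lemma ccw_route_crossed:
  assumes "ccw_route R b c"
  obtains V where "rte V" "cws (hi b) (lo c) V R" "cw V (seg R (lo b) (hi c))"
proof -
  have R: "rte R" "b \<in> R" "c \<in> R" "hi b \<le> lo c" using assms by (auto simp: ccw_route_def)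
  note sR = rte_strand[OF R(1)]
  obtain a d where ad: "il a b" "ol c d" using assms by (auto simp: ccw_route_def)
  have E: "a \<in> E" "d \<in> E" "b \<in> E" "c \<in> E" "hi a = hi b" "lo d = lo c" using il_E[OF ad(1)] ol_E[OF ad(2)] by auto
  obtain Ra where Ra: "rte Ra" "a \<in> Ra" using edge_in_route[OF E(1)] by blast
  obtain Rd where Rd: "rte Rd" "d \<in> Rd" using edge_in_route[OF E(2)] by blast
  note sRa = rte_strand[OF Ra(1)] and sRd = rte_strand[OF Rd(1)]
  have bt: "hi b < t" "s < lo c"
    using R(4) lo_less_hi[OF E(4)] hi_le_t[OF E(4)] lo_less_hi[OF E(3)] s_le_lo[OF E(3)] by simp_all
  have pR: "pass R (hi b)" "pass R (lo c)"
    using in_pass[OF R(1,2)] out_pass[OF R(1,3)] bt by blast+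
  have pa: "pass Ra (hi b)" using in_pass[OF Ra] E bt by simp
  have pd: "pass Rd (lo c)" using out_pass[OF Rd] E bt by simp
  define T where "T = splice R (lo c) Rd"
  have T: "rte T" "preeq (lo c) T R" "pass T (lo c)"
    unfolding T_def using splice_rte[OF R(1) Rd(1) pR(2) pd] splice_preeq[OF sR sRd] splice_pass[OF pR(2) pd]
    by auto
  note sT = rte_strand[OF T(1)]
  have pT: "pass T (hi b)"
    using preeq_pass[OF preeq_sym[OF T(2)] sR pR(2,1)] T(3) R(4) by (metis order_le_less)
  define V where "V = splice Ra (hi b) T"
  have V: "rte V" "sufeq (hi b) V T"
    unfolding V_def using splice_rte[OF Ra(1) T(1) pa pT] splice_sufeq[OF sRa sT] by auto
  have "a \<in> V" unfolding V_def using splice_memI1[OF Ra(2)] E by simp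
  moreover have "d \<in> T" unfolding T_def using splice_memI2[OF Rd(2)] E by simp
  then have "d \<in> V" unfolding V_def using splice_memI2[of d T] R(4) E by simp
  moreover have "agree V R (hi b) (lo c)"
    using agree_trans[OF sufeq_agree[OF V(2)] preeq_agree[OF T(2)]] .
  ultimately have c: "cws (hi b) (lo c) V R"
    using cwsI[OF _ R(2) E(5) ad(1) R(3) _ refl ad(2) R(4)] by blast
  then have "cw V (seg R (lo b) (hi c))" using cws_segI[OF sR c R(2,3)] by (auto simp: cw_def)
  then show thesis using that V(1) c by blast
qed

lemma ccw_not_least:
  assumes "ccw_route R b c"
  shows "\<exists>C. mc C \<and> \<not> below (least_avoiding (seg R (lo b) (hi c))) C"
proof -
  obtain V where V: "rte V" "cw V (seg R (lo b) (hi c))" using ccw_route_crossed[OF assms] by blast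
  obtain C where C: "mc C" "V \<in> C" using mc_containing[OF V(1)] by blast
  then show ?thesis using below_ccw_iff[OF assms C(1)] V(2) by blast
qed

text \<open>\<open>D\<close> is not above the clique, so it contains a route cw-below the path. This
  can only be the route that the flip trades, and since it is cw-below \<open>R\<close>, it is
  traded for \<open>R\<close>.\<close>

lemma ccw_flip_down:
  assumes R: "ccw_route R b c" and f: "flip D (least_avoiding (seg R (lo b) (hi c)))"
  obtains R1 where "D = insert R1 (least_avoiding (seg R (lo b) (hi c)) - {R})"
    "R1 \<notin> least_avoiding (seg R (lo b) (hi c)) - {R}" "cw R1 R"
proof -
  define C where "C = least_avoiding (seg R (lo b) (hi c))"
  have fD: "flip D C" using f by (simp add: C_def)
  obtain D0 R1 R' where *: "mc D" "mc C" "R1 \<notin> D0" "R' \<notin> D0" "D = insert R1 D0" "C = insert R' D0" "cw R1 R'"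
    using fD by (rule flipE)
  have sR: "strand R" using R rte_strand by (auto simp: ccw_route_def)
  have "D \<noteq> C" using fD flip_irrefl by blast
  then have "\<not> below C D" using below_antisym[OF *(1,2) flip_below[OF fD]] by blast
  then obtain V where V: "V \<in> D" "cw V (seg R (lo b) (hi c))" using below_ccw_iff[OF R *(1)] by (auto simp: C_def)
  have "V \<notin> C" using V(2) by (auto simp: C_def least_avoiding_def)
  then have "V = R1" using V(1) unfolding *(5,6) by blast
  then have c1: "cw R1 R" using cw_segD[OF sR V(2)] by blast
  have "R \<in> C" using ccw_route_in[OF R] by (simp add: C_def)
  moreover have "R \<notin> D0" using c1 mc_cw[OF *(1), of R1 R] unfolding *(5) by blast
  ultimately have "R = R'" unfolding *(6) by blast
  then have "D0 = C - {R}" using *(4,6) by blast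
  then show thesis using that[of R1] *(3,5) c1 by (simp add: C_def)
qed

lemma ccw_flip_unique:
  assumes R: "ccw_route R b c" and f: "flip D1 (least_avoiding (seg R (lo b) (hi c)))"
    "flip D2 (least_avoiding (seg R (lo b) (hi c)))"
  shows "D1 = D2"
proof -
  define C where "C = least_avoiding (seg R (lo b) (hi c))"
  obtain R1 where R1: "D1 = insert R1 (C - {R})" "R1 \<notin> C - {R}" "cw R1 R"
    using ccw_flip_down[OF R f(1)] unfolding C_def by blast
  obtain R2 where R2: "D2 = insert R2 (C - {R})" "R2 \<notin> C - {R}" "cw R2 R"
    using ccw_flip_down[OF R f(2)] unfolding C_def by blast
  have "insert R (C - {R}) = C" using ccw_route_in[OF R] by (auto simp: C_def)
  then have "R1 = R2"
    using ridge_unique[of R1 "C - {R}" R2 R] flip_mc[OF f(1)] flip_mc[OF f(2)] R1 R2 by (simp add: C_def)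
  then show ?thesis using R1 R2 by simp
qed

lemma not_bottom_flip:
  assumes "mc C" "mc A" "\<not> below C A"
  obtains D where "flip D C"
proof -
  have "least_avoiding {} \<noteq> C" using bottom_below[OF assms(2)] assms(3) by blast
  then show thesis using descent[OF assms(1) mc_bottom bottom_below[OF assms(1)]] that by blast
qed

text \<open>Tested on the route of \<open>ccw_route_crossed\<close>, which coincides with
  \<open>R\<close> between \<open>b\<close> and \<open>c\<close>. The edges of \<open>R\<close> at
  which it crosses the other segment are not on it, and they cannot lie before \<open>b\<close> or
  after \<open>c\<close> by extremality of \<open>R\<close>; so they are \<open>b\<close> and
  \<open>c\<close>.\<close>

lemma ccw_inj_aux:
  assumes R: "ccw_route R b c" "ccw_route R b' c'"
    and imp: "\<And>V. rte V \<Longrightarrow> cw V (seg R (lo b) (hi c)) \<Longrightarrow> cw V (seg R (lo b') (hi c'))"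
  shows "lo b' \<le> lo b" "hi c \<le> hi c'"
proof -
  have r: "rte R" "b \<in> R" "c \<in> R" "hi b \<le> lo c" "b' \<in> R" "c' \<in> R" using R by (auto simp: ccw_route_def)
  note sR = rte_strand[OF r(1)]
  have lt: "lo x < hi x" if "x \<in> R" for x using strand_lt[OF sR that] .
  obtain V where V: "rte V" "cws (hi b) (lo c) V R" "cw V (seg R (lo b) (hi c))"
    using ccw_route_crossed[OF R(1)] by blast
  note sV = rte_strand[OF V(1)]
  have ag: "agree V R (hi b) (lo c)" using V(2) by (simp add: cws_def)
  obtain w w' where w: "cws w w' V (seg R (lo b') (hi c'))" using imp[OF V(1,3)] by (auto simp: cw_def)
  obtain x y z u where *: "x \<in> V" "y \<in> seg R (lo b') (hi c')" "z \<in> seg R (lo b') (hi c')" "u \<in> V"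
    "hi x = w" "hi y = w" "lo z = w'" "lo u = w'" "il x y" "ol z u" "w \<le> w'"
    using w by (rule cwsE)
  have yz: "y \<in> R" "lo b' \<le> lo y" "z \<in> R" "hi z \<le> hi c'" using * by (auto simp: seg_def)
  have y1: "y \<notin> V" using strand_hi_inj[OF sV *(1), of y] * il_irrefl by auto
  have z1: "z \<notin> V" using strand_lo_inj[OF sV _ *(4), of z] * ol_irrefl by auto
  have y2: "\<not> hi y \<le> lo b" and z2: "\<not> hi c \<le> lo z" using R(1) yz(1,3) *(9,10) by (auto simp: ccw_route_def)
  show "lo b' \<le> lo b"
  proof (rule ccontr)
    assume "\<not> lo b' \<le> lo b"
    then have "hi b \<le> lo y" using strandD[OF sR r(2) yz(1)] y2 yz(2) lt[OF r(2)] by auto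
    moreover have "hi y \<le> lo c"
      using strandD[OF sR yz(3) r(3)] z2 *(6,7,11) lt[OF yz(3)] lt[OF r(3)] by auto
    ultimately show False using ag yz(1) y1 by (auto simp: agree_def)
  qed
  show "hi c \<le> hi c'"
  proof (rule ccontr)
    assume "\<not> hi c \<le> hi c'"
    then have "hi z \<le> lo c" using strandD[OF sR r(3) yz(3)] z2 yz(4) lt[OF r(3)] by auto
    moreover have "hi b \<le> lo z"
      using strandD[OF sR yz(1) r(2)] y2 *(6,7,11) lt[OF yz(1)] lt[OF r(2)] by auto
    ultimately show False using ag yz(3) z1 by (auto simp: agree_def)
  qed
qed

text \<open>The clique determines \<open>R\<close> as the only route missing from its lower
  neighbour. Hence both paths are segments of the same route, and the routes cw-below them determine
  the ends.\<close>

lemma least_avoiding_inj: "inj_on least_avoiding {P. ccw_path P}"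
proof (rule inj_onI, unfold mem_Collect_eq)
  fix P P' assume P: "ccw_path P" "ccw_path P'" and eq: "least_avoiding P = least_avoiding P'"
  obtain R b c where R: "ccw_route R b c" "P = seg R (lo b) (hi c)" using ccw_path_route[OF P(1)] .
  obtain R' b' c' where R': "ccw_route R' b' c'" "P' = seg R' (lo b') (hi c')" using ccw_path_route[OF P(2)] .
  have mC: "mc (least_avoiding P)" using mc_ccw_route[OF R(1)] R(2) by simp
  obtain D where D: "flip D (least_avoiding P)"
    using not_bottom_flip[OF mC] ccw_not_least[OF R(1)] R(2) by blast
  obtain R1 where "D = insert R1 (least_avoiding P - {R})" "R1 \<notin> least_avoiding P - {R}" "cw R1 R"
    using ccw_flip_down[OF R(1)] D unfolding R(2) by blast
  then have 1: "R \<notin> D" "least_avoiding P - D \<subseteq> {R}"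
    using mc_cw[OF flip_mc(1)[OF D], of R1 R] by blast+
  obtain R2 where "D = insert R2 (least_avoiding P - {R'})" "R2 \<notin> least_avoiding P - {R'}" "cw R2 R'"
    using ccw_flip_down[OF R'(1)] D unfolding eq R'(2) by blast
  then have 2: "R' \<notin> D" using mc_cw[OF flip_mc(1)[OF D], of R2 R'] by blast
  have "R' \<in> least_avoiding P" using ccw_route_in[OF R'(1)] eq R'(2) by simp
  then have RR: "R' = R" using 1 2 by blast
  have "R \<in> least_avoiding P'" "R \<in> least_avoiding P" using ccw_route_in[OF R(1)] eq R(2) by auto
  moreover have "strand R" using R(1) rte_strand by (auto simp: ccw_route_def)
  ultimately have i: "rte V \<Longrightarrow> cw V P \<longleftrightarrow> cw V P'" for V
    using cw_segD[of R V] R(2) R'(2) RR by (auto simp: least_avoiding_def)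
  have P': "P' = seg R (lo b') (hi c')" using R'(2) RR by simp
  have "lo b' \<le> lo b" "hi c \<le> hi c'"
    using ccw_inj_aux[OF R(1) R'(1)[unfolded RR]] i unfolding R(2) P' by blast+
  moreover have "lo b \<le> lo b'" "hi c' \<le> hi c"
    using ccw_inj_aux[OF R'(1)[unfolded RR] R(1)] i unfolding R(2) P' by blast+
  ultimately show "P = P'" using R(2) P' by simp
qed

section \<open>Ccw-extended paths and join-irreducibles\<close>

definition join_irred :: "'e set set \<Rightarrow> bool" where
  "join_irred x \<longleftrightarrow> mc x \<and> \<not> (\<forall>y. mc y \<longrightarrow> below x y) \<and>
     (\<forall>a b. mc a \<longrightarrow> mc b \<longrightarrow> below a x \<longrightarrow> below b x \<longrightarrow>
        (\<forall>u. mc u \<longrightarrow> below a u \<longrightarrow> below b u \<longrightarrow> below x u) \<longrightarrow> x = a \<or> x = b)"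

text \<open>Elements \<open>a\<close> and \<open>b\<close> strictly below the clique are both below
  its unique lower neighbour, so the clique is not their join.\<close>

lemma join_irred_least_avoiding:
  assumes "ccw_path P"
  shows "join_irred (least_avoiding P)"
proof -
  obtain R b c where R: "ccw_route R b c" "P = seg R (lo b) (hi c)" using ccw_path_route[OF assms] .
  have mC: "mc (least_avoiding P)" using mc_ccw_route[OF R(1)] R(2) by simp
  have "least_avoiding P = a \<or> least_avoiding P = b"
    if ab: "mc a" "mc b" "below a (least_avoiding P)" "below b (least_avoiding P)"
      and lub: "\<forall>u. mc u \<longrightarrow> below a u \<longrightarrow> below b u \<longrightarrow> below (least_avoiding P) u" for a b
  proof (rule ccontr)
    assume n: "\<not> ?thesis"
    obtain D1 where D1: "flip D1 (least_avoiding P)" "below a D1" using descent[OF mC ab(1,3)] n by metis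
    obtain D2 where D2: "flip D2 (least_avoiding P)" "below b D2" using descent[OF mC ab(2,4)] n by metis
    have "D1 = D2" using ccw_flip_unique[OF R(1)] D1(1) D2(1) R(2) by blast
    then have "below (least_avoiding P) D1" using lub D1 D2 flip_mc by blast
    then have "D1 = least_avoiding P" using below_antisym flip_mc[OF D1(1)] flip_below[OF D1(1)] by blast
    then show False using D1(1) flip_irrefl by blast
  qed
  then show ?thesis using mC ccw_not_least[OF R(1)] R(2) unfolding join_irred_def by blast
qed

lemma join_irred_ex:
  assumes "join_irred x"
  shows "\<exists>P. ccw_path P \<and> x = least_avoiding P"
proof -
  have mx: "mc x" using assms by (simp add: join_irred_def)
  obtain A where "mc A" "\<not> below x A" using assms by (auto simp: join_irred_def)
  then obtain D where D: "flip D x" using not_bottom_flip[OF mx] by blast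
  obtain D0 R1 R' where *: "mc D" "R1 \<notin> D0" "R' \<notin> D0" "D = insert R1 D0" "x = insert R' D0" "cw R1 R'"
    using D by (rule flipE)
  have R'x: "R' \<in> x" by (subst *(5)) simp
  have R1D: "R1 \<in> D" by (subst *(4)) simp
  have rR': "rte R'" using mc_rte[OF mx R'x] .
  note sR' = rte_strand[OF rR']
  obtain w w' where w: "cws w w' R1 R'" using *(6) by (auto simp: cw_def)
  obtain a b c d where abcd: "b \<in> R'" "c \<in> R'" "hi b = w" "lo c = w'" "il a b" "ol c d" "w \<le> w'"
    using w by (rule cwsE)
  \<comment> \<open>The crossing of \<open>R1\<close> with the removed route \<open>R'\<close>,
    together with the edges of \<open>R'\<close> that enter and leave it.\<close>
  define P where "P = seg R' (lo b) (hi c)"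
  have bc: "hi b \<le> lo c" using abcd(3,4,7) by simp
  then have lt: "lo b < hi c" using strand_lt[OF sR' abcd(1)] strand_lt[OF sR' abcd(2)] by linarith
  have bcP: "b \<in> P" "c \<in> P"
    using abcd(1,2) bc strand_lt[OF sR' abcd(1)] strand_lt[OF sR' abcd(2)] by (simp_all add: P_def seg_def)
  have "path P (lo b) (hi c)" unfolding P_def using path_seg[OF rR' abcd(1,2) lt] .
  then have P: "ccw_path P" unfolding ccw_path_def using bcP bc abcd(5,6) by blast
  obtain R b' c' where R: "ccw_route R b' c'" "P = seg R (lo b') (hi c')" using ccw_path_route[OF P] .
  have "cw R1 P" unfolding P_def cw_def using cws_segI[OF sR' w abcd(1,2)] abcd(3,4) by blast
  \<comment> \<open>This separates \<open>D\<close> from every flip that stays above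
    \<open>least_avoiding P\<close>.\<close>
  then have nD: "\<not> below (least_avoiding P) D" using below_ccw_iff[OF R(1) *(1)] R1D unfolding R(2)[symmetric] by blast
  have "\<not> cw V P" if "V \<in> x" for V
    using cw_segD[OF sR', of V "lo b" "hi c"] mc_cw[OF mx that R'x] unfolding P_def by blast
  then have below: "below (least_avoiding P) x" using below_least_avoiding[OF mx] by blast
  have "least_avoiding P = x"
  proof (rule ccontr)
    assume n: "least_avoiding P \<noteq> x"
    have mP: "mc (least_avoiding P)" using mc_ccw_route[OF R(1)] R(2) by simp
    obtain D2 where D2: "flip D2 x" "below (least_avoiding P) D2" using descent[OF mx mP below n] .
    obtain D0' R2 R'' where **: "mc D2" "R2 \<notin> D0'" "R'' \<notin> D0'" "D2 = insert R2 D0'" "x = insert R'' D0'" "cw R2 R''"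
      using D2(1) by (rule flipE)
    \<comment> \<open>Flips of \<open>x\<close> that remove the same route have the same lower end
      by \<open>ridge_unique\<close>, but \<open>D2\<close> is above \<open>least_avoiding P\<close>
      and \<open>D\<close> is not.\<close>
    have "R' \<noteq> R''"
    proof
      assume e: "R' = R''"
      have "D0 = x - {R'}" using *(3) by (subst *(5)) simp
      moreover have "D0' = x - {R''}" using **(3) by (subst **(5)) simp
      ultimately have e0: "D0' = D0" using e by simp
      have "R1 = R2"
      proof (rule ridge_unique[of R1 D0 R2 R'])
        show "mc (insert R1 D0)" using *(1,4) by simp
        show "mc (insert R2 D0)" using **(1,4) e0 by simp
        show "mc (insert R' D0)" using mx *(5) by simp
        show "R1 \<notin> D0" "R2 \<notin> D0" "R' \<notin> D0" "cw R1 R'" "cw R2 R'" using * ** e e0 by simp_all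
      qed
      then have "D2 = D" using *(4) **(4) e0 by simp
      then show False using D2(2) nD by simp
    qed
    have sub: "x \<subseteq> D \<union> D2"
    proof
      fix V assume V: "V \<in> x"
      have "V = R' \<or> V \<in> D" using V unfolding *(4,5) by blast
      moreover have "V = R'' \<or> V \<in> D2" using V unfolding **(4,5) by blast
      ultimately show "V \<in> D \<union> D2" using \<open>R' \<noteq> R''\<close> by blast
    qed
    have "\<forall>u. mc u \<longrightarrow> below D u \<longrightarrow> below D2 u \<longrightarrow> below x u"
      using sub by (auto simp: below_def)
    then have "x = D \<or> x = D2"
      using assms flip_below[OF D] flip_below[OF D2(1)] *(1) **(1) unfolding join_irred_def by blast
    then show False using D D2(1) flip_irrefl by blast
  qed
  then show ?thesis using P by blast
qed

lemma bij_least_avoiding: "bij_betw least_avoiding {P. ccw_path P} {x. join_irred x}"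
  unfolding bij_betw_def using least_avoiding_inj join_irred_least_avoiding join_irred_ex by auto

end

section \<open>From edge lists to edge sets\<close>

context framed_graph
begin

text \<open>An order embedding of the vertices into the integers, where edge reversal becomes
  negation.\<close>

definition rank :: "'v \<Rightarrow> int" where
  "rank v = int (card {u \<in> verts G. u < v})"

lemma rank_less:
  assumes "v \<in> verts G" "v < w"
  shows "rank v < rank w"
proof -
  have "{u \<in> verts G. u < v} \<subset> {u \<in> verts G. u < w}" using assms by auto
  then show ?thesis unfolding rank_def using finite_verts by (simp add: psubset_card_mono)
qed

lemma rank_inj: "v \<in> verts G \<Longrightarrow> w \<in> verts G \<Longrightarrow> rank v = rank w \<longleftrightarrow> v = w"
  using rank_less[of v w] rank_less[of w v] by (cases v w rule: linorder_cases) auto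

lemma rank_le: "v \<in> verts G \<Longrightarrow> w \<in> verts G \<Longrightarrow> rank v \<le> rank w \<longleftrightarrow> v \<le> w"
  using rank_less[of v w] rank_less[of w v] by (cases v w rule: linorder_cases) auto

abbreviation lo :: "'e \<Rightarrow> int" where "lo e \<equiv> rank (tail G e)"

abbreviation hi :: "'e \<Rightarrow> int" where "hi e \<equiv> rank (head G e)"

text \<open>\<open>e \<in> arcs G\<close> makes \<open>head G e\<close> a vertex; elsewhere the
  framing is arbitrary.\<close>

definition il :: "'e \<Rightarrow> 'e \<Rightarrow> bool" where
  "il e f \<longleftrightarrow> e \<in> arcs G \<and> e \<noteq> f \<and> (e, f) \<in> in_order F (head G e)"

definition ol :: "'e \<Rightarrow> 'e \<Rightarrow> bool" where
  "ol e f \<longleftrightarrow> e \<in> arcs G \<and> e \<noteq> f \<and> (e, f) \<in> out_order F (tail G e)"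

lemma in_orderD:
  assumes "(e, f) \<in> in_order F v" "v \<in> verts G"
  shows "e \<in> arcs G" "f \<in> arcs G" "head G e = v" "head G f = v"
proof -
  have "in_order F v \<subseteq> in_arcs G v \<times> in_arcs G v"
    using linear_in_order[OF assms(2)] by (simp add: linear_order_on_def partial_order_on_def preorder_on_def)
  then have "e \<in> in_arcs G v" "f \<in> in_arcs G v" using assms(1) by blast+
  then show "e \<in> arcs G" "f \<in> arcs G" "head G e = v" "head G f = v" by simp_all
qed

lemma out_orderD:
  assumes "(e, f) \<in> out_order F v" "v \<in> verts G"
  shows "e \<in> arcs G" "f \<in> arcs G" "tail G e = v" "tail G f = v"
proof -
  have "out_order F v \<subseteq> out_arcs G v \<times> out_arcs G v"
    using linear_out_order[OF assms(2)] by (simp add: linear_order_on_def partial_order_on_def preorder_on_def)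
  then have "e \<in> out_arcs G v" "f \<in> out_arcs G v" using assms(1) by blast+
  then show "e \<in> arcs G" "f \<in> arcs G" "tail G e = v" "tail G f = v" by simp_all
qed

lemma source_props: "source G \<in> verts G" "in_arcs G (source G) = {}"
  using theI'[OF unique_source] unfolding source_def by simp_all

lemma sink_props: "sink G \<in> verts G" "out_arcs G (sink G) = {}"
  using theI'[OF unique_sink] unfolding sink_def by simp_all

lemma in_arcs_ex:
  assumes "v \<in> verts G" "v \<noteq> source G"
  shows "\<exists>e\<in>arcs G. head G e = v"
proof -
  have "in_arcs G v \<noteq> {}"
  proof
    assume "in_arcs G v = {}"
    then have "source G = v" unfolding source_def using assms(1) by (intro the1_equality[OF unique_source] conjI)
    then show False using assms(2) by simp
  qed
  then obtain e where "e \<in> in_arcs G v" by blast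
  then have "e \<in> arcs G" "head G e = v" by simp_all
  then show ?thesis by blast
qed

lemma out_arcs_ex:
  assumes "v \<in> verts G" "v \<noteq> sink G"
  shows "\<exists>e\<in>arcs G. tail G e = v"
proof -
  have "out_arcs G v \<noteq> {}"
  proof
    assume "out_arcs G v = {}"
    then have "sink G = v" unfolding sink_def using assms(1) by (intro the1_equality[OF unique_sink] conjI)
    then show False using assms(2) by simp
  qed
  then obtain e where "e \<in> out_arcs G v" by blast
  then have "e \<in> arcs G" "tail G e = v" by simp_all
  then show ?thesis by blast
qed

text \<open>Edges increase, so the least vertex has no entering edge and is the source.\<close>

lemma source_le: "v \<in> verts G \<Longrightarrow> source G \<le> v"
proof -
  assume v: "v \<in> verts G"
  define m where "m = Min (verts G)"
  have m: "m \<in> verts G" unfolding m_def using v by (intro Min_in[OF finite_verts]) auto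
  have le: "m \<le> u" if "u \<in> verts G" for u using that finite_verts by (simp add: m_def)
  have "m = source G"
  proof (rule ccontr)
    assume "m \<noteq> source G"
    then obtain e where e: "e \<in> arcs G" "head G e = m" using in_arcs_ex[OF m] by blast
    then show False using tail_less_head[OF e(1)] le[OF tail_in_verts[OF e(1)]] by simp
  qed
  then show ?thesis using le[OF v] by simp
qed

lemma le_sink: "v \<in> verts G \<Longrightarrow> v \<le> sink G"
proof -
  assume v: "v \<in> verts G"
  define m where "m = Max (verts G)"
  have m: "m \<in> verts G" unfolding m_def using v by (intro Max_in[OF finite_verts]) auto
  have le: "u \<le> m" if "u \<in> verts G" for u using that finite_verts by (simp add: m_def)
  have "m = sink G"
  proof (rule ccontr)
    assume "m \<noteq> sink G"
    then obtain e where e: "e \<in> arcs G" "tail G e = m" using out_arcs_ex[OF m] by blast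
    then show False using tail_less_head[OF e(1)] le[OF head_in_verts[OF e(1)]] by simp
  qed
  then show ?thesis using le[OF v] by simp
qed

lemma framed_edges: "framed_edges (arcs G) lo hi (rank (source G)) (rank (sink G)) il ol"
proof
  show "finite (arcs G)" by (rule finite_arcs)
  fix e assume e: "e \<in> arcs G"
  note v = tail_in_verts[OF e] head_in_verts[OF e]
  show "lo e < hi e" using rank_less[OF v(1) tail_less_head[OF e]] .
  show "rank (source G) \<le> lo e" using rank_le source_props v source_le by blast
  show "hi e \<le> rank (sink G)" using rank_le sink_props v le_sink by blast
  show "\<exists>f\<in>arcs G. hi f = lo e" if "lo e \<noteq> rank (source G)"
    using in_arcs_ex[OF v(1)] that by metis
  show "\<exists>f\<in>arcs G. lo f = hi e" if "hi e \<noteq> rank (sink G)"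
    using out_arcs_ex[OF v(2)] that by metis
next
  fix a b assume ab: "il a b"
  then have "head G a \<in> verts G" by (simp add: il_def)
  then show "a \<in> arcs G \<and> b \<in> arcs G \<and> hi a = hi b" using ab in_orderD[of a b "head G a"] by (simp add: il_def)
next
  fix a b c assume ab: "il a b" "il b c"
  then have v: "head G a \<in> verts G" by (simp add: il_def)
  then have h: "head G b = head G a" using ab(1) in_orderD(4)[of a b "head G a"] by (simp add: il_def)
  have "trans (in_order F (head G a))" "antisym (in_order F (head G a))"
    using linear_in_order[OF v] by (auto simp: linear_order_on_def partial_order_on_def preorder_on_def)
  then show "il a c" using ab h unfolding il_def by (metis antisymD transD)
next
  fix a b assume ab: "a \<in> arcs G" "b \<in> arcs G" "hi a = hi b" "a \<noteq> b"
  then have h: "head G a = head G b" using rank_inj head_in_verts by blast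
  have "total_on (in_arcs G (head G a)) (in_order F (head G a))"
    using linear_in_order[OF head_in_verts[OF ab(1)]] by (simp add: linear_order_on_def)
  then show "il a b \<or> il b a" using ab h by (auto simp: il_def total_on_def in_arcs_def)
next
  fix a b assume ab: "ol a b"
  then have "tail G a \<in> verts G" by (simp add: ol_def)
  then show "a \<in> arcs G \<and> b \<in> arcs G \<and> lo a = lo b" using ab out_orderD[of a b "tail G a"] by (simp add: ol_def)
next
  fix a b c assume ab: "ol a b" "ol b c"
  then have v: "tail G a \<in> verts G" by (simp add: ol_def)
  then have h: "tail G b = tail G a" using ab(1) out_orderD(4)[of a b "tail G a"] by (simp add: ol_def)
  have "trans (out_order F (tail G a))" "antisym (out_order F (tail G a))"
    using linear_out_order[OF v] by (auto simp: linear_order_on_def partial_order_on_def preorder_on_def)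
  then show "ol a c" using ab h unfolding ol_def by (metis antisymD transD)
next
  fix a b assume ab: "a \<in> arcs G" "b \<in> arcs G" "lo a = lo b" "a \<noteq> b"
  then have h: "tail G a = tail G b" using rank_inj tail_in_verts by blast
  have "total_on (out_arcs G (tail G a)) (out_order F (tail G a))"
    using linear_out_order[OF tail_in_verts[OF ab(1)]] by (simp add: linear_order_on_def)
  then show "ol a b \<or> ol b a" using ab h by (auto simp: ol_def total_on_def out_arcs_def)
qed (simp_all add: il_def ol_def)

interpretation fe: framed_edges "arcs G" lo hi "rank (source G)" "rank (sink G)" il ol
  by (rule framed_edges)

lemma awalk_path: "awalk u p v \<Longrightarrow> fe.path (set p) (rank u) (rank v)"
proof (induction p arbitrary: u)
  case Nil
  then show ?case using fe.path_empty by (simp add: awalk_Nil_iff)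
next
  case (Cons e p)
  then have e: "e \<in> arcs G" "u = tail G e" "awalk (head G e) p v" by (auto simp: awalk_Cons_iff)
  show ?case using fe.path_append[OF fe.path_single[OF e(1)] Cons.IH[OF e(3)]] e(2) by simp
qed

lemma path_awalk:
  assumes "fe.path M (rank u) (rank v)" "u \<in> verts G" "v \<in> verts G"
  shows "\<exists>p. awalk u p v \<and> set p = M"
  using assms
proof (induction "card M" arbitrary: M u)
  case 0
  have "finite M" using fe.strand_finite 0(2) by (simp add: fe.path_def)
  then have "M = {}" using 0 by simp
  moreover have "rank u = rank v" using 0(2) unfolding \<open>M = {}\<close> fe.path_def by simp
  ultimately show ?case using rank_inj[OF 0(3,4)] 0(3) by (intro exI[of _ "[]"]) (simp add: awalk_Nil_iff)
next
  case (Suc n)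
  have M: "fe.strand M" using Suc(3) by (simp add: fe.path_def)
  have "M \<noteq> {}" using Suc(2) by auto
  then obtain y where y: "y \<in> M" by blast
  have "rank u \<noteq> rank v"
    using Suc(3) y fe.strand_lt[OF M y] by (fastforce simp: fe.path_def)
  then obtain x where x: "x \<in> M" "lo x = rank u" using Suc(3) by (auto simp: fe.path_def)
  have xE: "x \<in> arcs G" using fe.strand_E[OF M x(1)] .
  have u: "tail G x = u" using x(2) rank_inj tail_in_verts[OF xE] Suc(4) by blast
  have "n = card (M - {x})" using Suc(2) x(1) by simp
  moreover have "fe.path (M - {x}) (rank (head G x)) (rank v)" using fe.path_tail[OF Suc(3) x] .
  ultimately obtain p where "awalk (head G x) p v" "set p = M - {x}"
    using Suc(1)[of "M - {x}" "head G x"] head_in_verts[OF xE] Suc(5) by blast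
  then show ?case using x(1) xE u by (intro exI[of _ "x # p"]) (auto simp: awalk_Cons_iff)
qed

lemma awalk_sorted: "awalk u p v \<Longrightarrow> sorted_wrt (\<lambda>e f. hi e \<le> lo f) p"
proof (induction p arbitrary: u)
  case (Cons e p)
  then have e: "awalk (head G e) p v" by (auto simp: awalk_Cons_iff)
  show ?case using Cons.IH[OF e] awalk_path[OF e] by (simp add: fe.path_def)
qed simp

lemma awalk_arcs: "awalk u p v \<Longrightarrow> set p \<subseteq> arcs G"
  by (simp add: awalk_def)

text \<open>Tails increase strictly along such a list, so it enumerates its set in the order of
  tails. Hence passing from edge lists to edge sets loses nothing.\<close>

lemma sorted_unique:
  assumes "sorted_wrt (\<lambda>e f. hi e \<le> lo f) p" "sorted_wrt (\<lambda>e f. hi e \<le> lo f) q"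
    "set p = set q" "set p \<subseteq> arcs G"
  shows "p = q"
proof -
  have lt: "lo e < hi e" if "e \<in> set p" for e using fe.lo_less_hi assms(4) that by blast
  have st: "sorted_wrt (<) (map lo l)" if "sorted_wrt (\<lambda>e f. hi e \<le> lo f) l" "set l = set p" for l
    unfolding sorted_wrt_map using that(1)
    by (rule sorted_wrt_mono_rel[rotated]) (use lt that(2) in fastforce)
  have "map lo p = map lo q"
    by (rule strict_sorted_equal) (use st assms in auto)
  moreover have "inj_on lo (set p \<union> set q)"
  proof (rule inj_onI)
    fix x y assume xy: "x \<in> set p \<union> set q" "y \<in> set p \<union> set q" "lo x = lo y"
    have "e = f \<or> hi e \<le> lo f \<or> hi f \<le> lo e" if "e \<in> set p" "f \<in> set p" for e f
      using assms(1) that by (induction p) auto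
    then show "x = y" using xy lt[of x] lt[of y] assms(3) by force
  qed
  ultimately show ?thesis using map_inj_on by blast
qed

lemma awalk_unique: "awalk u p v \<Longrightarrow> awalk u' q v' \<Longrightarrow> set p = set q \<Longrightarrow> p = q"
  using sorted_unique awalk_sorted awalk_arcs by blast

lemma apath_iff: "apath u p v \<longleftrightarrow> awalk u p v"
proof
  show "awalk u p v \<Longrightarrow> apath u p v"
  proof (induction p arbitrary: u)
    case Nil
    then show ?case by (auto simp: apath_Nil_iff awalk_Nil_iff)
  next
    case (Cons e p)
    then have e: "e \<in> arcs G" "u = tail G e" "awalk (head G e) p v" by (auto simp: awalk_Cons_iff)
    have mono: "w \<le> x" if "awalk w q v" "x \<in> set (awalk_verts w q)" for w x q
      using that
    proof (induction q arbitrary: w)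
      case (Cons f q)
      then have f: "f \<in> arcs G" "w = tail G f" "awalk (head G f) q v" by (auto simp: awalk_Cons_iff)
      show ?case using Cons.IH[OF f(3)] Cons.prems(2) tail_less_head[OF f(1)] f(2) by fastforce
    qed simp
    have "tail G e \<notin> set (awalk_verts (head G e) p)"
      using mono[OF e(3)] tail_less_head[OF e(1)] by fastforce
    then show ?case using Cons.IH[OF e(3)] e by (simp add: apath_def awalk_Cons_iff)
  qed
qed (simp add: apath_def)

lemma route_iff: "route G P \<longleftrightarrow> awalk (source G) P (sink G)"
  by (simp add: route_def apath_iff)

lemma route_rte: "route G P \<Longrightarrow> fe.rte (set P)"
  using awalk_path fe.path_rte by (simp add: route_iff)

lemma rte_route:
  assumes "fe.rte R"
  obtains P where "route G P" "set P = R"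
  using path_awalk[OF fe.rte_path[OF assms] source_props(1) sink_props(1)] that route_iff by blast

lemma route_inj: "route G P \<Longrightarrow> route G Q \<Longrightarrow> set P = set Q \<longleftrightarrow> P = Q"
  using awalk_unique route_iff by blast

lemma route_arcs: "route G P \<Longrightarrow> set P \<subseteq> arcs G"
  by (simp add: route_iff awalk_arcs)

text \<open>Inner vertices are the tails of all edges but the first. Each of these edges has a
  predecessor on the route, whereas nothing enters the tail of the first edge.\<close>

lemma inner_iff:
  assumes P: "route G P" and v: "v \<in> verts G"
  shows "v \<in> set (inner_verts P) \<longleftrightarrow> fe.pass (set P) (rank v)"
proof (cases P)
  case Nil
  then show ?thesis by (simp add: fe.pass_def)
next
  case (Cons e p)
  have e: "e \<in> arcs G" "awalk (head G e) p (sink G)"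
    using P unfolding Cons route_iff by (auto simp: awalk_Cons_iff)
  have pth: "fe.path (set p) (hi e) (rank (sink G))" using awalk_path[OF e(2)] .
  have lt: "lo e < hi e" using fe.lo_less_hi[OF e(1)] .
  have rk: "lo x = rank v \<longleftrightarrow> tail G x = v" "hi x = rank v \<longleftrightarrow> head G x = v" if "x \<in> set P" for x
    using that rank_inj v route_arcs[OF P] tail_in_verts head_in_verts by blast+
  have in': "v \<in> set (inner_verts P) \<longleftrightarrow> (\<exists>x\<in>set p. tail G x = v)"
    by (auto simp: inner_verts_def Cons)
  show ?thesis
  proof
    assume "v \<in> set (inner_verts P)"
    then obtain x where x: "x \<in> set p" "tail G x = v" using in' by blast
    then have "lo x = hi e \<or> (\<exists>y\<in>set p. hi y = lo x)" using pth unfolding fe.path_def by blast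
    then have "\<exists>y\<in>set P. hi y = lo x" unfolding Cons by auto
    moreover have "x \<in> set P" using x(1) Cons by simp
    ultimately show "fe.pass (set P) (rank v)" using x(2) unfolding fe.pass_def by blast
  next
    assume "fe.pass (set P) (rank v)"
    then obtain x y where xy: "x \<in> set P" "hi x = rank v" "y \<in> set P" "lo y = rank v" by (rule fe.passE)
    have "lo e < hi x"
    proof (cases "x = e")
      case False
      then have "x \<in> set p" using xy(1) Cons by simp
      then have "hi e \<le> lo x" "x \<in> arcs G" using pth awalk_arcs[OF e(2)] by (auto simp: fe.path_def)
      then show ?thesis using lt fe.lo_less_hi[of x] by simp
    qed (use lt in simp)
    then have "y \<in> set p" using xy Cons by auto
    then show "v \<in> set (inner_verts P)" using in' rk(1)[OF xy(3)] xy(4) by blast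
  qed
qed

lemma sorted_split:
  assumes "sorted_wrt (\<lambda>e f. hi e \<le> lo f) (A @ a # S)" "set (A @ a # S) \<subseteq> arcs G"
  shows "set A = {x \<in> set (A @ a # S). hi x \<le> lo a}" "set S = {x \<in> set (A @ a # S). hi a \<le> lo x}"
proof -
  have 1: "hi x \<le> lo a" if "x \<in> set A" for x using assms(1) that by (simp add: sorted_wrt_append)
  have 2: "hi a \<le> lo x" if "x \<in> set S" for x using assms(1) that by (simp add: sorted_wrt_append)
  have 3: "lo x < hi x" if "x \<in> set A \<or> x = a \<or> x \<in> set S" for x
  proof (rule fe.lo_less_hi)
    show "x \<in> arcs G" using assms(2) that by auto
  qed
  show "set A = {x \<in> set (A @ a # S). hi x \<le> lo a}"
  proof (intro Set.set_eqI iffI)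
    fix x assume "x \<in> {x \<in> set (A @ a # S). hi x \<le> lo a}"
    then have x: "x \<in> set A \<or> x = a \<or> x \<in> set S" "hi x \<le> lo a" by auto
    have "x \<noteq> a" using x(2) 3[of a] by auto
    moreover have "x \<notin> set S" using x(2) 2[of x] 3[OF x(1)] 3[of a] by auto
    ultimately show "x \<in> set A" using x(1) by blast
  qed (use 1 in simp)
  show "set S = {x \<in> set (A @ a # S). hi a \<le> lo x}"
  proof (intro Set.set_eqI iffI)
    fix x assume "x \<in> {x \<in> set (A @ a # S). hi a \<le> lo x}"
    then have x: "x \<in> set A \<or> x = a \<or> x \<in> set S" "hi a \<le> lo x" by auto
    have "x \<noteq> a" using x(2) 3[of a] by auto
    moreover have "x \<notin> set A" using x(2) 1[of x] 3[OF x(1)] 3[of a] by auto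
    ultimately show "x \<in> set S" using x(1) by blast
  qed (use 2 in simp)
qed

lemma route_cut:
  assumes P: "route G P" and v: "v \<in> verts G" and p: "fe.pass (set P) (rank v)"
  shows "P = path_to G P v @ path_from G v P"
    and "set (path_to G P v) = {x \<in> set P. hi x \<le> rank v}"
    and "set (path_from G v P) = {x \<in> set P. rank v \<le> lo x}"
proof -
  show P': "P = path_to G P v @ path_from G v P" by (simp add: path_to_def path_from_def)
  obtain x where x: "x \<in> set P" "lo x = rank v" using p by (rule fe.passE)
  have PE: "set P \<subseteq> arcs G" using route_arcs[OF P] .
  have "tail G x = v" using x rank_inj[OF _ v] tail_in_verts PE by blast
  then have "path_from G v P \<noteq> []" using x(1) by (auto simp: path_from_def dropWhile_eq_Nil_conv)
  then obtain y B where yB: "path_from G v P = y # B" by (cases "path_from G v P") auto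
  have ty: "tail G y = v" using yB hd_dropWhile[of "\<lambda>e. tail G e \<noteq> v" P] by (simp add: path_from_def)
  have P2: "P = path_to G P v @ y # B" unfolding yB[symmetric] by (rule P')
  have s: "sorted_wrt (\<lambda>e f. hi e \<le> lo f) (path_to G P v @ y # B)" "set (path_to G P v @ y # B) \<subseteq> arcs G"
    unfolding P2[symmetric] using awalk_sorted[of "source G" P "sink G"] P PE by (simp_all add: route_iff)
  note sp = sorted_split[OF s, unfolded P2[symmetric]]
  show "set (path_to G P v) = {x \<in> set P. hi x \<le> rank v}" using sp(1) ty by simp
  have y: "y \<in> set P" by (subst P2) simp
  have str: "fe.strand (set P)" using fe.rte_strand[OF route_rte[OF P]] .
  show "set (path_from G v P) = {x \<in> set P. rank v \<le> lo x}"
  proof (intro Set.set_eqI iffI)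
    fix z assume "z \<in> set (path_from G v P)"
    then have "z = y \<or> z \<in> set B" using yB by simp
    moreover have "z \<in> set P \<and> hi y \<le> lo z" if "z \<in> set B" using that sp(2) by blast
    ultimately show "z \<in> {x \<in> set P. rank v \<le> lo x}" using y ty fe.strand_lt[OF str y] by auto
  next
    fix z assume z: "z \<in> {x \<in> set P. rank v \<le> lo x}"
    then have "z = y \<or> hi y \<le> lo z"
      using fe.strandD[OF str _ y, of z] fe.strand_lt[OF str y] fe.strand_lt[OF str, of z] ty by auto
    moreover have "z \<in> set B" if "hi y \<le> lo z" using that z sp(2) by blast
    ultimately show "z \<in> set (path_from G v P)" using yB by auto
  qed
qed

lemma
  assumes "route G P"
  shows route_parts_sorted: "sorted_wrt (\<lambda>e f. hi e \<le> lo f) (path_to G P v)"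
      "sorted_wrt (\<lambda>e f. hi e \<le> lo f) (path_from G v P)"
    and route_parts_arcs: "set (path_to G P v) \<subseteq> arcs G" "set (path_from G v P) \<subseteq> arcs G"
proof -
  have P: "path_to G P v @ path_from G v P = P" by (simp add: path_to_def path_from_def)
  have "sorted_wrt (\<lambda>e f. hi e \<le> lo f) (path_to G P v @ path_from G v P)"
    unfolding P using awalk_sorted assms route_iff by blast
  then show "sorted_wrt (\<lambda>e f. hi e \<le> lo f) (path_to G P v)"
      "sorted_wrt (\<lambda>e f. hi e \<le> lo f) (path_from G v P)"
    unfolding sorted_wrt_append by blast+
  have "set (path_to G P v @ path_from G v P) \<subseteq> arcs G" unfolding P by (rule route_arcs[OF assms])
  then show "set (path_to G P v) \<subseteq> arcs G" "set (path_from G v P) \<subseteq> arcs G" by simp_all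
qed

lemma in_less_iff:
  assumes P: "route G P" and Q: "route G Q" and v: "v \<in> verts G"
    and p: "fe.pass (set P) (rank v)" "fe.pass (set Q) (rank v)"
  shows "in_less G F v P Q \<longleftrightarrow> fe.ltp (rank v) (set P) (set Q)"
proof -
  have srt: "sorted_wrt (\<lambda>e f. hi e \<le> lo f) (path_to G R v)" if "route G R" for R
    by (rule route_parts_sorted[OF that])
  have E: "set (path_to G R v) \<subseteq> arcs G" if "route G R" for R
    by (rule route_parts_arcs[OF that])
  note cP = route_cut(2)[OF P v p(1)] and cQ = route_cut(2)[OF Q v p(2)]
  show ?thesis
  proof
    assume "in_less G F v P Q"
    then obtain A B S e f where *: "path_to G P v = A @ e # S" "path_to G Q v = B @ f # S"
      "e \<noteq> f" "(e, f) \<in> in_order F (head G e)" by (auto simp: in_less_def)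
    have e: "e \<in> set P" "hi e \<le> rank v" and f: "f \<in> set Q" "hi f \<le> rank v"
      using cP cQ unfolding *(1,2) by auto
    have il: "il e f" using * e(1) route_arcs[OF P] by (auto simp: il_def)
    then have h: "hi e = hi f" using fe.il_E by blast
    have SP: "set S = {x \<in> set (path_to G P v). hi e \<le> lo x}"
      using sorted_split(2)[of A e S] srt[OF P] E[OF P] *(1) by simp
    have SQ: "set S = {x \<in> set (path_to G Q v). hi f \<le> lo x}"
      using sorted_split(2)[of B f S] srt[OF Q] E[OF Q] *(2) by simp
    have "fe.agree (set P) (set Q) (hi e) (rank v)"
      unfolding fe.agree_def
    proof (intro allI impI)
      fix x assume x: "hi e \<le> lo x" "hi x \<le> rank v"
      have "x \<in> set S \<longleftrightarrow> x \<in> set P" unfolding SP cP using x by simp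
      moreover have "x \<in> set S \<longleftrightarrow> x \<in> set Q" unfolding SQ cQ using x h by simp
      ultimately show "x \<in> set P \<longleftrightarrow> x \<in> set Q" by blast
    qed
    then show "fe.ltp (rank v) (set P) (set Q)" using fe.ltpI[OF e(1) f(1) e(2) il] by blast
  next
    assume "fe.ltp (rank v) (set P) (set Q)"
    then obtain a b where ab: "a \<in> set P" "b \<in> set Q" "hi a = hi b" "hi a \<le> rank v" "il a b"
      "fe.agree (set P) (set Q) (hi a) (rank v)" by (rule fe.ltpE)
    obtain A S where A: "path_to G P v = A @ a # S" using cP ab split_list[of a "path_to G P v"] by auto
    obtain B S' where B: "path_to G Q v = B @ b # S'" using cQ ab split_list[of b "path_to G Q v"] by auto
    have SP: "set S = {x \<in> set (path_to G P v). hi a \<le> lo x}"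
      using sorted_split(2)[of A a S] srt[OF P] E[OF P] A by simp
    have SQ: "set S' = {x \<in> set (path_to G Q v). hi b \<le> lo x}"
      using sorted_split(2)[of B b S'] srt[OF Q] E[OF Q] B by simp
    have "S = S'"
    proof (rule sorted_unique)
      show "sorted_wrt (\<lambda>e f. hi e \<le> lo f) S" "sorted_wrt (\<lambda>e f. hi e \<le> lo f) S'"
        using srt[OF P] srt[OF Q] unfolding A B by (simp_all add: sorted_wrt_append)
      have "x \<in> set S \<longleftrightarrow> x \<in> set S'" for x
        using ab(3,6) unfolding SP SQ cP cQ fe.agree_def mem_Collect_eq by metis
      then show "set S = set S'" by blast
      show "set S \<subseteq> arcs G" using E[OF P] A by auto
    qed
    moreover have "a \<noteq> b" "(a, b) \<in> in_order F (head G a)" using ab(5) by (simp_all add: il_def)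
    ultimately show "in_less G F v P Q" unfolding in_less_def using A B by blast
  qed
qed

lemma out_less_iff:
  assumes P: "route G P" and Q: "route G Q" and v: "v \<in> verts G"
    and p: "fe.pass (set P) (rank v)" "fe.pass (set Q) (rank v)"
  shows "out_less G F v P Q \<longleftrightarrow> fe.lts (rank v) (set P) (set Q)"
proof -
  have srt: "sorted_wrt (\<lambda>e f. hi e \<le> lo f) (path_from G v R)" if "route G R" for R
    by (rule route_parts_sorted[OF that])
  have E: "set (path_from G v R) \<subseteq> arcs G" if "route G R" for R
    by (rule route_parts_arcs[OF that])
  note cP = route_cut(3)[OF P v p(1)] and cQ = route_cut(3)[OF Q v p(2)]
  show ?thesis
  proof
    assume "out_less G F v P Q"
    then obtain A B S e f where *: "path_from G v P = S @ e # A" "path_from G v Q = S @ f # B"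
      "e \<noteq> f" "(e, f) \<in> out_order F (tail G e)" by (auto simp: out_less_def)
    have e: "e \<in> set P" "rank v \<le> lo e" and f: "f \<in> set Q" "rank v \<le> lo f"
      using cP cQ unfolding *(1,2) by auto
    have ol: "ol e f" using * e(1) route_arcs[OF P] by (auto simp: ol_def)
    then have h: "lo e = lo f" using fe.ol_E by blast
    have SP: "set S = {x \<in> set (path_from G v P). hi x \<le> lo e}"
      using sorted_split(1)[of S e A] srt[OF P] E[OF P] *(1) by simp
    have SQ: "set S = {x \<in> set (path_from G v Q). hi x \<le> lo f}"
      using sorted_split(1)[of S f B] srt[OF Q] E[OF Q] *(2) by simp
    have "fe.agree (set P) (set Q) (rank v) (lo e)"
      unfolding fe.agree_def
    proof (intro allI impI)
      fix x assume x: "rank v \<le> lo x" "hi x \<le> lo e"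
      have "x \<in> set S \<longleftrightarrow> x \<in> set P" unfolding SP cP using x by simp
      moreover have "x \<in> set S \<longleftrightarrow> x \<in> set Q" unfolding SQ cQ using x h by simp
      ultimately show "x \<in> set P \<longleftrightarrow> x \<in> set Q" by blast
    qed
    then show "fe.lts (rank v) (set P) (set Q)" using fe.ltsI[OF e(1) f(1) e(2) ol] by blast
  next
    assume "fe.lts (rank v) (set P) (set Q)"
    then obtain a b where ab: "a \<in> set P" "b \<in> set Q" "lo a = lo b" "rank v \<le> lo a" "ol a b"
      "fe.agree (set P) (set Q) (rank v) (lo a)" by (rule fe.ltsE)
    obtain A S where A: "path_from G v P = S @ a # A" using cP ab split_list[of a "path_from G v P"] by auto
    obtain B S' where B: "path_from G v Q = S' @ b # B" using cQ ab split_list[of b "path_from G v Q"] by auto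
    have SP: "set S = {x \<in> set (path_from G v P). hi x \<le> lo a}"
      using sorted_split(1)[of S a A] srt[OF P] E[OF P] A by simp
    have SQ: "set S' = {x \<in> set (path_from G v Q). hi x \<le> lo b}"
      using sorted_split(1)[of S' b B] srt[OF Q] E[OF Q] B by simp
    have "S = S'"
    proof (rule sorted_unique)
      show "sorted_wrt (\<lambda>e f. hi e \<le> lo f) S" "sorted_wrt (\<lambda>e f. hi e \<le> lo f) S'"
        using srt[OF P] srt[OF Q] unfolding A B by (simp_all add: sorted_wrt_append)
      have "x \<in> set S \<longleftrightarrow> x \<in> set S'" for x
        using ab(3,6) unfolding SP SQ cP cQ fe.agree_def mem_Collect_eq by metis
      then show "set S = set S'" by blast
      show "set S \<subseteq> arcs G" using E[OF P] A by auto
    qed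
    moreover have "a \<noteq> b" "(a, b) \<in> out_order F (tail G a)" using ab(5) by (simp_all add: ol_def)
    ultimately show "out_less G F v P Q" unfolding out_less_def using A B by blast
  qed
qed

lemma cw_less_iff:
  assumes P: "route G P" and Q: "route G Q"
  shows "(\<exists>v. cw_less G F v P Q) \<longleftrightarrow> fe.cw (set P) (set Q)"
proof
  note rP = route_rte[OF P] and rQ = route_rte[OF Q]
  assume "\<exists>v. cw_less G F v P Q"
  then obtain v where v: "v \<in> set (inner_verts P)" "v \<in> set (inner_verts Q)" "in_less G F v P Q" "out_less G F v Q P"
    by (auto simp: cw_less_def common_inner_vertex_def)
  have "v \<in> set (map (tail G) P)"
    using v(1) by (cases P) (auto simp: inner_verts_def)
  then have vG: "v \<in> verts G" using route_arcs[OF P] tail_in_verts by auto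
  have p: "fe.pass (set P) (rank v)" "fe.pass (set Q) (rank v)"
    using inner_iff[OF P vG] inner_iff[OF Q vG] v by simp_all
  show "fe.cw (set P) (set Q)"
    using fe.cwI[OF fe.rte_strand[OF rP] fe.rte_strand[OF rQ]] p v(3,4)
      in_less_iff[OF P Q vG p] out_less_iff[OF Q P vG p(2,1)] by blast
next
  note rP = route_rte[OF P] and rQ = route_rte[OF Q]
  assume "fe.cw (set P) (set Q)"
  then obtain w w' where w: "fe.cws w w' (set P) (set Q)" by (auto simp: fe.cw_def)
  obtain a where a: "a \<in> set P" "hi a = w" using w by (rule fe.cwsE)
  \<comment> \<open>The common inner vertex is the first vertex of the crossing.\<close>
  define v where "v = head G a"
  have vG: "v \<in> verts G" using a(1) route_arcs[OF P] head_in_verts by (auto simp: v_def)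
  have wv: "w = rank v" using a(2) by (simp add: v_def)
  have p: "fe.pass (set P) (rank v)" "fe.pass (set Q) (rank v)"
    using fe.cws_pass(1)[OF w rP] fe.cws_pass(2)[OF w rQ] wv by simp_all
  have "fe.ltp (rank v) (set P) (set Q)" "fe.lts (rank v) (set Q) (set P)"
    using fe.cws_at[OF w, of w] w unfolding wv by (auto simp: fe.cws_def)
  then have "cw_less G F v P Q"
    using in_less_iff[OF P Q vG p] out_less_iff[OF Q P vG p(2,1)] inner_iff[OF P vG] inner_iff[OF Q vG] p
    by (simp add: cw_less_def common_inner_vertex_def)
  then show "\<exists>v. cw_less G F v P Q" by blast
qed

lemma coherent_iff:
  assumes P: "route G P" and Q: "route G Q"
  shows "coherent G F P Q \<longleftrightarrow> \<not> fe.cw (set P) (set Q) \<and> \<not> fe.cw (set Q) (set P)"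
proof -
  have "common_inner_vertex G P Q v" if "cw_less G F v P Q \<or> cw_less G F v Q P" for v
    using that by (auto simp: cw_less_def common_inner_vertex_def)
  then show ?thesis
    unfolding cw_less_iff[OF P Q, symmetric] cw_less_iff[OF Q P, symmetric] coherent_def incoherent_at_def
    by blast
qed

lemma clique_iff:
  "clique G F C \<longleftrightarrow> (\<forall>P\<in>C. route G P) \<and> (\<forall>P\<in>C. \<forall>Q\<in>C. \<not> fe.cw (set P) (set Q))"
proof -
  have "\<not> fe.cw (set P) (set P)" if "route G P" for P
    using fe.cw_irrefl[OF fe.rte_strand[OF route_rte[OF that]]] .
  then show ?thesis unfolding clique_def pairwise_def using coherent_iff by metis
qed

lemma maximal_clique_iff: "maximal_clique G F C \<longleftrightarrow> (\<forall>P\<in>C. route G P) \<and> fe.mc (set ` C)"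
proof
  assume m: "maximal_clique G F C"
  then have C: "\<And>P. P \<in> C \<Longrightarrow> route G P" "\<And>P Q. P \<in> C \<Longrightarrow> Q \<in> C \<Longrightarrow> \<not> fe.cw (set P) (set Q)"
    by (auto simp: maximal_clique_def clique_iff)
  have "R \<in> set ` C" if R: "fe.rte R" "\<forall>Q\<in>set ` C. \<not> fe.cw R Q \<and> \<not> fe.cw Q R" for R
  proof -
    obtain P where P: "route G P" "set P = R" using rte_route[OF R(1)] .
    have "clique G F (insert P C)"
      unfolding clique_iff using C P R(2) fe.cw_irrefl[OF fe.rte_strand[OF R(1)]] by auto
    then have "insert P C = C" using m unfolding maximal_clique_def by blast
    then show ?thesis using P(2) by blast
  qed
  then show "(\<forall>P\<in>C. route G P) \<and> fe.mc (set ` C)"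
    using C route_rte unfolding fe.mc_def by auto
next
  assume a: "(\<forall>P\<in>C. route G P) \<and> fe.mc (set ` C)"
  have "clique G F C" unfolding clique_iff using a fe.mc_cw by blast
  moreover have "D = C" if D: "clique G F D" "C \<subseteq> D" for D
  proof
    show "D \<subseteq> C"
    proof
      fix P assume P: "P \<in> D"
      have rP: "route G P" using D(1) P by (simp add: clique_iff)
      have "\<not> fe.cw (set P) Q \<and> \<not> fe.cw Q (set P)" if "Q \<in> set ` C" for Q
        using that D P unfolding clique_iff by blast
      then have "set P \<in> set ` C" using fe.mc_max[of "set ` C" "set P"] a route_rte[OF rP] by blast
      then obtain Q where "Q \<in> C" "set P = set Q" by blast
      then show "P \<in> C" using route_inj[OF rP] a by blast
    qed
  qed (rule D(2))
  ultimately show "maximal_clique G F C" unfolding maximal_clique_def by blast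
qed

lemma routes_inj: "inj_on set {P. route G P}"
  by (rule inj_onI) (simp add: route_inj)

lemma clique_routes: "maximal_clique G F C \<Longrightarrow> C \<subseteq> {P. route G P}"
  unfolding maximal_clique_iff by blast

lemma clique_image_inj:
  assumes "maximal_clique G F C" "maximal_clique G F D" "set ` C = set ` D"
  shows "C = D"
  using inj_on_image_eq_iff[OF routes_inj clique_routes[OF assms(1)] clique_routes[OF assms(2)]] assms(3) by simp

lemma clique_image_ex:
  assumes D: "fe.mc D"
  obtains C where "maximal_clique G F C" "set ` C = D"
proof -
  define C where "C = {P. route G P \<and> set P \<in> D}"
  have eq: "set ` C = D"
  proof
    show "D \<subseteq> set ` C"
    proof
      fix R assume R: "R \<in> D"
      obtain P where "route G P" "set P = R" using rte_route[OF fe.mc_rte[OF D R]] .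
      then show "R \<in> set ` C" using R by (auto simp: C_def)
    qed
  qed (auto simp: C_def)
  have "\<forall>P\<in>C. route G P" by (simp add: C_def)
  then have "maximal_clique G F C" unfolding maximal_clique_iff eq using D by blast
  then show thesis using that eq by blast
qed

lemma bij_cliques: "bij_betw ((`) set) {C. maximal_clique G F C} {D. fe.mc D}"
  unfolding bij_betw_def
proof
  show "inj_on ((`) set) {C. maximal_clique G F C}"
    by (rule inj_onI) (rule clique_image_inj, simp_all)
  show "(`) set ` {C. maximal_clique G F C} = {D. fe.mc D}"
  proof
    show "(`) set ` {C. maximal_clique G F C} \<subseteq> {D. fe.mc D}" by (auto simp: maximal_clique_iff)
    show "{D. fe.mc D} \<subseteq> (`) set ` {C. maximal_clique G F C}"
    proof
      fix D assume "D \<in> {D. fe.mc D}"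
      then obtain C where "maximal_clique G F C" "set ` C = D" using clique_image_ex[of D] by blast
      then show "D \<in> (`) set ` {C. maximal_clique G F C}" by blast
    qed
  qed
qed

lemma up_flip_iff:
  assumes C: "maximal_clique G F C" and C': "maximal_clique G F C'"
  shows "up_flip G F C C' \<longleftrightarrow> fe.flip (set ` C) (set ` C')"
proof -
  have mC: "fe.mc (set ` C)" "fe.mc (set ` C')" using C C' by (simp_all add: maximal_clique_iff)
  have r: "route G P" if "P \<in> C \<or> P \<in> C'" for P
    using that clique_routes[OF C] clique_routes[OF C'] by blast
  show ?thesis
  proof
    assume "up_flip G F C C'"
    then obtain R R' u where R: "R \<in> C" "C' = C - {R} \<union> {R'}" "cw_less G F u R R'"
      unfolding up_flip_def by blast
    have rR: "route G R" "route G R'" using r R(1,2) by blast+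
    have c: "fe.cw (set R) (set R')" using cw_less_iff[OF rR] R(3) by blast
    have 1: "set R \<notin> set ` (C - {R})"
    proof
      assume "set R \<in> set ` (C - {R})"
      then obtain Q where "Q \<in> C" "Q \<noteq> R" "set R = set Q" by blast
      then show False using route_inj[OF rR(1) r] by blast
    qed
    have 2: "set R' \<notin> set ` (C - {R})"
      using c fe.mc_cw[OF mC(1), of "set R" "set R'"] R(1) by blast
    have "C = insert R (C - {R})" using R(1) by blast
    then have 3: "set ` C = insert (set R) (set ` (C - {R}))" by (metis image_insert)
    have 4: "set ` C' = insert (set R') (set ` (C - {R}))" unfolding R(2) by simp
    show "fe.flip (set ` C) (set ` C')" unfolding fe.flip_def 
      by (intro conjI exI[of _ "set ` (C - {R})"] exI[of _ "set R"] exI[of _ "set R'"] mC 1 2 3 4 c)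
  next
    assume "fe.flip (set ` C) (set ` C')"
    then obtain D S S' where *: "S \<notin> D" "S' \<notin> D" "set ` C = insert S D" "set ` C' = insert S' D" "fe.cw S S'"
      by (rule fe.flipE)
    have "S \<in> set ` C" by (subst *(3)) simp
    then obtain R where R: "R \<in> C" "S = set R" by blast
    have "S' \<in> set ` C'" by (subst *(4)) simp
    then obtain R' where R': "R' \<in> C'" "S' = set R'" by blast
    have rR: "route G R" "route G R'" using r R(1) R'(1) by blast+
    obtain u where u: "cw_less G F u R R'" using *(5) cw_less_iff[OF rR] R(2) R'(2) by blast
    have "set ` (C - {R}) = set ` C - set ` {R}"
      by (rule inj_on_image_set_diff[OF routes_inj]) (use clique_routes[OF C] R(1) in blast)+
    then have "set ` (C - {R}) = D" using *(1) unfolding *(3) R(2) by simp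
    then have eq: "set ` C' = set ` (C - {R} \<union> {R'})" unfolding *(4) R'(2) by simp
    have "C - {R} \<union> {R'} \<subseteq> {P. route G P}" using clique_routes[OF C] rR by blast
    then have "C' = C - {R} \<union> {R'}"
      using iffD1[OF inj_on_image_eq_iff[OF routes_inj clique_routes[OF C']] eq] by simp
    then show "up_flip G F C C'" unfolding up_flip_def 
      by (intro conjI exI[of _ R] exI[of _ R'] exI[of _ u] C C' R(1) u)
  qed
qed

lemma up_flips_iff:
  assumes C: "maximal_clique G F C" and D: "maximal_clique G F D"
  shows "(up_flip G F)\<^sup>*\<^sup>* C D \<longleftrightarrow> fe.below (set ` C) (set ` D)"
proof -
  have mc: "fe.mc (set ` C)" "fe.mc (set ` D)" using C D by (simp_all add: maximal_clique_iff)
  have "fe.flip\<^sup>*\<^sup>* (set ` C) (set ` D)" if "(up_flip G F)\<^sup>*\<^sup>* C D" for D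
    using that
  proof (induction rule: rtranclp_induct)
    case (step D1 D2)
    have "maximal_clique G F D1" "maximal_clique G F D2" using step(2) by (simp_all add: up_flip_def)
    then have "fe.flip (set ` D1) (set ` D2)" using step(2) up_flip_iff by blast
    with step(3) show ?case by (rule rtranclp.rtrancl_into_rtrancl)
  qed simp
  \<comment> \<open>Intermediate cliques of edge sets have to be lifted to cliques of edge lists, so
    the induction quantifies over all lifts \<open>D\<close>.\<close>
  moreover have "\<forall>D. maximal_clique G F D \<longrightarrow> X = set ` D \<longrightarrow> (up_flip G F)\<^sup>*\<^sup>* C D"
    if "fe.flip\<^sup>*\<^sup>* (set ` C) X" for X
    using that
  proof (induction rule: rtranclp_induct)
    case base
    show ?case using clique_image_inj[OF C] by auto
  next
    case (step X1 X2)
    show ?case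
    proof (intro allI impI)
      fix D assume D: "maximal_clique G F D" "X2 = set ` D"
      obtain D1 where D1: "maximal_clique G F D1" "set ` D1 = X1"
        by (rule clique_image_ex[OF fe.flip_mc(1)[OF step(2)]])
      have "(up_flip G F)\<^sup>*\<^sup>* C D1" using step(3) D1(1) D1(2)[symmetric] by blast
      moreover have "up_flip G F D1 D" using up_flip_iff[OF D1(1) D(1)] step(2) D1(2) D(2) by simp
      ultimately show "(up_flip G F)\<^sup>*\<^sup>* C D" by (rule rtranclp.rtrancl_into_rtrancl)
    qed
  qed
  ultimately show ?thesis using fe.flips_iff_below[OF mc] D by blast
qed

lemma join_irreducible_iff:
  assumes C: "maximal_clique G F C"
  shows "join_irreducible (framing_lattice G F) C \<longleftrightarrow> fe.join_irred (set ` C)"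
proof -
  let ?le = "\<lambda>C D. fe.below (set ` C) (set ` D)"
  define M where "M = {C. maximal_clique G F C}"
  \<comment> \<open>Stated for arbitrary \<open>Q\<close>, so that unfolding it transfers all the
    nested quantifiers over maximal cliques.\<close>
  have all: "(\<forall>y. fe.mc y \<longrightarrow> Q y) \<longleftrightarrow> (\<forall>D\<in>M. Q (set ` D))" for Q
  proof
    assume a: "\<forall>y. fe.mc y \<longrightarrow> Q y"
    show "\<forall>D\<in>M. Q (set ` D)" using a by (simp add: M_def maximal_clique_iff)
  next
    assume a: "\<forall>D\<in>M. Q (set ` D)"
    show "\<forall>y. fe.mc y \<longrightarrow> Q y"
    proof (intro allI impI)
      fix y assume "fe.mc y"
      then obtain D where "maximal_clique G F D" "set ` D = y" by (rule clique_image_ex)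
      then show "Q y" using a by (auto simp: M_def)
    qed
  qed
  have le: "le (framing_lattice G F) A B \<longleftrightarrow> ?le A B" if "A \<in> M" "B \<in> M" for A B
    using up_flips_iff that by (simp add: framing_lattice_def M_def)
  have car: "carrier (framing_lattice G F) = M" by (simp add: framing_lattice_def M_def)
  have CM: "C \<in> M" using C by (simp add: M_def)
  have least: "least (framing_lattice G F) C M \<longleftrightarrow> (\<forall>D\<in>M. ?le C D)"
    unfolding least_def car using CM le[OF CM] by blast
  have lub: "is_lub (framing_lattice G F) C {a, b} \<longleftrightarrow>
      ?le a C \<and> ?le b C \<and> (\<forall>D\<in>M. ?le a D \<longrightarrow> ?le b D \<longrightarrow> ?le C D)"
    if ab: "a \<in> M" "b \<in> M" for a b
  proof -
    have "Upper (framing_lattice G F) {a, b} = {D \<in> M. ?le a D \<and> ?le b D}"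
    proof (intro Set.set_eqI)
      fix D
      show "D \<in> Upper (framing_lattice G F) {a, b} \<longleftrightarrow> D \<in> {D \<in> M. ?le a D \<and> ?le b D}"
        unfolding Upper_def car using ab le[OF ab(1), of D] le[OF ab(2), of D] by (cases "D \<in> M") auto
    qed
    then have "is_lub (framing_lattice G F) C {a, b} \<longleftrightarrow>
        C \<in> {D \<in> M. ?le a D \<and> ?le b D} \<and> (\<forall>D\<in>{D \<in> M. ?le a D \<and> ?le b D}. le (framing_lattice G F) C D)"
      unfolding least_def car by auto
    also have "\<dots> \<longleftrightarrow> ?le a C \<and> ?le b C \<and> (\<forall>D\<in>M. ?le a D \<longrightarrow> ?le b D \<longrightarrow> ?le C D)"
      using CM le[OF CM] by auto
    finally show ?thesis .
  qed
  have inj: "set ` C = set ` a \<longleftrightarrow> C = a" if "a \<in> M" for a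
    using clique_image_inj[OF C, of a] that unfolding M_def mem_Collect_eq by metis
  have mC: "fe.mc (set ` C)" using C by (simp add: maximal_clique_iff)
  have "fe.join_irred (set ` C) \<longleftrightarrow> \<not> (\<forall>y. fe.mc y \<longrightarrow> fe.below (set ` C) y) \<and>
    (\<forall>a. fe.mc a \<longrightarrow> (\<forall>b. fe.mc b \<longrightarrow> fe.below a (set ` C) \<longrightarrow> fe.below b (set ` C) \<longrightarrow>
      (\<forall>u. fe.mc u \<longrightarrow> fe.below a u \<longrightarrow> fe.below b u \<longrightarrow> fe.below (set ` C) u) \<longrightarrow> set ` C = a \<or> set ` C = b))"
    unfolding fe.join_irred_def using mC by blast
  also have "\<dots> \<longleftrightarrow> \<not> (\<forall>D\<in>M. ?le C D) \<and>
      (\<forall>a\<in>M. \<forall>b\<in>M. ?le a C \<longrightarrow> ?le b C \<longrightarrow> (\<forall>D\<in>M. ?le a D \<longrightarrow> ?le b D \<longrightarrow> ?le C D) \<longrightarrow>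
         set ` C = set ` a \<or> set ` C = set ` b)"
    unfolding all ..
  also have "\<dots> \<longleftrightarrow> \<not> (\<forall>D\<in>M. ?le C D) \<and>
      (\<forall>a\<in>M. \<forall>b\<in>M. is_lub (framing_lattice G F) C {a, b} \<longrightarrow> C = a \<or> C = b)"
    by (intro arg_cong2[of _ _ _ _ "(\<and>)"] refl ball_cong) (simp only: lub inj, blast)
  also have "\<dots> \<longleftrightarrow> join_irreducible (framing_lattice G F) C"
    unfolding join_irreducible_def car least using CM by blast
  finally show ?thesis by simp
qed

lemma ccw_extended_path_iff:
  "ccw_extended_path G F P \<longleftrightarrow> (\<exists>u v. awalk u P v) \<and> fe.ccw_path (set P)"
proof
  assume a: "ccw_extended_path G F P"
  then obtain u v where w: "awalk u P v" by (auto simp: ccw_extended_path_def apath_iff)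
  have "2 \<le> length P" using a by (simp add: ccw_extended_path_def)
  then obtain b p where P: "P = b # p" "p \<noteq> []" by (cases P) (auto simp: Suc_le_eq)
  have b: "b \<in> arcs G" "u = tail G b" "awalk (head G b) p v" using w P(1) by (auto simp: awalk_Cons_iff)
  define c where "c = last P"
  have c: "c \<in> set p" "c \<in> set P" using P by (simp_all add: c_def)
  have cE: "c \<in> arcs G" using c awalk_arcs[OF w] by blast
  have "last (awalk_verts u P) = v" using w by (rule awalkE)
  then have "v = head G c" unfolding awalk_verts_conv c_def using P(1) by simp
  then have pth: "fe.path (set P) (lo b) (hi c)" using awalk_path[OF w] b(2) by simp
  have "hi b \<le> lo c" using awalk_path[OF b(3)] c(1) unfolding fe.path_def by blast
  moreover have "\<exists>a. il a b"
  proof -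
    obtain f where f: "f \<noteq> b" "(f, b) \<in> in_order F (head G b)"
      using a P(1) by (auto simp: ccw_extended_path_def)
    then have "il f b" using in_orderD[OF f(2) head_in_verts[OF b(1)]] by (simp add: il_def)
    then show ?thesis by blast
  qed
  moreover have "\<exists>d. ol c d"
  proof -
    obtain f where f: "f \<noteq> c" "(c, f) \<in> out_order F (tail G c)"
      using a by (auto simp: ccw_extended_path_def c_def)
    then have "ol c f" using cE by (simp add: ol_def)
    then show ?thesis by blast
  qed
  moreover have "b \<in> set P" using P(1) by simp
  ultimately have "fe.ccw_path (set P)" unfolding fe.ccw_path_def using pth c(2) by blast
  then show "(\<exists>u v. awalk u P v) \<and> fe.ccw_path (set P)" using w by blast
next
  assume a: "(\<exists>u v. awalk u P v) \<and> fe.ccw_path (set P)"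
  then obtain u v where w: "awalk u P v" by blast
  obtain b c where bc: "fe.path (set P) (lo b) (hi c)" "b \<in> set P" "c \<in> set P" "hi b \<le> lo c" "\<exists>a. il a b" "\<exists>d. ol c d"
    using conjunct2[OF a] unfolding fe.ccw_path_def by blast
  have str: "fe.strand (set P)" using bc(1) by (simp add: fe.path_def)
  have lt: "lo b < hi b" "lo c < hi c" using fe.strand_lt[OF str] bc by blast+
  have srt: "sorted_wrt (\<lambda>e f. hi e \<le> lo f) P" using awalk_sorted[OF w] .
  obtain p where P: "P = b # p"
  proof -
    obtain A B where AB: "P = A @ b # B" using split_list[OF bc(2)] by blast
    have "x \<notin> set A" for x
    proof
      assume x: "x \<in> set A"
      then have xP: "x \<in> set P" unfolding AB by simp
      have "hi x \<le> lo b" using srt x unfolding AB sorted_wrt_append by auto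
      moreover have "lo b \<le> lo x" using bc(1) xP unfolding fe.path_def by blast
      ultimately show False using fe.strand_lt[OF str xP] by simp
    qed
    then have "A = []" by (cases A) auto
    then show thesis using that AB by simp
  qed
  have last: "last P = c"
  proof -
    obtain A B where AB: "P = A @ c # B" using split_list[OF bc(3)] by blast
    have "x \<notin> set B" for x
    proof
      assume x: "x \<in> set B"
      then have xP: "x \<in> set P" unfolding AB by simp
      have "hi c \<le> lo x" using srt x unfolding AB sorted_wrt_append by auto
      moreover have "hi x \<le> hi c" using bc(1) xP unfolding fe.path_def by blast
      ultimately show False using fe.strand_lt[OF str xP] by simp
    qed
    then have "B = []" by (cases B) auto
    then show ?thesis using AB by simp
  qed
  have "b \<noteq> c" using bc(4) lt by auto
  then have "2 \<le> length P" using P last by (cases p) auto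
  moreover have "\<exists>f. f \<noteq> hd P \<and> (f, hd P) \<in> in_order F (head G (hd P))"
  proof -
    obtain a where a: "il a b" using bc(5) by blast
    then have "head G b = head G a" using in_orderD(4)[of a b "head G a"] by (simp add: il_def)
    then have "a \<noteq> hd P" "(a, hd P) \<in> in_order F (head G (hd P))" using a P by (auto simp: il_def)
    then show ?thesis by blast
  qed
  moreover have "\<exists>f. f \<noteq> last P \<and> (last P, f) \<in> out_order F (tail G (last P))"
  proof -
    obtain d where "ol c d" using bc(6) by blast
    then have "d \<noteq> last P" "(last P, d) \<in> out_order F (tail G (last P))" unfolding last ol_def by auto
    then show ?thesis by blast
  qed
  ultimately show "ccw_extended_path G F P"
    unfolding ccw_extended_path_def apath_iff using w by blast
qed

lemma bij_extended_paths: "bij_betw set {P. ccw_extended_path G F P} {M. fe.ccw_path M}"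
  unfolding bij_betw_def
proof
  show "inj_on set {P. ccw_extended_path G F P}"
  proof (rule inj_onI)
    fix P Q assume "P \<in> {P. ccw_extended_path G F P}" "Q \<in> {P. ccw_extended_path G F P}" "set P = set Q"
    then show "P = Q" unfolding mem_Collect_eq ccw_extended_path_iff using awalk_unique by blast
  qed
  show "set ` {P. ccw_extended_path G F P} = {M. fe.ccw_path M}"
  proof
    show "set ` {P. ccw_extended_path G F P} \<subseteq> {M. fe.ccw_path M}" by (auto simp: ccw_extended_path_iff)
    show "{M. fe.ccw_path M} \<subseteq> set ` {P. ccw_extended_path G F P}"
    proof
      fix M assume "M \<in> {M. fe.ccw_path M}"
      then have M: "fe.ccw_path M" by simp
      then obtain b c where bc: "fe.path M (lo b) (hi c)" "b \<in> M" "c \<in> M" unfolding fe.ccw_path_def by blast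
      have "fe.strand M" using bc(1) by (simp add: fe.path_def)
      then have bcE: "b \<in> arcs G" "c \<in> arcs G" using fe.strand_E bc(2,3) by blast+
      obtain P where P: "awalk (tail G b) P (head G c)" "set P = M"
        using path_awalk[OF bc(1) tail_in_verts[OF bcE(1)] head_in_verts[OF bcE(2)]] by blast
      have "ccw_extended_path G F P" unfolding ccw_extended_path_iff P(2) using M P(1) by blast
      then show "M \<in> set ` {P. ccw_extended_path G F P}" using P(2) by blast
    qed
  qed
qed

lemma bij_join_irreducibles:
  "\<exists>\<phi>. bij_betw \<phi> {C. join_irreducible (framing_lattice G F) C} {P. ccw_extended_path G F P}"
proof -
  let ?J = "{C. join_irreducible (framing_lattice G F) C}"
  have car: "maximal_clique G F C" if "join_irreducible (framing_lattice G F) C" for C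
    using that by (simp add: join_irreducible_def framing_lattice_def)
  have 1: "bij_betw ((`) set) ?J {x. fe.join_irred x}"
  proof (rule bij_betw_subset[OF bij_cliques])
    show "?J \<subseteq> {C. maximal_clique G F C}" using car by blast
    show "(`) set ` ?J = {x. fe.join_irred x}"
    proof
      show "(`) set ` ?J \<subseteq> {x. fe.join_irred x}" using car join_irreducible_iff by blast
      show "{x. fe.join_irred x} \<subseteq> (`) set ` ?J"
      proof
        fix x assume "x \<in> {x. fe.join_irred x}"
        then have x: "fe.join_irred x" by simp
        then have "fe.mc x" by (simp add: fe.join_irred_def)
        then obtain C where C: "maximal_clique G F C" "set ` C = x" by (rule clique_image_ex)
        have "join_irreducible (framing_lattice G F) C" unfolding join_irreducible_iff[OF C(1)] C(2) by (rule x)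
        then show "x \<in> (`) set ` ?J" using C(2) by blast
      qed
    qed
  qed
  note 2 = bij_betw_inv_into[OF fe.bij_least_avoiding] and 3 = bij_betw_inv_into[OF bij_extended_paths]
  show ?thesis by (rule exI, rule bij_betw_trans[OF 1 bij_betw_trans[OF 2 3]])
qed

end

section \<open>Meet-irreducibles by reversing the framing\<close>

definition reverse_framing :: "('v, 'e) framing \<Rightarrow> ('v, 'e) framing" where
  "reverse_framing F = \<lparr>in_order = \<lambda>v. (in_order F v)\<inverse>, out_order = \<lambda>v. (out_order F v)\<inverse>\<rparr>"

context framed_graph
begin

lemma framed_graph_reverse: "framed_graph G (reverse_framing F)"
proof
  fix v assume v: "v \<in> verts G"
  show "linear_order_on (in_arcs G v) (in_order (reverse_framing F) v)"
    using linear_in_order[OF v] by (simp add: reverse_framing_def)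
  show "linear_order_on (out_arcs G v) (out_order (reverse_framing F) v)"
    using linear_out_order[OF v] by (simp add: reverse_framing_def)
qed

text \<open>Framing orders are controlled only at vertices, hence the restriction to edges of
  \<open>G\<close>: for these \<open>e\<close> and \<open>f\<close> have the same head, so the
  definition can be read with them exchanged. The converse comes from reversing twice.\<close>

lemma in_less_reverseD:
  assumes "in_less G (reverse_framing F) v P Q" "set P \<subseteq> arcs G" "set Q \<subseteq> arcs G"
  shows "in_less G F v Q P"
proof -
  obtain A B S e f where *: "path_to G P v = A @ e # S" "path_to G Q v = B @ f # S" "e \<noteq> f"
    "(f, e) \<in> in_order F (head G e)"
    using assms(1) by (auto simp: in_less_def reverse_framing_def)
  have "e \<in> set (path_to G P v)" unfolding *(1) by simp
  then have "e \<in> arcs G" using assms(2) set_takeWhileD unfolding path_to_def by (metis subsetD)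
  then have "(f, e) \<in> in_order F (head G f)" using in_orderD(3)[OF *(4)] *(4) by simp
  then show ?thesis unfolding in_less_def using *(1-3) by metis
qed

lemma out_less_reverseD:
  assumes "out_less G (reverse_framing F) v P Q" "set P \<subseteq> arcs G" "set Q \<subseteq> arcs G"
  shows "out_less G F v Q P"
proof -
  obtain A B S e f where *: "path_from G v P = S @ e # A" "path_from G v Q = S @ f # B" "e \<noteq> f"
    "(f, e) \<in> out_order F (tail G e)"
    using assms(1) by (auto simp: out_less_def reverse_framing_def)
  have "e \<in> set (path_from G v P)" unfolding *(1) by simp
  then have "e \<in> arcs G" using assms(2) set_dropWhileD unfolding path_from_def by (metis subsetD)
  then have "(f, e) \<in> out_order F (tail G f)" using out_orderD(3)[OF *(4)] *(4) by simp
  then show ?thesis unfolding out_less_def using *(1-3) by metis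
qed

lemma cw_less_reverseD:
  assumes "cw_less G (reverse_framing F) v P Q" "set P \<subseteq> arcs G" "set Q \<subseteq> arcs G"
  shows "cw_less G F v Q P"
  using assms in_less_reverseD out_less_reverseD unfolding cw_less_def common_inner_vertex_def by blast

end

lemma reverse_reverse_framing: "in_order (reverse_framing (reverse_framing F)) = in_order F"
  "out_order (reverse_framing (reverse_framing F)) = out_order F"
  by (auto simp: reverse_framing_def)

context framed_graph
begin

lemma cw_less_reverse:
  assumes "set P \<subseteq> arcs G" "set Q \<subseteq> arcs G"
  shows "cw_less G (reverse_framing F) v P Q \<longleftrightarrow> cw_less G F v Q P"
proof
  assume "cw_less G F v Q P"
  then have "cw_less G (reverse_framing (reverse_framing F)) v Q P"
    unfolding cw_less_def in_less_def out_less_def reverse_reverse_framing .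
  then show "cw_less G (reverse_framing F) v P Q"
    using framed_graph.cw_less_reverseD[OF framed_graph_reverse] assms by blast
qed (use cw_less_reverseD assms in blast)

lemma clique_reverse: "clique G (reverse_framing F) C \<longleftrightarrow> clique G F C"
proof -
  have "coherent G (reverse_framing F) P Q \<longleftrightarrow> coherent G F P Q" if "route G P" "route G Q" for P Q
    using cw_less_reverse[OF route_arcs[OF that(1)] route_arcs[OF that(2)]]
      cw_less_reverse[OF route_arcs[OF that(2)] route_arcs[OF that(1)]]
    unfolding coherent_def incoherent_at_def by blast
  then show ?thesis unfolding clique_def pairwise_def by blast
qed

lemma maximal_clique_reverse: "maximal_clique G (reverse_framing F) C \<longleftrightarrow> maximal_clique G F C"
  unfolding maximal_clique_def clique_reverse ..

lemma up_flip_reverseD: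
  assumes "up_flip G (reverse_framing F) C C'"
  shows "up_flip G F C' C"
proof -
  have m: "maximal_clique G F C" "maximal_clique G F C'"
    using assms by (simp_all add: up_flip_def maximal_clique_reverse)
  obtain R R' u where R: "R \<in> C" "C' = (C - {R}) \<union> {R'}" "cw_less G (reverse_framing F) u R R'"
    using assms unfolding up_flip_def by blast
  have r: "route G R" "route G R'"
    using R(1,2) m unfolding maximal_clique_def clique_def by blast+
  have c: "cw_less G F u R' R" using R(3) cw_less_reverse[OF route_arcs[OF r(1)] route_arcs[OF r(2)]] by blast
  have "R' \<notin> C - {R}"
  proof
    assume "R' \<in> C - {R}"
    then have "coherent G F R' R" using R(1) m(1) unfolding maximal_clique_def clique_def pairwise_def by blast
    moreover have "common_inner_vertex G R' R u" using c by (simp add: cw_less_def)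
    ultimately show False using c unfolding coherent_def incoherent_at_def by blast
  qed
  then have "C = (C' - {R'}) \<union> {R}" unfolding R(2) using R(1) by blast
  moreover have "R' \<in> C'" unfolding R(2) by simp
  ultimately show ?thesis unfolding up_flip_def using m c by blast
qed

text \<open>With the edges kept in place, both comparisons in \<open>cw_less\<close> turn around,
  unlike in \<open>rv_cw\<close>, where edges and framing are reversed together.\<close>

lemma up_flip_reverse: "up_flip G (reverse_framing F) = (up_flip G F)\<inverse>\<inverse>"
proof (intro ext)
  fix C C'
  have "up_flip G (reverse_framing (reverse_framing F)) = up_flip G F"
    unfolding up_flip_def maximal_clique_def clique_def coherent_def incoherent_at_def cw_less_def in_less_def
      out_less_def pairwise_def reverse_reverse_framing ..
  then show "up_flip G (reverse_framing F) C C' = (up_flip G F)\<inverse>\<inverse> C C'"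
    using up_flip_reverseD framed_graph.up_flip_reverseD[OF framed_graph_reverse] by auto
qed

lemma meet_irreducible_reverse:
  "meet_irreducible (framing_lattice G F) C \<longleftrightarrow> join_irreducible (framing_lattice G (reverse_framing F)) C"
proof -
  let ?L = "framing_lattice G F" and ?L' = "framing_lattice G (reverse_framing F)"
  have car: "carrier ?L' = carrier ?L" by (simp add: framing_lattice_def maximal_clique_reverse)
  have le: "le ?L' A B = le ?L B A" for A B
    by (simp add: framing_lattice_def up_flip_reverse rtranclp_conversep)
  have "least ?L' C A = greatest ?L C A" for A unfolding least_def greatest_def car le ..
  moreover have "Upper ?L' A = Lower ?L A" for A unfolding Upper_def Lower_def car le ..
  ultimately show ?thesis unfolding meet_irreducible_def join_irreducible_def car by simp
qed

lemma cw_extended_path_reverse: "cw_extended_path G F P \<longleftrightarrow> ccw_extended_path G (reverse_framing F) P"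
  by (simp add: cw_extended_path_def ccw_extended_path_def reverse_framing_def)

end

theorem theorem4p4:
  fixes G :: "('v::linorder, 'e) pre_digraph" and F :: "('v, 'e) framing"
  assumes "framed_graph G F"
  shows "(\<exists>\<phi>. bij_betw \<phi> {C. join_irreducible (framing_lattice G F) C} {P. ccw_extended_path G F P}) \<and>
    (\<exists>\<psi>. bij_betw \<psi> {C. meet_irreducible (framing_lattice G F) C} {P. cw_extended_path G F P})"
proof -
  interpret framed_graph G F by (rule assms)
  interpret rev: framed_graph G "reverse_framing F" by (rule framed_graph_reverse)
  show ?thesis
    unfolding meet_irreducible_reverse cw_extended_path_reverse
    using bij_join_irreducibles rev.bij_join_irreducibles by blast
qed

end
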